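(* Let $\mathfrak g$ be a simple Lie algebra endowed with the invariant scalar product $\langle\cdot,\cdot\rangle=\lambda\cdot(\text{Killing form})$, $\lambda\neq 0$, and let $w_{\mathfrak g}$ be the associated Lie algebra weight system and $\bar w_{\mathfrak g}=w_{\mathfrak g}\circ\pi$. Then for all integers $i\ge 1$, $j\ge 0$, $$\bar w_{\mathfrak g}(J_{i,j})=\bar w_{\mathfrak g}(J_{i-1,j+1})+\frac{1}{\lambda}\,\bar w_{\mathfrak g}(J_{i-1,j}).$$
   Context: A closed Jacobi diagram is a connected graph consisting of a distinguished oriented circle (the Wilson loop) together with vertices on the loop (each incident to exactly one edge off the loop, called a leg) and internal trivalent vertices off the loop, each with a fixed cyclic order of its three half-edges; its degree is half its number of vertices. Chord diagrams are those closed diagrams with no internal vertices. The internal graph is obtained by deleting the Wilson loop; its connected components are the components of the diagram. Let $\mathcal C$ be the vector space spanned by closed diagrams modulo the STU relations $S=T-U$, where $S$ has an internal vertex joined to the loop by a leg and to two further half-edges $x,y$ (in the vertex's cyclic order), and $T$, $U$ are obtained by deleting that vertex and attaching $x,y$ directly to two adjacent points of the loop, in the order $x,y$ along the loop orientation for $T$ and $y,x$ for $U$. $\mathcal C$ is isomorphic to the space $\mathcal A^{fr}$ of chord diagrams modulo 4-term relations, and is a commutative cocommutative connected graded Hopf algebra: the product glues two Wilson loops by cutting them, and the coproduct is $\delta(D)=\sum_{J\subseteq [D]}D_J\otimes D_{\bar J}$ over subsets $J$ of the set $[D]$ of components. The projection $\pi$ onto primitive elements along the subspace of decomposable elements (products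 of elements of positive degree) is $$\pi(D)=D-\sum_{i\ge 2}(-1)^i(i-1)!\sum_{[D_1]\sqcup\dots\sqcup[D_i]=[D],\ [D_j]\ne\emptyset}D_1\cdots D_i,$$ the inner sum over unordered splittings of the set of components into nonempty parts, $D_j$ the subdiagram formed by the components in $[D_j]$. For a Lie algebra $\mathfrak g$ with a nondegenerate invariant form, basis $e_1,\dots,e_m$ and dual basis $e_1^*,\dots,e_m^*$, the weight system $w_{\mathfrak g}$ sends a chord diagram $D$ with $n$ chords to the element of $ZU(\mathfrak g)$ obtained by choosing a base point on the loop, labelling the first endpoint of each chord $a$ by $e_{i_a}$ and the second by $e_{i_a}^*$, multiplying the labels in the order along the loop and summing over all $i_a\in\{1,\dots,m\}$; it satisfies the 4-term relations and extends linearly to $\mathcal C$ via the STU relations. Write $\bar w_{\mathfrak g}=w_{\mathfrak g}\circ\pi$. The diagram $J_{i,j}$ ($i,j\ge0$), of degree $i+j+2$, is drawn in the plane inside its Wilson loop (loop oriented counterclockwise, internal vertices oriented counterclockwise by the planar drawing). Counterclockwise along the loop take points $p_1$, then $a_1,\dots,a_j$, then $p_2$, $p_3$, then $b_j,\dots,b_1$, then $p_4$ (so $p_1,p_2$ lie on the upper arc, $p_3,p_4$ on the lower arc, $p_2,p_3$ on the left and $p_4,p_1$ on the right), with chords $a_kb_k$, $k=1,\dots,j$ (mutually parallel, each separating $\{p_2,p_3\}$ from $\{p_1,p_4\}$). If $i=0$, the remaining part consists of the two chords $p_1p_2$ and $p_3p_4$, so $J_{0,j}$ is a chord diagram whose intersection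 graph is the complete bipartite graph $K_{2,j}$. If $i\ge1$, the remaining part is a planar ladder: internal vertices $u_1,\dots,u_i$ (upper rail) and $v_1,\dots,v_i$ (lower rail), edges $u_ku_{k+1}$, $v_kv_{k+1}$ ($1\le k<i$), rungs $u_kv_k$ ($1\le k\le i$), and legs $u_1p_2$, $v_1p_3$, $u_ip_1$, $v_ip_4$ (thus $i-1$ square cells, and the $j$ chords cross both rails). In particular $J_{i,0}$ is the ladder with $i$ rungs and four legs. *)

theory Defs
  imports Complex_Main "HOL-Library.FuncSet" "HOL-Library.Disjoint_Sets"
begin

section \<open>Lie algebras given by structure constants (basis e_0..e_{m-1})\<close>

text \<open>[e_a, e_b] = sum over k < m of c a b k e_k.\<close>

definition lie_alg :: "nat \<Rightarrow> (nat \<Rightarrow> nat \<Rightarrow> nat \<Rightarrow> complex) \<Rightarrow> bool" where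
  "lie_alg m c \<longleftrightarrow>
     (\<forall>a<m. \<forall>b<m. \<forall>k<m. c a b k = - c b a k) \<and>
     (\<forall>a<m. \<forall>b<m. \<forall>d<m. \<forall>l<m.
        (\<Sum>k<m. c b d k * c a k l) + (\<Sum>k<m. c d a k * c b k l) + (\<Sum>k<m. c a b k * c d k l) = 0)"

definition lvecs :: "nat \<Rightarrow> (nat \<Rightarrow> complex) set" where
  "lvecs m = {v. \<forall>i\<ge>m. v i = 0}"

definition lbracket :: "nat \<Rightarrow> (nat \<Rightarrow> nat \<Rightarrow> nat \<Rightarrow> complex) \<Rightarrow> (nat \<Rightarrow> complex) \<Rightarrow> (nat \<Rightarrow> complex) \<Rightarrow> nat \<Rightarrow> complex" where
  "lbracket m c v w k = (if k < m then (\<Sum>a<m. \<Sum>b<m. v a * w b * c a b k) else 0)"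

definition lie_ideal :: "nat \<Rightarrow> (nat \<Rightarrow> nat \<Rightarrow> nat \<Rightarrow> complex) \<Rightarrow> (nat \<Rightarrow> complex) set \<Rightarrow> bool" where
  "lie_ideal m c S \<longleftrightarrow> S \<subseteq> lvecs m \<and> (\<lambda>_. 0) \<in> S \<and>
     (\<forall>x\<in>S. \<forall>y\<in>S. (\<lambda>i. x i + y i) \<in> S) \<and>
     (\<forall>r. \<forall>x\<in>S. (\<lambda>i. r * x i) \<in> S) \<and>
     (\<forall>x\<in>lvecs m. \<forall>s\<in>S. lbracket m c x s \<in> S)"

text \<open>Simple (complex) Lie algebra: non-abelian, only trivial ideals.\<close>
definition simple_lie :: "nat \<Rightarrow> (nat \<Rightarrow> nat \<Rightarrow> nat \<Rightarrow> complex) \<Rightarrow> bool" where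
  "simple_lie m c \<longleftrightarrow> lie_alg m c \<and> (\<exists>a<m. \<exists>b<m. \<exists>k<m. c a b k \<noteq> 0) \<and>
     (\<forall>S. lie_ideal m c S \<longrightarrow> S = {\<lambda>_. 0} \<or> S = lvecs m)"

text \<open>Killing form: K(e_a,e_b) = tr(ad e_a ad e_b).\<close>
definition killing :: "nat \<Rightarrow> (nat \<Rightarrow> nat \<Rightarrow> nat \<Rightarrow> complex) \<Rightarrow> nat \<Rightarrow> nat \<Rightarrow> complex" where
  "killing m c a b = (\<Sum>i<m. \<Sum>k<m. c b i k * c a k i)"

text \<open>Invariant form <.,.> = lam * Killing (Gram matrix).\<close>
definition gform :: "nat \<Rightarrow> (nat \<Rightarrow> nat \<Rightarrow> nat \<Rightarrow> complex) \<Rightarrow> complex \<Rightarrow> nat \<Rightarrow> nat \<Rightarrow> complex" where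
  "gform m c lam a b = lam * killing m c a b"

text \<open>Inverse Gram matrix: dual basis e_i^* = sum_j ginv j i e_j.\<close>
definition ginv :: "nat \<Rightarrow> (nat \<Rightarrow> nat \<Rightarrow> nat \<Rightarrow> complex) \<Rightarrow> complex \<Rightarrow> nat \<Rightarrow> nat \<Rightarrow> complex" where
  "ginv m c lam = (SOME M. \<forall>a<m. \<forall>b<m.
      (\<Sum>k<m. gform m c lam a k * M k b) = (if a = b then 1 else 0))"

text \<open><[e_a,e_b],e_d>\<close>
definition trip :: "nat \<Rightarrow> (nat \<Rightarrow> nat \<Rightarrow> nat \<Rightarrow> complex) \<Rightarrow> complex \<Rightarrow> nat \<Rightarrow> nat \<Rightarrow> nat \<Rightarrow> complex" where
  "trip m c lam a b d = (\<Sum>k<m. c a b k * gform m c lam k d)"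

section \<open>Free associative algebra and U(g)\<close>

type_synonym falg = "nat list \<Rightarrow> complex"

definition fa_word :: "nat list \<Rightarrow> falg" where
  "fa_word xs = (\<lambda>w. if w = xs then 1 else 0)"
definition fa_add :: "falg \<Rightarrow> falg \<Rightarrow> falg" where
  "fa_add f g = (\<lambda>w. f w + g w)"
definition fa_sub :: "falg \<Rightarrow> falg \<Rightarrow> falg" where
  "fa_sub f g = (\<lambda>w. f w - g w)"
definition fa_smult :: "complex \<Rightarrow> falg \<Rightarrow> falg" where
  "fa_smult r f = (\<lambda>w. r * f w)"
definition fa_mult :: "falg \<Rightarrow> falg \<Rightarrow> falg" where
  "fa_mult f g = (\<lambda>w. \<Sum>k\<le>length w. f (take k w) * g (drop k w))"

text \<open>Two-sided ideal generated by x y - y x - [x,y]; U(g) = free algebra / ideal.\<close>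
inductive_set ug_ideal :: "nat \<Rightarrow> (nat \<Rightarrow> nat \<Rightarrow> nat \<Rightarrow> complex) \<Rightarrow> falg set"
  for m c where
  gen: "a < m \<Longrightarrow> b < m \<Longrightarrow>
     (\<lambda>w. fa_word [a,b] w - fa_word [b,a] w - (\<Sum>k<m. c a b k * fa_word [k] w)) \<in> ug_ideal m c"
| zero: "(\<lambda>_. 0) \<in> ug_ideal m c"
| add: "x \<in> ug_ideal m c \<Longrightarrow> y \<in> ug_ideal m c \<Longrightarrow> fa_add x y \<in> ug_ideal m c"
| smult: "x \<in> ug_ideal m c \<Longrightarrow> fa_smult r x \<in> ug_ideal m c"
| mult: "x \<in> ug_ideal m c \<Longrightarrow> fa_mult (fa_mult (fa_word u) x) (fa_word v) \<in> ug_ideal m c"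

definition U_eq :: "nat \<Rightarrow> (nat \<Rightarrow> nat \<Rightarrow> nat \<Rightarrow> complex) \<Rightarrow> falg \<Rightarrow> falg \<Rightarrow> bool" where
  "U_eq m c x y \<longleftrightarrow> fa_sub x y \<in> ug_ideal m c"

section \<open>Closed Jacobi diagrams (half-edge representation)\<close>

text \<open>loop: half-edges attached to the Wilson loop, in loop order from a base point;
  verts: internal trivalent vertices, each a triple of half-edges in cyclic order;
  edges: pairs of half-edges glued to an edge.\<close>
record diagram =
  dloop :: "nat list"
  dverts :: "(nat \<times> nat \<times> nat) list"
  dedges :: "(nat \<times> nat) list"

definition halfedges :: "diagram \<Rightarrow> nat set" where
  "halfedges D = set (dloop D) \<union> (\<Union>(a,b,d)\<in>set (dverts D). {a,b,d})"

definition adj :: "diagram \<Rightarrow> nat rel" where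
  "adj D = set (dedges D) \<union> (\<Union>(a,b,d)\<in>set (dverts D). {(a,b),(b,d)})"

text \<open>Components of the internal graph, as sets of half-edges.\<close>
definition comps :: "diagram \<Rightarrow> nat set set" where
  "comps D = halfedges D // ((adj D \<union> (adj D)\<inverse>)\<^sup>*)"

definition subdiag :: "diagram \<Rightarrow> nat set \<Rightarrow> diagram" where
  "subdiag D U = \<lparr> dloop = filter (\<lambda>h. h \<in> U) (dloop D),
                  dverts = filter (\<lambda>(a,_,_). a \<in> U) (dverts D),
                  dedges = filter (\<lambda>(a,_). a \<in> U) (dedges D) \<rparr>"

text \<open>Product: cut the two Wilson loops at their base points and glue.\<close>
definition dmult :: "diagram \<Rightarrow> diagram \<Rightarrow> diagram" where
  "dmult D1 D2 = \<lparr> dloop = dloop D1 @ dloop D2, dverts = dverts D1 @ dverts D2,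
                  dedges = dedges D1 @ dedges D2 \<rparr>"

definition dunit :: diagram where
  "dunit = \<lparr> dloop = [], dverts = [], dedges = [] \<rparr>"

section \<open>Lie algebra weight system\<close>

text \<open>State sum: each half-edge gets a basis label; an edge with labels p,q contributes
  ginv q p (i.e. labels e_i and e_i^*), an internal vertex with cyclic labels a,b,d contributes
  <[e_a,e_b],e_d> (the extension forced by STU), the loop gives the word of its labels.\<close>
definition wsys :: "nat \<Rightarrow> (nat \<Rightarrow> nat \<Rightarrow> nat \<Rightarrow> complex) \<Rightarrow> complex \<Rightarrow> diagram \<Rightarrow> falg" where
  "wsys m c lam D = (\<lambda>w. \<Sum>f \<in> (halfedges D \<rightarrow>\<^sub>E {..<m}).
      (prod_list (map (\<lambda>(x,y). ginv m c lam (f y) (f x)) (dedges D)) *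
       prod_list (map (\<lambda>(a,b,d). trip m c lam (f a) (f b) (f d)) (dverts D))) *
      (if map f (dloop D) = w then 1 else 0))"

text \<open>Product D_1 ... D_i of the subdiagrams for the blocks of a splitting P.\<close>
definition split_prod :: "diagram \<Rightarrow> nat set set set \<Rightarrow> diagram" where
  "split_prod D P = foldr dmult (map (\<lambda>B. subdiag D (\<Union>B)) (SOME ps. distinct ps \<and> set ps = P)) dunit"

text \<open>wbar = w o pi.\<close>
definition wbar :: "nat \<Rightarrow> (nat \<Rightarrow> nat \<Rightarrow> nat \<Rightarrow> complex) \<Rightarrow> complex \<Rightarrow> diagram \<Rightarrow> falg" where
  "wbar m c lam D = (\<lambda>w. wsys m c lam D w -
     (\<Sum>P \<in> {P. partition_on (comps D) P \<and> card P \<ge> 2}.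
        (-1) ^ card P * of_nat (fact (card P - 1)) * wsys m c lam (split_prod D P) w))"

section \<open>The diagrams J_{i,j}\<close>

text \<open>Half-edges: p1=0, p2=1, p3=2, p4=3 at the loop; a_k = 2k+2, b_k = 2k+3 (1 \<le> k \<le> j).
  For ladder vertex number k (1..i), with s = 2j+4+6(k-1): u_k has half-edges
  s (towards right), s+1 (towards left), s+2 (down); v_k has s+3 (right), s+4 (up), s+5 (left).
  Counterclockwise cyclic orders: u_k = (right, left, down), v_k = (right, up, left).\<close>
definition Jdiag :: "nat \<Rightarrow> nat \<Rightarrow> diagram" where
  "Jdiag i j =
    (let a = (\<lambda>k. 2*k+2); b = (\<lambda>k. 2*k+3); s = (\<lambda>k. 2*j+4+6*(k-1));
         chords = map (\<lambda>k. (a k, b k)) [1..<j+1]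
     in \<lparr> dloop = [0] @ map a [1..<j+1] @ [1,2] @ rev (map b [1..<j+1]) @ [3],
          dverts = (if i = 0 then [] else
                    concat (map (\<lambda>k. [(s k, s k + 1, s k + 2), (s k + 3, s k + 4, s k + 5)]) [1..<i+1])),
          dedges = (if i = 0 then [(0,1),(2,3)] @ chords else
                    map (\<lambda>k. (s k + 2, s k + 4)) [1..<i+1] @
                    map (\<lambda>k. (s k, s (k+1) + 1)) [1..<i] @
                    map (\<lambda>k. (s k + 3, s (k+1) + 5)) [1..<i] @
                    [(s 1 + 1, 1), (s 1 + 5, 2), (s i, 0), (s i + 3, 3)] @ chords) \<rparr>)"

end

theory Submission
  imports Defs "Jordan_Normal_Form.Jordan_Normal_Form_Existence" "HOL-Library.Function_Algebras"
begin

text \<open>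
  Write \<open>\<Phi>(x) = \<Sum> e\<^sub>a x e\<^sub>a\<^sup>*\<close> for the enclosure of \<open>x\<close> by a chord and \<open>C = \<Phi>(1)\<close> for the central Casimir element. As the
  form is \<open>\<lambda>\<close> times the Killing form, \<open>C\<close> acts on the adjoint representation by \<open>1/\<lambda>\<close>, so
  \<open>\<Phi>(x) = (C - 1/(2\<lambda>)) x\<close> for \<open>x\<close> in the Lie algebra. Resolving both ends of the leftmost rung of the ladder by STU
  moves that rung to a chord in four positions: across both legs, across one of them (twice), and across none. With
  \<open>X\<^sub>i(n)\<close> the value of the ladder with \<open>i\<close> rungs crossed by \<open>n\<close> chords, this reads
  \<open>X\<^sub>i\<^sub>+\<^sub>1(n) = X\<^sub>i(n+1) + (1/\<lambda> - C) X\<^sub>i(n)\<close>.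

  In every splitting all parts other than the one containing the ladder are products of parallel chords, that is, powers of
  \<open>C\<close>. Adding one more chord to all splittings therefore turns the projection to primitive elements into the recursion
  \<open>F\<^sub>j\<^sub>+\<^sub>1(X) = F\<^sub>j(X shifted) - C F\<^sub>j(X)\<close>, and the term \<open>C X\<close> cancels. For \<open>i = 0\<close> the ladder consists of two chords; the
  splittings that separate them contribute a term that is multiplied by \<open>-1/\<lambda>\<close> when a chord is added, so it drops out as well.

  That the dual basis exists is Cartan's criterion: the Killing form of a simple Lie algebra does not vanish, for
  otherwise every \<open>ad x\<close> would be nilpotent, which Engel's theorem excludes.
\<close>

section \<open>The Killing form of a simple Lie algebra\<close>

text \<open>The leftmost rung is the one to resolve because its legs end at p2 and p3, which are
  neighbours among the core endpoints and lie inside all parallel chords. The value of the diagram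
  is \<open>E p * (Phi ^^ n) (E x * E y) * E q\<close> contracted with the ladder, so the chord made
  from the rung is a new innermost chord, and the remaining rungs act on the labels
  \<open>x\<close>, \<open>y\<close> by a linear operator; a relation for one rung therefore passes
  to ladders of every length. Each of the two positions in which the chord crosses a single leg
  contributes 1/(2\<lambda>), and together they give the 1/\<lambda> of the formula. The same half
  explains the factor -1/\<lambda> for \<open>i = 0\<close>. If the two core chords lie in different
  parts, a new chord may join either of these parts, where it acts by C - 1/(2\<lambda>), while
  everywhere else it acts by C. The coefficients of C add up to zero and twice -1/(2\<lambda>)
  remains. The parts of a splitting are multiplied in an unspecified order, and all relations hold
  only in the enveloping algebra. Centrality of C is what makes the values independent of that
  order.\<close>

lemma jordan_matrix_entries:
  fixes n_as :: "(nat \<times> 'a::{zero,one}) list"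
  shows "\<exists>\<alpha> \<epsilon>. (\<forall>i j. i < sum_list (map fst n_as) \<longrightarrow> j < sum_list (map fst n_as) \<longrightarrow>
      jordan_matrix n_as $$ (i,j) = (if i = j then \<alpha> j else if Suc i = j then \<epsilon> j else 0)) \<and>
     (\<forall>j. Suc j < sum_list (map fst n_as) \<longrightarrow> \<epsilon> (Suc j) \<noteq> 0 \<longrightarrow> \<alpha> (Suc j) = \<alpha> j)"
proof (induction n_as)
  case Nil
  then show ?case by auto
next
  case (Cons na n_as)
  obtain n a where na: "na = (n,a)" by (cases na)
  let ?s = "sum_list (map fst n_as)"
  from Cons obtain \<alpha> \<epsilon> where
    J: "\<And>i j. i < ?s \<Longrightarrow> j < ?s \<Longrightarrow>
      jordan_matrix n_as $$ (i,j) = (if i = j then \<alpha> j else if Suc i = j then \<epsilon> j else 0)"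
    and e: "\<And>j. Suc j < ?s \<Longrightarrow> \<epsilon> (Suc j) \<noteq> 0 \<Longrightarrow> \<alpha> (Suc j) = \<alpha> j" by blast
  define \<alpha>' where "\<alpha>' = (\<lambda>j. if j < n then a else \<alpha> (j - n))"
  \<comment> \<open>Column \<open>n\<close> is the first column of the next Jordan block, so its
    superdiagonal entry is zero.\<close>
  define \<epsilon>' where "\<epsilon>' = (\<lambda>j. if j < n then 1 else if j = n then 0 else \<epsilon> (j - n))"
  show ?case unfolding na
  proof (rule exI[of _ \<alpha>'], rule exI[of _ \<epsilon>'], intro conjI allI impI)
    fix i j
    assume "i < sum_list (map fst ((n, a) # n_as))" "j < sum_list (map fst ((n, a) # n_as))"
    then show "jordan_matrix ((n, a) # n_as) $$ (i, j)
        = (if i = j then \<alpha>' j else if Suc i = j then \<epsilon>' j else 0)"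
      unfolding jordan_matrix_Cons by (auto simp: J \<alpha>'_def \<epsilon>'_def)
  next
    fix j
    assume j: "Suc j < sum_list (map fst ((n, a) # n_as))" and nz: "\<epsilon>' (Suc j) \<noteq> 0"
    show "\<alpha>' (Suc j) = \<alpha>' j"
    proof (cases "Suc j \<le> n")
      case True
      then show ?thesis using nz by (auto simp: \<alpha>'_def \<epsilon>'_def split: if_splits)
    next
      case False
      then have "Suc j - n = Suc (j - n)" by simp
      then show ?thesis using nz j False e[of "j - n"] by (auto simp: \<alpha>'_def \<epsilon>'_def)
    qed
  qed
qed

text \<open>Column \<open>j\<close> of \<open>P\<close> is the \<open>j\<close>-th vector of a
  Jordan basis. Index functions replace matrices so that the result combines with sums over
  structure constants. The last property says that a Jordan chain stays inside one generalised
  eigenspace.\<close>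

lemma jordan_basis:
  fixes A :: "nat \<Rightarrow> nat \<Rightarrow> complex"
  obtains P Q \<alpha> \<epsilon> where
    "\<And>i j. i < m \<Longrightarrow> j < m \<Longrightarrow> (\<Sum>k<m. P i k * Q k j) = (if i = j then 1 else 0)"
    "\<And>i j. i < m \<Longrightarrow> j < m \<Longrightarrow> (\<Sum>k<m. Q i k * P k j) = (if i = j then 1 else 0)"
    "\<And>i j. i < m \<Longrightarrow> j < m \<Longrightarrow>
      (\<Sum>k<m. A i k * P k j) = \<alpha> j * P i j + (if j = 0 then 0 else \<epsilon> j * P i (j - 1))"
    "\<And>j. Suc j < m \<Longrightarrow> \<epsilon> (Suc j) \<noteq> 0 \<Longrightarrow> \<alpha> (Suc j) = (\<alpha> j :: complex)"
proof -
  define M where "M = mat m m (\<lambda>(i,j). A i j)"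
  have M: "M \<in> carrier_mat m m" by (simp add: M_def)
  obtain as where "char_poly M = (\<Prod>a\<leftarrow>as. [:- a, 1:])" using char_poly_factorized[OF M] by blast
  then obtain n_as where "jordan_nf M n_as" using jordan_nf_exists[OF M] by blast
  then have "similar_mat M (jordan_matrix n_as)" by (simp add: jordan_nf_def)
  then obtain P Q where "similar_mat_wit M (jordan_matrix n_as) P Q" by (auto simp: similar_mat_def)
  then have c: "jordan_matrix n_as \<in> carrier_mat m m" "P \<in> carrier_mat m m" "Q \<in> carrier_mat m m"
    and PQ: "P * Q = 1\<^sub>m m" and QP: "Q * P = 1\<^sub>m m" and MJ: "M = P * jordan_matrix n_as * Q"
    using similar_mat_witD2[OF M] by auto
  let ?J = "jordan_matrix n_as"
  have s: "sum_list (map fst n_as) = m" using c(1) by (metis carrier_matD(1) jordan_matrix_dim(1))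
  obtain \<alpha> \<epsilon> where
    J: "\<And>i j. i < m \<Longrightarrow> j < m \<Longrightarrow> ?J $$ (i,j) = (if i = j then \<alpha> j else if Suc i = j then \<epsilon> j else 0)"
    and e: "\<And>j. Suc j < m \<Longrightarrow> \<epsilon> (Suc j) \<noteq> 0 \<Longrightarrow> \<alpha> (Suc j) = \<alpha> j"
    using jordan_matrix_entries[of n_as] unfolding s by blast
  have MP: "M * P = P * ?J"
  proof -
    have "M * P = P * ?J * (Q * P)" unfolding MJ using c by (simp add: assoc_mult_mat[of _ m m _ m _ m])
    then show ?thesis using c QP by (metis mult_carrier_mat right_mult_one_mat)
  qed
  have mult: "(\<Sum>k<m. X $$ (i,k) * Y $$ (k,j)) = (X * Y) $$ (i,j)"
    if "X \<in> carrier_mat m m" "Y \<in> carrier_mat m m" "i < m" "j < m" for X Y :: "complex mat" and i j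
    using that by (simp add: scalar_prod_def atLeast0LessThan)
  show thesis
  proof (rule that[of "\<lambda>i j. P $$ (i,j)" "\<lambda>i j. Q $$ (i,j)" \<alpha> \<epsilon>])
    fix i j assume ij: "i < m" "j < m"
    show "(\<Sum>k<m. P $$ (i,k) * Q $$ (k,j)) = (if i = j then 1 else 0)"
      using mult[OF c(2,3) ij] PQ ij by simp
    show "(\<Sum>k<m. Q $$ (i,k) * P $$ (k,j)) = (if i = j then 1 else 0)"
      using mult[OF c(3,2) ij] QP ij by simp
    have "(\<Sum>k<m. A i k * P $$ (k,j)) = (M * P) $$ (i,j)"
      unfolding mult[OF M c(2) ij, symmetric] using ij by (intro sum.cong) (auto simp: M_def)
    also have "\<dots> = (\<Sum>k<m. P $$ (i,k) * ?J $$ (k,j))"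
      unfolding MP using mult[OF c(2,1) ij] by simp
    also have "\<dots> = (\<Sum>k<m. (if k = j then \<alpha> j * P $$ (i,j) else 0) +
        (if Suc k = j then \<epsilon> j * P $$ (i,k) else 0))"
      using ij by (intro sum.cong) (auto simp: J)
    also have "\<dots> = \<alpha> j * P $$ (i,j) + (if j = 0 then 0 else \<epsilon> j * P $$ (i, j - 1))"
    proof (cases j)
      case 0 then show ?thesis using ij by (simp add: sum.distrib)
    next
      case (Suc j')
      then have "(\<Sum>k<m. if Suc k = j then \<epsilon> j * P $$ (i,k) else 0) = \<epsilon> j * P $$ (i, j')"
        using ij sum.delta[of "{..<m}" j' "\<lambda>k. \<epsilon> j * P $$ (i,k)"] by simp
      then show ?thesis using ij Suc by (simp add: sum.distrib)
    qed
    finally show "(\<Sum>k<m. A i k * P $$ (k,j)) = \<alpha> j * P $$ (i,j) + (if j = 0 then 0 else \<epsilon> j * P $$ (i, j - 1))" .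
  qed (use e in auto)
qed

section \<open>Endomorphisms of the coordinate space and their traces\<close>

definition vscale :: "complex \<Rightarrow> (nat \<Rightarrow> complex) \<Rightarrow> nat \<Rightarrow> complex" where
  "vscale r v = (\<lambda>i. r * v i)"

text \<open>Provides span, subspace and independence for coordinate vectors. The ambient space of
  all sequences is infinite-dimensional; the Lie algebra is its subspace
  \<open>lvecs m\<close>.\<close>

interpretation cvec: vector_space vscale
  by unfold_locales (auto simp: vscale_def fun_eq_iff algebra_simps)

definition unitv :: "nat \<Rightarrow> nat \<Rightarrow> complex" where
  "unitv k = (\<lambda>i. if i = k then 1 else 0)"

lemma unitv_in_lvecs: "k < m \<Longrightarrow> unitv k \<in> lvecs m"
  by (auto simp: unitv_def lvecs_def)

lemma subspace_lvecs: "cvec.subspace (lvecs m)"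
  by (auto simp: cvec.subspace_def lvecs_def vscale_def)

lemma sum_fun_apply: "(\<Sum>k\<in>S. F k) x = (\<Sum>k\<in>S. F k x)" for F :: "'b \<Rightarrow> 'c \<Rightarrow> 'a::comm_monoid_add"
  by (induction S rule: infinite_finite_induct) auto

lemma lvecs_expand:
  assumes "v \<in> lvecs m"
  shows "v = (\<Sum>k<m. vscale (v k) (unitv k))"
proof
  fix i
  have "(\<Sum>k<m. vscale (v k) (unitv k)) i = (\<Sum>k<m. if i = k then v k else 0)"
    unfolding sum_fun_apply by (intro sum.cong) (auto simp: vscale_def unitv_def)
  then show "v i = (\<Sum>k<m. vscale (v k) (unitv k)) i"
    using assms by (cases "i < m") (auto simp: lvecs_def)
qed

text \<open>Endomorphisms of the coordinate space, extended by zero beyond coordinate \<open>m\<close>.\<close>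
definition lin_op :: "nat \<Rightarrow> ((nat \<Rightarrow> complex) \<Rightarrow> nat \<Rightarrow> complex) \<Rightarrow> bool" where
  "lin_op m T \<longleftrightarrow> (\<forall>x y. T (x + y) = T x + T y) \<and> (\<forall>r x. T (vscale r x) = vscale r (T x)) \<and>
     (\<forall>x. T x \<in> lvecs m)"

lemma lin_op_add: "lin_op m T \<Longrightarrow> T (x + y) = T x + T y"
  and lin_op_scale: "lin_op m T \<Longrightarrow> T (vscale r x) = vscale r (T x)"
  and lin_op_lvecs: "lin_op m T \<Longrightarrow> T x \<in> lvecs m"
  by (auto simp: lin_op_def)

lemma lin_op_zero: "lin_op m T \<Longrightarrow> T 0 = 0"
  using lin_op_add[of m T 0 0] by simp

lemma lin_op_sum: "lin_op m T \<Longrightarrow> T (\<Sum>k\<in>S. F k) = (\<Sum>k\<in>S. T (F k))"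
  by (induction S rule: infinite_finite_induct) (auto simp: lin_op_add lin_op_zero)

lemma lin_op_comp: "lin_op m S \<Longrightarrow> lin_op m T \<Longrightarrow> lin_op m (S \<circ> T)"
  by (auto simp: lin_op_def)

lemma lin_op_plus: "lin_op m S \<Longrightarrow> lin_op m T \<Longrightarrow> lin_op m (\<lambda>v. S v + T v)"
  using subspace_lvecs[of m]
  by (auto simp: lin_op_def cvec.scale_right_distrib cvec.subspace_def)

lemma lin_op_expand:
  assumes "lin_op m T" "v \<in> lvecs m"
  shows "T v = (\<Sum>k<m. vscale (v k) (T (unitv k)))"
  by (subst lvecs_expand[OF assms(2)]) (simp add: lin_op_sum[OF assms(1)] lin_op_scale[OF assms(1)])

lemma lin_op_expand_apply:
  assumes "lin_op m T" "v \<in> lvecs m"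
  shows "T v i = (\<Sum>k<m. v k * T (unitv k) i)"
  unfolding lin_op_expand[OF assms] sum_fun_apply by (simp add: vscale_def)

definition op_trace :: "nat \<Rightarrow> ((nat \<Rightarrow> complex) \<Rightarrow> nat \<Rightarrow> complex) \<Rightarrow> complex" where
  "op_trace m T = (\<Sum>k<m. T (unitv k) k)"

lemma op_trace_plus: "op_trace m (\<lambda>v. S v + T v) = op_trace m S + op_trace m T"
  by (simp add: op_trace_def sum.distrib)

lemma op_trace_comm:
  assumes "lin_op m S" "lin_op m T"
  shows "op_trace m (S \<circ> T) = op_trace m (T \<circ> S)"
proof -
  have "op_trace m (S \<circ> T) = (\<Sum>k<m. \<Sum>l<m. T (unitv k) l * S (unitv l) k)"
    by (simp add: op_trace_def lin_op_expand_apply[OF assms(1) lin_op_lvecs[OF assms(2)]])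
  also have "\<dots> = (\<Sum>l<m. \<Sum>k<m. S (unitv l) k * T (unitv k) l)"
    by (subst sum.swap) (simp add: mult.commute)
  also have "\<dots> = op_trace m (T \<circ> S)"
    by (simp add: op_trace_def lin_op_expand_apply[OF assms(2) lin_op_lvecs[OF assms(1)]])
  finally show ?thesis .
qed

section \<open>The bracket on coordinate vectors\<close>

lemma lbracket_in_lvecs: "lbracket m c x y \<in> lvecs m"
  by (simp add: lvecs_def lbracket_def)

lemma lin_op_lbracket: "lin_op m (lbracket m c x)"
  unfolding lin_op_def
proof (intro conjI allI)
  show "lbracket m c x (y + z) = lbracket m c x y + lbracket m c x z" for y z
    by (rule ext) (simp add: lbracket_def distrib_left distrib_right sum.distrib)
  show "lbracket m c x (vscale r y) = vscale r (lbracket m c x y)" for r y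
    by (rule ext) (simp add: lbracket_def vscale_def sum_distrib_left mult_ac)
qed (rule lbracket_in_lvecs)

lemma lbracket_add_left: "lbracket m c (x + y) z = lbracket m c x z + lbracket m c y z"
  by (rule ext) (simp add: lbracket_def distrib_right sum.distrib)

lemma lbracket_scale_left: "lbracket m c (vscale r x) z = vscale r (lbracket m c x z)"
  by (rule ext) (simp add: lbracket_def vscale_def sum_distrib_left mult_ac)

lemma lbracket_zero_left: "lbracket m c 0 z = 0"
  using lbracket_add_left[of m c 0 0 z] by simp

lemma lbracket_sum_left: "lbracket m c (\<Sum>k\<in>S. F k) z = (\<Sum>k\<in>S. lbracket m c (F k) z)"
proof (induction S rule: infinite_finite_induct)
  case (insert x S)
  then show ?case by (simp only: sum.insert lbracket_add_left not_False_eq_True)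
qed (simp_all only: sum.infinite sum.empty lbracket_zero_left not_False_eq_True)

lemmas lbracket_add_right = lin_op_add[OF lin_op_lbracket]
lemmas lbracket_scale_right = lin_op_scale[OF lin_op_lbracket]
lemmas lbracket_sum_right = lin_op_sum[OF lin_op_lbracket]
lemmas lbracket_zero_right = lin_op_zero[OF lin_op_lbracket]

lemma sum_unitv: "b < m \<Longrightarrow> (\<Sum>j<m. unitv b j * f j) = f b"
proof -
  assume "b < m"
  have "(\<Sum>j<m. unitv b j * f j) = (\<Sum>j<m. if j = b then f j else 0)"
    by (rule sum.cong) (auto simp: unitv_def)
  then show ?thesis using \<open>b < m\<close> by simp
qed

lemma lbracket_unitv: "a < m \<Longrightarrow> b < m \<Longrightarrow> k < m \<Longrightarrow> lbracket m c (unitv a) (unitv b) k = c a b k"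
  by (simp add: lbracket_def mult.assoc sum_unitv flip: sum_distrib_left)

lemma lie_alg_antisym: "lie_alg m c \<Longrightarrow> a < m \<Longrightarrow> b < m \<Longrightarrow> k < m \<Longrightarrow> c a b k = - c b a k"
  unfolding lie_alg_def by blast

lemma lie_alg_jacobi:
  "lie_alg m c \<Longrightarrow> a < m \<Longrightarrow> b < m \<Longrightarrow> d < m \<Longrightarrow> l < m \<Longrightarrow>
    (\<Sum>k<m. c b d k * c a k l) + (\<Sum>k<m. c d a k * c b k l) + (\<Sum>k<m. c a b k * c d k l) = 0"
  unfolding lie_alg_def by blast

lemma lbracket_antisym:
  assumes "lie_alg m c"
  shows "lbracket m c x y = - lbracket m c y x"
proof
  fix k
  show "lbracket m c x y k = (- lbracket m c y x) k"
  proof (cases "k < m")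
    case True
    have "(\<Sum>a<m. \<Sum>b<m. x a * y b * c a b k) = (\<Sum>a<m. \<Sum>b<m. - (y b * x a * c b a k))"
      using lie_alg_antisym[OF assms _ _ True] by (intro sum.cong refl) (metis lessThan_iff minus_mult_right mult.commute)
    also have "\<dots> = - (\<Sum>b<m. \<Sum>a<m. y b * x a * c b a k)"
      by (subst sum.swap) (simp add: sum_negf)
    finally show ?thesis using True by (simp add: lbracket_def)
  qed (simp add: lbracket_def)
qed

text \<open>Brings a nested bracket to the monomials \<open>x a * y b * z d\<close>, in which the
  three terms of the Jacobi identity can be compared.\<close>

lemma sum3_expand:
  fixes x y z :: "nat \<Rightarrow> complex"
  shows "(\<Sum>a<m. \<Sum>k<m. x a * (\<Sum>b<m. \<Sum>d<m. y b * z d * c b d k) * c a k l)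
    = (\<Sum>a<m. \<Sum>b<m. \<Sum>d<m. x a * y b * z d * (\<Sum>k<m. c b d k * c a k l))"
proof -
  have "(\<Sum>k<m. x a * (\<Sum>b<m. \<Sum>d<m. y b * z d * c b d k) * c a k l)
     = (\<Sum>b<m. \<Sum>d<m. x a * y b * z d * (\<Sum>k<m. c b d k * c a k l))" for a
  proof -
    have "(\<Sum>k<m. x a * (\<Sum>b<m. \<Sum>d<m. y b * z d * c b d k) * c a k l)
      = (\<Sum>k<m. \<Sum>b<m. \<Sum>d<m. x a * y b * z d * (c b d k * c a k l))"
      by (intro sum.cong refl) (simp add: sum_distrib_left sum_distrib_right mult.assoc)
    also have "\<dots> = (\<Sum>b<m. \<Sum>k<m. \<Sum>d<m. x a * y b * z d * (c b d k * c a k l))"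
      by (rule sum.swap)
    also have "\<dots> = (\<Sum>b<m. \<Sum>d<m. \<Sum>k<m. x a * y b * z d * (c b d k * c a k l))"
      by (intro sum.cong refl sum.swap)
    finally show ?thesis by (simp add: sum_distrib_left)
  qed
  then show ?thesis by simp
qed

lemma jacobi_cyclic:
  assumes "lie_alg m c"
  shows "lbracket m c x (lbracket m c y z) + lbracket m c y (lbracket m c z x)
    + lbracket m c z (lbracket m c x y) = 0"
proof
  fix l
  show "(lbracket m c x (lbracket m c y z) + lbracket m c y (lbracket m c z x)
    + lbracket m c z (lbracket m c x y)) l = 0 l"
  proof (cases "l < m")
    case True
    have e: "lbracket m c x (lbracket m c y z) l
        = (\<Sum>a<m. \<Sum>b<m. \<Sum>d<m. x a * y b * z d * (\<Sum>k<m. c b d k * c a k l))" for x y z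
      unfolding sum3_expand[symmetric] using True by (simp add: lbracket_def)
    \<comment> \<open>Cyclic renaming of the summation indices puts the same monomial in front of
      all three terms, so that the Jacobi identity for structure constants applies
      coefficientwise.\<close>
    have 2: "lbracket m c y (lbracket m c z x) l
        = (\<Sum>a<m. \<Sum>b<m. \<Sum>d<m. x a * y b * z d * (\<Sum>k<m. c d a k * c b k l))"
    proof -
      have "lbracket m c y (lbracket m c z x) l
        = (\<Sum>b<m. \<Sum>d<m. \<Sum>a<m. x a * y b * z d * (\<Sum>k<m. c d a k * c b k l))"
        unfolding e by (intro sum.cong refl) (simp only: mult_ac)
      also have "\<dots> = (\<Sum>b<m. \<Sum>a<m. \<Sum>d<m. x a * y b * z d * (\<Sum>k<m. c d a k * c b k l))"
        by (intro sum.cong refl sum.swap)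
      also have "\<dots> = (\<Sum>a<m. \<Sum>b<m. \<Sum>d<m. x a * y b * z d * (\<Sum>k<m. c d a k * c b k l))"
        by (rule sum.swap)
      finally show ?thesis .
    qed
    have 3: "lbracket m c z (lbracket m c x y) l
        = (\<Sum>a<m. \<Sum>b<m. \<Sum>d<m. x a * y b * z d * (\<Sum>k<m. c a b k * c d k l))"
    proof -
      have "lbracket m c z (lbracket m c x y) l
        = (\<Sum>d<m. \<Sum>a<m. \<Sum>b<m. x a * y b * z d * (\<Sum>k<m. c a b k * c d k l))"
        unfolding e by (intro sum.cong refl) (simp only: mult_ac)
      also have "\<dots> = (\<Sum>a<m. \<Sum>d<m. \<Sum>b<m. x a * y b * z d * (\<Sum>k<m. c a b k * c d k l))"
        by (rule sum.swap)
      also have "\<dots> = (\<Sum>a<m. \<Sum>b<m. \<Sum>d<m. x a * y b * z d * (\<Sum>k<m. c a b k * c d k l))"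
        by (intro sum.cong refl sum.swap)
      finally show ?thesis .
    qed
    have "lbracket m c x (lbracket m c y z) l + lbracket m c y (lbracket m c z x) l
      + lbracket m c z (lbracket m c x y) l
      = (\<Sum>a<m. \<Sum>b<m. \<Sum>d<m. x a * y b * z d * ((\<Sum>k<m. c b d k * c a k l)
          + (\<Sum>k<m. c d a k * c b k l) + (\<Sum>k<m. c a b k * c d k l)))"
      unfolding 2 3 e[of x y z] by (simp add: sum.distrib distrib_left)
    also have "\<dots> = 0"
      using lie_alg_jacobi[OF assms _ _ _ True] by (intro sum.neutral ballI) simp
    finally show ?thesis by simp
  qed (simp add: lbracket_def)
qed

lemma lbracket_derivation:
  assumes "lie_alg m c"
  shows "lbracket m c x (lbracket m c y z)
    = lbracket m c (lbracket m c x y) z + lbracket m c y (lbracket m c x z)"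
proof -
  have "lbracket m c y (lbracket m c z x) = - lbracket m c y (lbracket m c x z)"
    unfolding lbracket_antisym[OF assms, of z x]
    using lbracket_scale_right[of m c y "- 1" "lbracket m c x z"] by (simp add: cvec.scale_minus_left)
  moreover have "lbracket m c z (lbracket m c x y) = - lbracket m c (lbracket m c x y) z"
    by (rule lbracket_antisym[OF assms])
  ultimately have "lbracket m c x (lbracket m c y z) + - lbracket m c y (lbracket m c x z)
      + - lbracket m c (lbracket m c x y) z = 0"
    using jacobi_cyclic[OF assms, of x y z] by (simp only:)
  moreover have "a + - b + - d = 0 \<Longrightarrow> a = d + b" for a b d :: "'v::ab_group_add"
    by (simp add: algebra_simps)
  ultimately show ?thesis by blast
qed

section \<open>The Killing form as a trace form\<close>

lemma killing_eq_op_trace: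
  assumes "a < m" "b < m"
  shows "killing m c a b = op_trace m (lbracket m c (unitv a) \<circ> lbracket m c (unitv b))"
proof -
  have "lbracket m c (unitv a) (lbracket m c (unitv b) (unitv i)) i = (\<Sum>k<m. c b i k * c a k i)"
    if "i < m" for i
    using that assms by (subst lin_op_expand_apply[OF lin_op_lbracket lbracket_in_lvecs])
      (simp add: lbracket_unitv)
  then show ?thesis by (simp add: killing_def op_trace_def)
qed

lemma killing_form_expand:
  assumes "x \<in> lvecs m" "y \<in> lvecs m"
  shows "op_trace m (lbracket m c x \<circ> lbracket m c y) = (\<Sum>a<m. \<Sum>b<m. x a * y b * killing m c a b)"
proof -
  let ?e = unitv and ?br = "lbracket m c"
  have 1: "?br x v = (\<Sum>a<m. vscale (x a) (?br (?e a) v))" if "x \<in> lvecs m" for x v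
    by (subst lvecs_expand[OF that]) (simp only: lbracket_sum_left lbracket_scale_left)
  have "?br x (?br y v) k = (\<Sum>a<m. \<Sum>b<m. x a * y b * ?br (?e a) (?br (?e b) v) k)" for v k
  proof -
    have "?br x (?br y v) = (\<Sum>a<m. vscale (x a) (\<Sum>b<m. vscale (y b) (?br (?e a) (?br (?e b) v))))"
      unfolding 1[OF assms(1), of "?br y v"] unfolding 1[OF assms(2), of v]
      by (simp only: lbracket_sum_right lbracket_scale_right)
    then show ?thesis
      by (simp add: sum_fun_apply vscale_def sum_distrib_left mult.assoc)
  qed
  then have "op_trace m (?br x \<circ> ?br y)
      = (\<Sum>k<m. \<Sum>a<m. \<Sum>b<m. x a * y b * ?br (?e a) (?br (?e b) (?e k)) k)"
    by (simp add: op_trace_def)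
  also have "\<dots> = (\<Sum>a<m. \<Sum>k<m. \<Sum>b<m. x a * y b * ?br (?e a) (?br (?e b) (?e k)) k)"
    by (rule sum.swap)
  also have "\<dots> = (\<Sum>a<m. \<Sum>b<m. \<Sum>k<m. x a * y b * ?br (?e a) (?br (?e b) (?e k)) k)"
    by (intro sum.cong refl sum.swap)
  also have "\<dots> = (\<Sum>a<m. \<Sum>b<m. x a * y b * killing m c a b)"
    by (intro sum.cong refl) (simp add: killing_eq_op_trace op_trace_def sum_distrib_left)
  finally show ?thesis .
qed

lemma lin_op_lbracket_left: "lin_op m (\<lambda>u. lbracket m c u v)"
  by (simp add: lin_op_def lbracket_add_left lbracket_scale_left lbracket_in_lvecs)

lemma lin_op_funpow: "lin_op m T \<Longrightarrow> lin_op m (T ^^ Suc n)"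
  by (induction n) (auto intro: lin_op_comp)

text \<open>If the Killing form vanishes, then \<open>ad x\<close> is nilpotent: in a Jordan basis of \<open>ad x\<close> the diagonal operator
  \<open>D\<close> with the conjugated eigenvalues is a derivation, so \<open>tr (D ad [y,z]) = K(D y, z) = 0\<close>, whence
  \<open>tr (D ad x)\<close>, the sum of the squared moduli of the eigenvalues, is zero.\<close>

lemma ad_nilpotent:
  assumes lie: "lie_alg m c"
    and K0: "\<And>a b. a < m \<Longrightarrow> b < m \<Longrightarrow> killing m c a b = 0"
    and perfect: "lvecs m \<subseteq> cvec.span {lbracket m c y z | y z. y \<in> lvecs m \<and> z \<in> lvecs m}"
    and x: "x \<in> lvecs m" and v: "v \<in> lvecs m"
  shows "(lbracket m c x ^^ Suc m) v = 0"
proof -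
  let ?br = "lbracket m c"
  obtain P Q \<alpha> \<epsilon> where
    PQ: "\<And>i j. i < m \<Longrightarrow> j < m \<Longrightarrow> (\<Sum>k<m. P i k * Q k j) = (if i = j then 1 else 0)" and
    QP: "\<And>i j. i < m \<Longrightarrow> j < m \<Longrightarrow> (\<Sum>k<m. Q i k * P k j) = (if i = j then 1 else 0)" and
    AP: "\<And>i j. i < m \<Longrightarrow> j < m \<Longrightarrow>
      (\<Sum>k<m. ?br x (unitv k) i * P k j) = \<alpha> j * P i j + (if j = 0 then 0 else \<epsilon> j * P i (j - 1))" and
    eps: "\<And>j. Suc j < m \<Longrightarrow> \<epsilon> (Suc j) \<noteq> 0 \<Longrightarrow> \<alpha> (Suc j) = (\<alpha> j :: complex)"
    by (rule jordan_basis[of m "\<lambda>i k. ?br x (unitv k) i"]) (rule that)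
  \<comment> \<open>The Jordan basis vectors \<open>f j\<close> and their dual coordinate
    functionals \<open>q k\<close>; the cut-off at \<open>m\<close> puts \<open>f j\<close> into
    \<open>lvecs m\<close>.\<close>
  define f where "f j = (\<lambda>i. if i < m then P i j else 0)" for j
  define q where "q k u = (\<Sum>l<m. Q k l * u l)" for k and u :: "nat \<Rightarrow> complex"
  have f: "f j \<in> lvecs m" for j by (simp add: f_def lvecs_def)
  have brf: "?br x (f j) = vscale (\<alpha> j) (f j) + (if j = 0 then 0 else vscale (\<epsilon> j) (f (j - 1)))"
    if "j < m" for j
  proof
    fix i
    show "?br x (f j) i = (vscale (\<alpha> j) (f j) + (if j = 0 then 0 else vscale (\<epsilon> j) (f (j - 1)))) i"
    proof (cases "i < m")
      case True
      have "?br x (f j) i = (\<Sum>k<m. ?br x (unitv k) i * P k j)"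
        unfolding lin_op_expand_apply[OF lin_op_lbracket f] by (intro sum.cong) (auto simp: f_def)
      then show ?thesis using AP[OF True that] True by (simp add: vscale_def f_def)
    next
      case False
      then show ?thesis by (simp add: vscale_def f_def lbracket_def)
    qed
  qed
  have q_add: "q k (u + w) = q k u + q k w" for k u w
    by (simp add: q_def distrib_left sum.distrib)
  have q_scale: "q k (vscale r u) = r * q k u" for k r u
    by (simp add: q_def vscale_def sum_distrib_left mult_ac)
  have q_zero: "q k 0 = 0" for k by (simp add: q_def)
  have q_sum: "q k (\<Sum>a\<in>A. g a) = (\<Sum>a\<in>A. q k (g a))" for k g and A :: "nat set"
    by (induction A rule: infinite_finite_induct)
      (simp_all only: sum.infinite sum.empty sum.insert q_zero q_add not_False_eq_True)
  have qf: "q k (f j) = (if k = j then 1 else 0)" if "k < m" "j < m" for k j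
    unfolding q_def QP[OF that, symmetric] by (intro sum.cong) (auto simp: f_def)
  have expand: "u = (\<Sum>k<m. vscale (q k u) (f k))" if "u \<in> lvecs m" for u
  proof
    fix i
    show "u i = (\<Sum>k<m. vscale (q k u) (f k)) i"
    proof (cases "i < m")
      case True
      have "(\<Sum>k<m. vscale (q k u) (f k)) i = (\<Sum>k<m. \<Sum>l<m. P i k * Q k l * u l)"
        unfolding sum_fun_apply using True
        by (intro sum.cong) (auto simp: vscale_def f_def q_def sum_distrib_left mult_ac)
      also have "\<dots> = (\<Sum>l<m. (\<Sum>k<m. P i k * Q k l) * u l)"
        by (subst sum.swap) (simp add: sum_distrib_right)
      also have "\<dots> = (\<Sum>l<m. if i = l then u l else 0)"
        using True by (intro sum.cong) (auto simp: PQ)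
      finally show ?thesis using True by simp
    next
      case False
      then show ?thesis using that by (simp add: sum_fun_apply vscale_def f_def lvecs_def)
    qed
  qed
  have agree: "S u = T u" if "lin_op m S" "lin_op m T" "\<And>j. j < m \<Longrightarrow> S (f j) = T (f j)" "u \<in> lvecs m" for S T u
  proof -
    have "S u = (\<Sum>k<m. vscale (q k u) (S (f k)))"
      by (subst expand[OF that(4)]) (simp add: lin_op_sum[OF that(1)] lin_op_scale[OF that(1)])
    also have "\<dots> = (\<Sum>k<m. vscale (q k u) (T (f k)))" using that(3) by simp
    also have "\<dots> = T u"
      by (subst (2) expand[OF that(4)]) (simp add: lin_op_sum[OF that(2)] lin_op_scale[OF that(2)])
    finally show ?thesis .
  qed
  define D where "D u = (\<Sum>k<m. vscale (cnj (\<alpha> k) * q k u) (f k))" for u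
  have linD: "lin_op m D"
    unfolding lin_op_def
  proof (intro conjI allI)
    show "D (u + w) = D u + D w" for u w
      by (simp add: D_def q_add distrib_left cvec.scale_left_distrib sum.distrib)
    show "D (vscale r u) = vscale r (D u)" for r u
      unfolding D_def q_scale cvec.scale_sum_right by (simp add: mult_ac)
    show "D u \<in> lvecs m" for u
      unfolding D_def by (intro cvec.subspace_sum cvec.subspace_scale subspace_lvecs f)
  qed
  have q_br: "q k (?br x u) = \<alpha> k * q k u + (if Suc k < m then \<epsilon> (Suc k) * q (Suc k) u else 0)"
    if "k < m" "u \<in> lvecs m" for k u
  proof -
    have "q k (?br x u) = (\<Sum>j<m. q j u * q k (?br x (f j)))"
      by (subst expand[OF that(2)]) (simp add: lbracket_sum_right lbracket_scale_right q_sum q_scale)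
    also have "\<dots> = (\<Sum>j<m. (if j = k then \<alpha> k * q k u else 0) + (if j = Suc k then \<epsilon> (Suc k) * q (Suc k) u else 0))"
      using that(1) by (intro sum.cong refl) (auto simp: brf q_add q_scale q_zero qf split: if_splits)
    also have "\<dots> = \<alpha> k * q k u + (if Suc k < m then \<epsilon> (Suc k) * q (Suc k) u else 0)"
      using that(1) by (simp add: sum.distrib)
    finally show ?thesis .
  qed
  \<comment> \<open>Where \<open>\<alpha> k\<close> differs from \<open>\<beta>\<close>, comparing
    coordinates gives \<open>(\<alpha> k - \<beta>) * q k u = - \<epsilon> (Suc k) * q (Suc k)
    u\<close>. A nonzero superdiagonal entry forces the next eigenvalue to be the same, so the right
    side vanishes by induction from the last coordinate downwards.\<close>
  have gen_eig: "q k u = 0"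
    if u: "u \<in> lvecs m" and h: "\<And>k. k < m \<Longrightarrow> \<alpha> k \<noteq> \<beta> \<Longrightarrow> q k (?br x u) = \<beta> * q k u"
      and k: "k < m" "\<alpha> k \<noteq> \<beta>" for u \<beta> k
    using k
  proof (induction "m - k" arbitrary: k rule: less_induct)
    case less
    have "\<beta> * q k u = \<alpha> k * q k u + (if Suc k < m then \<epsilon> (Suc k) * q (Suc k) u else 0)"
      using q_br[OF less(2) u] h[OF less(2,3)] by simp
    moreover have "(if Suc k < m then \<epsilon> (Suc k) * q (Suc k) u else 0) = 0"
    proof (cases "Suc k < m \<and> \<epsilon> (Suc k) \<noteq> 0")
      case True
      then have "\<alpha> (Suc k) \<noteq> \<beta>" using eps less(3) by auto
      then show ?thesis using less(1)[of "Suc k"] True by auto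
    qed auto
    ultimately show ?case using less(3) by auto
  qed
  \<comment> \<open>The bracket of generalised eigenvectors lies in the generalised eigenspace of
    the sum of the eigenvalues. Induction on \<open>i + j\<close> works because the nilpotent part
    of ad x lowers one index by one and keeps the eigenvalue.\<close>
  have br_eig: "q k (?br (f i) (f j)) = 0" if "i < m" "j < m" "k < m" "\<alpha> k \<noteq> \<alpha> i + \<alpha> j" for i j k
    using that
  proof (induction "i + j" arbitrary: i j k rule: less_induct)
    case less
    let ?w = "?br (f i) (f j)"
    have "?br x ?w = ?br (?br x (f i)) (f j) + ?br (f i) (?br x (f j))"
      by (rule lbracket_derivation[OF lie])
    also have "\<dots> = vscale (\<alpha> i) ?w + (if i = 0 then 0 else vscale (\<epsilon> i) (?br (f (i - 1)) (f j)))
       + (vscale (\<alpha> j) ?w + (if j = 0 then 0 else vscale (\<epsilon> j) (?br (f i) (f (j - 1)))))"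
      by (auto simp: brf less.prems lbracket_add_left lbracket_scale_left lbracket_add_right lbracket_scale_right
          lbracket_zero_left lbracket_zero_right)
    finally have e: "?br x ?w = \<dots>" .
    have 1: "\<epsilon> i * q l (?br (f (i - 1)) (f j)) = 0" if "i \<noteq> 0" "l < m" "\<alpha> l \<noteq> \<alpha> i + \<alpha> j" for l
    proof (cases "\<epsilon> i = 0")
      case False
      then have "\<alpha> i = \<alpha> (i - 1)" using eps[of "i - 1"] that less.prems by simp
      then show ?thesis using less.hyps[of "i - 1" j l] that less.prems by simp
    qed simp
    have 2: "\<epsilon> j * q l (?br (f i) (f (j - 1))) = 0" if "j \<noteq> 0" "l < m" "\<alpha> l \<noteq> \<alpha> i + \<alpha> j" for l
    proof (cases "\<epsilon> j = 0")
      case False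
      then have "\<alpha> j = \<alpha> (j - 1)" using eps[of "j - 1"] that less.prems by simp
      then show ?thesis using less.hyps[of i "j - 1" l] that less.prems by simp
    qed simp
    have "q l (?br x ?w) = (\<alpha> i + \<alpha> j) * q l ?w" if "l < m" "\<alpha> l \<noteq> \<alpha> i + \<alpha> j" for l
      unfolding e using 1[OF _ that] 2[OF _ that]
      by (auto simp: q_add q_scale q_zero distrib_right)
    then show ?case by (rule gen_eig[OF lbracket_in_lvecs]) (use less.prems in auto)
  qed
  have Df: "D (f j) = vscale (cnj (\<alpha> j)) (f j)" if "j < m" for j
  proof -
    have "D (f j) = (\<Sum>k<m. if k = j then vscale (cnj (\<alpha> j)) (f j) else 0)"
      unfolding D_def using that by (intro sum.cong) (auto simp: qf)
    then show ?thesis using that by simp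
  qed
  \<comment> \<open>On a generalised eigenspace \<open>D\<close> is multiplication by the conjugated
    eigenvalue. Conjugation is additive, so \<open>br_eig\<close> yields the Leibniz rule on basis
    vectors.\<close>
  have Dbr: "D (?br (f i) (f j)) = ?br (D (f i)) (f j) + ?br (f i) (D (f j))" if "i < m" "j < m" for i j
  proof -
    let ?w = "?br (f i) (f j)"
    have "D ?w = (\<Sum>k<m. vscale (cnj (\<alpha> i + \<alpha> j)) (vscale (q k ?w) (f k)))"
      unfolding D_def
    proof (intro sum.cong refl)
      fix k assume "k \<in> {..<m}"
      then show "vscale (cnj (\<alpha> k) * q k ?w) (f k) = vscale (cnj (\<alpha> i + \<alpha> j)) (vscale (q k ?w) (f k))"
        using br_eig[OF that, of k] by (cases "\<alpha> k = \<alpha> i + \<alpha> j") (auto)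
    qed
    also have "\<dots> = vscale (cnj (\<alpha> i + \<alpha> j)) ?w"
      by (subst (2) expand[OF lbracket_in_lvecs]) (simp add: cvec.scale_sum_right)
    finally show ?thesis
      by (simp add: Df that lbracket_scale_left lbracket_scale_right cvec.scale_left_distrib)
  qed
  have Dder1: "D (?br (f i) w) = ?br (D (f i)) w + ?br (f i) (D w)" if "i < m" "w \<in> lvecs m" for i w
    using agree[OF lin_op_comp[OF linD lin_op_lbracket[of m c "f i"]]
        lin_op_plus[OF lin_op_lbracket[of m c "D (f i)"] lin_op_comp[OF lin_op_lbracket[of m c "f i"] linD]] _ that(2)]
      Dbr[OF that(1)] by simp
  have Dder: "D (?br u w) = ?br (D u) w + ?br u (D w)" if "u \<in> lvecs m" "w \<in> lvecs m" for u w
    using agree[OF lin_op_comp[OF linD lin_op_lbracket_left[of m c w]]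
        lin_op_plus[OF lin_op_comp[OF lin_op_lbracket_left[of m c w] linD] lin_op_lbracket_left[of m c "D w"]] _ that(1)]
      Dder1[OF _ that(2)] by simp
  have tr0: "op_trace m (?br y \<circ> ?br z) = 0" if "y \<in> lvecs m" "z \<in> lvecs m" for y z
    unfolding killing_form_expand[OF that] using K0 by simp
  have trbr: "op_trace m (D \<circ> ?br (?br y z)) = 0" if y: "y \<in> lvecs m" and z: "z \<in> lvecs m" for y z
  proof -
    have "D \<circ> (?br y \<circ> ?br z) = (\<lambda>w. (D \<circ> ?br (?br y z)) w + (D \<circ> (?br z \<circ> ?br y)) w)"
      by (rule ext) (simp add: lbracket_derivation[OF lie, of y z] lin_op_add[OF linD])
    then have 1: "op_trace m (D \<circ> (?br y \<circ> ?br z)) = op_trace m (D \<circ> ?br (?br y z)) + op_trace m (D \<circ> (?br z \<circ> ?br y))"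
      by (simp only: op_trace_plus)
    \<comment> \<open>The Leibniz rule moves \<open>D\<close> past ad y. By cyclicity the trace of
      the second summand is that of \<open>D\<close> ad z ad y, so only K(D y, z) survives in the
      difference.\<close>
    have "D \<circ> (?br y \<circ> ?br z) = (\<lambda>w. (?br (D y) \<circ> ?br z) w + (?br y \<circ> (D \<circ> ?br z)) w)"
      by (rule ext) (simp add: Dder[OF y lbracket_in_lvecs])
    then have "op_trace m (D \<circ> (?br y \<circ> ?br z)) = op_trace m (?br (D y) \<circ> ?br z) + op_trace m (?br y \<circ> (D \<circ> ?br z))"
      by (simp only: op_trace_plus)
    moreover have "op_trace m (?br y \<circ> (D \<circ> ?br z)) = op_trace m ((D \<circ> ?br z) \<circ> ?br y)"
      by (intro op_trace_comm lin_op_comp linD lin_op_lbracket)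
    moreover have "op_trace m (?br (D y) \<circ> ?br z) = 0"
      by (rule tr0[OF lin_op_lvecs[OF linD] z])
    ultimately show ?thesis using 1 by (simp add: comp_assoc)
  qed
  have "cvec.span {?br y z | y z. y \<in> lvecs m \<and> z \<in> lvecs m} \<subseteq> {u. op_trace m (D \<circ> ?br u) = 0}"
  proof (rule cvec.span_minimal)
    show "{?br y z | y z. y \<in> lvecs m \<and> z \<in> lvecs m} \<subseteq> {u. op_trace m (D \<circ> ?br u) = 0}"
      using trbr by auto
    show "cvec.subspace {u. op_trace m (D \<circ> ?br u) = 0}"
      by (simp add: cvec.subspace_def op_trace_def lbracket_zero_left lin_op_zero[OF linD] lbracket_add_left
          lin_op_add[OF linD] sum.distrib lbracket_scale_left lin_op_scale[OF linD])
        (simp add: vscale_def flip: sum_distrib_left)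
  qed
  then have tr_D: "op_trace m (D \<circ> ?br x) = 0" using perfect x by blast
  have tr_basis: "op_trace m T = (\<Sum>k<m. q k (T (f k)))" if T: "lin_op m T" for T
  proof -
    have "q k (T (f k)) = (\<Sum>l<m. \<Sum>i<m. P i k * Q k l * T (unitv i) l)" if "k < m" for k
      unfolding q_def lin_op_expand_apply[OF T f]
      by (intro sum.cong refl) (auto simp: f_def sum_distrib_left mult_ac intro!: sum.cong)
    then have "(\<Sum>k<m. q k (T (f k))) = (\<Sum>k<m. \<Sum>l<m. \<Sum>i<m. P i k * Q k l * T (unitv i) l)" by simp
    also have "\<dots> = (\<Sum>l<m. \<Sum>k<m. \<Sum>i<m. P i k * Q k l * T (unitv i) l)" by (rule sum.swap)
    also have "\<dots> = (\<Sum>l<m. \<Sum>i<m. \<Sum>k<m. P i k * Q k l * T (unitv i) l)"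
      by (intro sum.cong refl sum.swap)
    also have "\<dots> = (\<Sum>l<m. \<Sum>i<m. (if i = l then T (unitv i) l else 0))"
      by (intro sum.cong refl) (auto simp: PQ simp flip: sum_distrib_right)
    also have "\<dots> = op_trace m T" by (simp add: op_trace_def)
    finally show ?thesis by simp
  qed
  have "(\<Sum>k<m. q k (D (?br x (f k)))) = 0"
    using tr_basis[OF lin_op_comp[OF linD lin_op_lbracket[of m c x]]] tr_D by simp
  \<comment> \<open>The superdiagonal part sends \<open>f k\<close> to a multiple of
    \<open>f (k - 1)\<close> and so has no diagonal coefficient; an eigenvalue times its conjugate
    remains.\<close>
  moreover have "q k (D (?br x (f k))) = complex_of_real ((cmod (\<alpha> k))\<^sup>2)" if "k < m" for k
    unfolding complex_norm_square
    using that by (auto simp: brf lin_op_add[OF linD] lin_op_scale[OF linD] lin_op_zero[OF linD] Df q_add q_scale q_zero qf mult_ac)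
  ultimately have "complex_of_real (\<Sum>k<m. (cmod (\<alpha> k))\<^sup>2) = 0" by simp
  then have "(\<Sum>k<m. (cmod (\<alpha> k))\<^sup>2) = 0" by (simp only: of_real_eq_0_iff)
  then have \<alpha>0: "\<alpha> k = 0" if "k < m" for k
    using that by (subst (asm) sum_nonneg_eq_0_iff) auto
  have nil: "(?br x ^^ n) (f j) = 0" if "j < n" "j < m" for n j
    using that
  proof (induction n arbitrary: j)
    case (Suc n)
    have "(?br x ^^ Suc n) (f j) = (?br x ^^ n) (?br x (f j))" by (simp add: funpow_swap1)
    also have "?br x (f j) = (if j = 0 then 0 else vscale (\<epsilon> j) (f (j - 1)))"
      using brf[OF Suc(3)] \<alpha>0[OF Suc(3)] by simp
    also have "(?br x ^^ n) \<dots> = 0"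
    proof (cases n)
      case 0
      then show ?thesis using Suc by simp
    next
      case (Suc n')
      then have lin: "lin_op m (?br x ^^ n)" using lin_op_funpow[OF lin_op_lbracket] by simp
      then show ?thesis
        using Suc.IH[of "j - 1"] Suc.prems by (auto simp: lin_op_zero[OF lin] lin_op_scale[OF lin])
    qed
    finally show ?case .
  qed simp
  have zero: "lin_op m (\<lambda>_. 0)" by (simp add: lin_op_def lvecs_def)
  \<comment> \<open>The power is \<open>Suc m\<close> because \<open>lin_op\<close> forces values in
    \<open>lvecs m\<close>: the zeroth power, the identity on all sequences, is not of this
    kind.\<close>
  show ?thesis
    by (rule agree[OF lin_op_funpow[OF lin_op_lbracket] zero _ v]) (rule nil, simp_all)
qed

section \<open>Engel's theorem through iterated brackets with a growing subspace\<close>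

primrec lower_series :: "nat \<Rightarrow> (nat \<Rightarrow> nat \<Rightarrow> nat \<Rightarrow> complex) \<Rightarrow> (nat \<Rightarrow> complex) set \<Rightarrow> nat \<Rightarrow> (nat \<Rightarrow> complex) set" where
  "lower_series m c S 0 = lvecs m"
| "lower_series m c S (Suc k) = cvec.span {lbracket m c s v | s v. s \<in> S \<and> v \<in> lower_series m c S k}"

lemma subspace_lower_series: "cvec.subspace (lower_series m c S k)"
  by (cases k) (auto simp: subspace_lvecs)

lemma lower_series_bracket: "s \<in> S \<Longrightarrow> v \<in> lower_series m c S k \<Longrightarrow> lbracket m c s v \<in> lower_series m c S (Suc k)"
  by (auto intro: cvec.span_base)

lemma lower_series_subset_lvecs: "lower_series m c S k \<subseteq> lvecs m"
proof (cases k)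
  case (Suc k')
  show ?thesis unfolding Suc lower_series.simps
    by (rule cvec.span_minimal[OF _ subspace_lvecs]) (use lbracket_in_lvecs in blast)
qed simp

lemma lower_series_decreasing: "lower_series m c S (Suc k) \<subseteq> lower_series m c S k"
proof (induction k)
  case 0
  show ?case using lower_series_subset_lvecs[of m c S "Suc 0"] by simp
next
  case (Suc k)
  have "lower_series m c S (Suc (Suc k)) \<subseteq> cvec.span {lbracket m c s v | s v. s \<in> S \<and> v \<in> lower_series m c S k}"
    unfolding lower_series.simps(2)[of _ _ _ "Suc k"] by (rule cvec.span_mono) (use Suc in blast)
  then show ?case by simp
qed

text \<open>Otherwise every vector outside \<open>S\<close> is sent outside \<open>S\<close> by some
  member of \<open>S\<close>, and iteration yields vectors outside \<open>S\<close> in each term of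
  the series, although the \<open>N\<close>-th term is zero. This replaces the usual passage to a
  quotient, so that the induction can run over subspaces instead of subalgebras.\<close>

lemma normalizing_vector_exists:
  assumes S: "cvec.subspace S" "S \<subset> lvecs m" and nil: "lower_series m c S N \<subseteq> {0}"
  obtains y where "y \<in> lvecs m" "y \<notin> S" "\<And>s. s \<in> S \<Longrightarrow> lbracket m c s y \<in> S"
proof -
  have "\<exists>y\<in>lvecs m - S. \<forall>s\<in>S. lbracket m c s y \<in> S"
  proof (rule ccontr)
    assume "\<not> ?thesis"
    then have h: "\<exists>s\<in>S. lbracket m c s y \<notin> S" if "y \<in> lvecs m" "y \<notin> S" for y using that by blast
    have "\<exists>y\<in>lower_series m c S k. y \<notin> S" for k
    proof (induction k)
      case 0
      then show ?case using S by auto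
    next
      case (Suc k)
      then obtain y where y: "y \<in> lower_series m c S k" "y \<notin> S" by blast
      then obtain s where "s \<in> S" "lbracket m c s y \<notin> S" using h lower_series_subset_lvecs by blast
      then show ?case using lower_series_bracket[OF _ y(1)] by blast
    qed
    then obtain y where "y \<in> lower_series m c S N" "y \<notin> S" by blast
    then show False using nil cvec.subspace_0[OF S(1)] by auto
  qed
  then show ?thesis using that by blast
qed

text \<open>As \<open>y\<close> normalises \<open>S\<close>, both terms of
  \<open>[y,[s,v]] = [[y,s],v] + [s,[y,v]]\<close> are again brackets of \<open>S\<close> with the
  previous step.\<close>

lemma lower_series_stable:
  assumes lie: "lie_alg m c" and S: "cvec.subspace S" and y: "\<And>s. s \<in> S \<Longrightarrow> lbracket m c s y \<in> S"
    and v: "v \<in> lower_series m c S k"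
  shows "lbracket m c y v \<in> lower_series m c S k"
  using v
proof (induction k arbitrary: v)
  case 0
  then show ?case by (simp add: lbracket_in_lvecs)
next
  case (Suc k)
  have "cvec.span {lbracket m c s v | s v. s \<in> S \<and> v \<in> lower_series m c S k}
      \<subseteq> {v. lbracket m c y v \<in> lower_series m c S (Suc k)}"
  proof (rule cvec.span_minimal)
    show "cvec.subspace {v. lbracket m c y v \<in> lower_series m c S (Suc k)}"
      using subspace_lower_series[of m c S "Suc k"]
      by (simp del: lower_series.simps add: cvec.subspace_def lbracket_zero_right lbracket_add_right lbracket_scale_right)
    show "{lbracket m c s v | s v. s \<in> S \<and> v \<in> lower_series m c S k}
      \<subseteq> {v. lbracket m c y v \<in> lower_series m c S (Suc k)}"
    proof clarify
      fix s v assume sv: "s \<in> S" "v \<in> lower_series m c S k"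
      have "lbracket m c y s \<in> S"
        unfolding lbracket_antisym[OF lie, of y s] by (intro cvec.subspace_neg[OF S] y sv)
      then show "lbracket m c y (lbracket m c s v) \<in> lower_series m c S (Suc k)"
        unfolding lbracket_derivation[OF lie, of y s v]
        by (intro cvec.subspace_add[OF subspace_lower_series] lower_series_bracket sv Suc.IH)
    qed
  qed
  then show ?case using Suc.prems by auto
qed

text \<open>\<open>S\<close> lowers the filtration by one step and \<open>y\<close> preserves it, so modulo the next step only powers of \<open>y\<close> survive in a
  word in \<open>S + y\<close>.\<close>
lemma lower_series_extend:
  assumes lie: "lie_alg m c" and S: "cvec.subspace S" and y: "\<And>s. s \<in> S \<Longrightarrow> lbracket m c s y \<in> S"
    and nil: "\<And>v. v \<in> lvecs m \<Longrightarrow> (lbracket m c y ^^ M) v = 0"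
    and S': "\<And>t. t \<in> S' \<Longrightarrow> \<exists>r. t - vscale r y \<in> S"
  shows "lower_series m c S' (k * M) \<subseteq> lower_series m c S k"
proof (induction k)
  case (Suc k)
  let ?V = "lower_series m c S" and ?Y = "\<lambda>r. lbracket m c y ^^ r"
  \<comment> \<open>Intermediate spaces between two filtration steps: \<open>r\<close> further
    brackets beyond \<open>k * M\<close> land in step \<open>k + 1\<close> plus the image of step
    \<open>k\<close> under the \<open>r\<close>-th power of ad y. For \<open>r = M\<close> the
    second summand is zero.\<close>
  define A where "A r = {u + ?Y r v | u v. u \<in> ?V (Suc k) \<and> v \<in> ?V k}" for r
  have Ylin: "?Y r (v + w) = ?Y r v + ?Y r w" "?Y r (vscale a v) = vscale a (?Y r v)" for r a v w
    by (induction r) (simp_all add: lbracket_add_right lbracket_scale_right)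
  have Ystab: "?Y r v \<in> ?V k" if "v \<in> ?V k" for r v
    by (induction r) (use that lower_series_stable[OF lie S y] in auto)
  have sub: "cvec.subspace (A r)" for r
    unfolding cvec.subspace_def
  proof (intro conjI ballI allI)
    have "0 + ?Y r (vscale 0 0) \<in> A r" unfolding A_def
      using cvec.subspace_0[OF subspace_lower_series] cvec.subspace_scale[OF subspace_lower_series] by blast
    then show "0 \<in> A r" unfolding Ylin by simp
  next
    fix a b assume "a \<in> A r" "b \<in> A r"
    then obtain u v u' v' where *: "a = u + ?Y r v" "b = u' + ?Y r v'"
      "u \<in> ?V (Suc k)" "v \<in> ?V k" "u' \<in> ?V (Suc k)" "v' \<in> ?V k" unfolding A_def by blast
    have "a + b = (u + u') + ?Y r (v + v')" unfolding * Ylin by (simp only: add_ac)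
    then show "a + b \<in> A r" unfolding A_def
      using cvec.subspace_add[OF subspace_lower_series] * by blast
  next
    fix t a assume "a \<in> A r"
    then obtain u v where *: "a = u + ?Y r v" "u \<in> ?V (Suc k)" "v \<in> ?V k" unfolding A_def by blast
    have "vscale t a = vscale t u + ?Y r (vscale t v)" unfolding * Ylin by (rule cvec.scale_right_distrib)
    then show "vscale t a \<in> A r" unfolding A_def
      using cvec.subspace_scale[OF subspace_lower_series] * by blast
  qed
  have "lower_series m c S' (k * M + r) \<subseteq> A r" for r
  proof (induction r)
    case 0
    have "v = 0 + ?Y 0 v" for v by simp
    then have "?V k \<subseteq> A 0" unfolding A_def using cvec.subspace_0[OF subspace_lower_series] by blast
    then show ?case using Suc by auto
  next
    case (Suc r)
    have "cvec.span {lbracket m c s v | s v. s \<in> S' \<and> v \<in> lower_series m c S' (k * M + r)} \<subseteq> A (Suc r)"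
    proof (rule cvec.span_minimal[OF _ sub], clarify)
      fix t w assume t: "t \<in> S'" and w: "w \<in> lower_series m c S' (k * M + r)"
      from S'[OF t] obtain a where a: "t - vscale a y \<in> S" by blast
      define s where "s = t - vscale a y"
      have ts: "t = s + vscale a y" by (simp only: s_def diff_add_cancel)
      from w Suc obtain u v where uv: "w = u + ?Y r v" "u \<in> ?V (Suc k)" "v \<in> ?V k"
        unfolding A_def by blast
      \<comment> \<open>With \<open>t = s + vscale a y\<close>, the bracket of \<open>s\<close> with
        \<open>w\<close> moves one step down and the bracket of \<open>y\<close> with
        \<open>u\<close> stays in step \<open>k + 1\<close>; only \<open>y\<close> applied to the
        power part raises the exponent.\<close>
      have "lbracket m c t w = (lbracket m c s w + vscale a (lbracket m c y u)) + ?Y (Suc r) (vscale a v)"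
        unfolding Ylin ts uv(1)
        by (simp only: lbracket_add_left lbracket_add_right lbracket_scale_left lbracket_scale_right
            cvec.scale_right_distrib funpow.simps o_apply add_ac)
      moreover have "w \<in> ?V k"
        unfolding uv(1) using uv Ystab lower_series_decreasing
        by (intro cvec.subspace_add[OF subspace_lower_series]) blast+
      then have "lbracket m c s w \<in> ?V (Suc k)"
        using a unfolding s_def by (intro lower_series_bracket)
      then have "lbracket m c s w + vscale a (lbracket m c y u) \<in> ?V (Suc k)"
        by (intro cvec.subspace_add[OF subspace_lower_series] cvec.subspace_scale[OF subspace_lower_series]
            lower_series_stable[OF lie S y] uv(2))
      moreover have "vscale a v \<in> ?V k"
        by (intro cvec.subspace_scale[OF subspace_lower_series] uv(3))
      ultimately show "lbracket m c t w \<in> A (Suc r)" unfolding A_def by blast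
    qed
    then show ?case by simp
  qed
  from this[of M] have "lower_series m c S' (Suc k * M) \<subseteq> A M" by (simp add: add.commute)
  also have "A M \<subseteq> ?V (Suc k)"
  proof
    fix w assume "w \<in> A M"
    then obtain u v where "w = u + ?Y M v" "u \<in> ?V (Suc k)" "v \<in> ?V k" unfolding A_def by blast
    moreover have "?Y M v = 0" using calculation lower_series_subset_lvecs by (intro nil) blast
    ultimately show "w \<in> ?V (Suc k)" by (simp only: add.right_neutral)
  qed
  finally show ?case .
qed simp

text \<open>A proper subspace whose iterated brackets die out can be enlarged by a normalising
  vector without losing this property. If the conclusion failed, no subspace with this property
  would be everything, and the enlargement would pass the dimension \<open>m\<close>.\<close>

lemma engel:
  assumes lie: "lie_alg m c"
    and nil: "\<And>y. y \<in> lvecs m \<Longrightarrow> \<exists>M. \<forall>v\<in>lvecs m. (lbracket m c y ^^ M) v = 0"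
  shows "\<exists>N. lower_series m c (lvecs m) N \<subseteq> {0}"
proof (rule ccontr)
  assume no: "\<not> ?thesis"
  have "\<exists>B. B \<subseteq> lvecs m \<and> finite B \<and> cvec.independent B \<and> card B = n
      \<and> (\<exists>N. lower_series m c (cvec.span B) N \<subseteq> {0})" for n
  proof (induction n)
    case 0
    have "lower_series m c (cvec.span {}) (Suc 0) \<subseteq> {0}"
      unfolding lower_series.simps by (rule cvec.span_minimal) (auto simp: lbracket_zero_left)
    then have "\<exists>N. lower_series m c (cvec.span {}) N \<subseteq> {0}" by blast
    then show ?case using cvec.independent_empty
      by (intro exI[of _ "{}"] conjI) (simp_all only: card.empty finite.emptyI empty_subsetI not_False_eq_True)
  next
    case (Suc n)
    then obtain B N where B: "B \<subseteq> lvecs m" "finite B" "cvec.independent B" "card B = n"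
      and N: "lower_series m c (cvec.span B) N \<subseteq> {0}" by blast
    have "cvec.span B \<noteq> lvecs m"
    proof
      assume "cvec.span B = lvecs m"
      then have "lower_series m c (lvecs m) N \<subseteq> {0}" using N by simp
      then show False using no by blast
    qed
    then have psub: "cvec.span B \<subset> lvecs m"
      using cvec.span_minimal[OF B(1) subspace_lvecs] by (simp only: psubsetI)
    obtain y where y: "y \<in> lvecs m" "y \<notin> cvec.span B"
      "\<And>s. s \<in> cvec.span B \<Longrightarrow> lbracket m c s y \<in> cvec.span B"
      by (rule normalizing_vector_exists[OF cvec.subspace_span psub N]) (rule that)
    obtain M where M: "\<And>v. v \<in> lvecs m \<Longrightarrow> (lbracket m c y ^^ M) v = 0" using nil[OF y(1)] by blast
    have span: "\<exists>r. t - vscale r y \<in> cvec.span B" if "t \<in> cvec.span (insert y B)" for t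
      using that unfolding cvec.span_breakdown_eq .
    have "lower_series m c (cvec.span (insert y B)) (N * M) \<subseteq> lower_series m c (cvec.span B) N"
      by (rule lower_series_extend[OF lie cvec.subspace_span y(3) M span])
    also note N
    finally have N': "lower_series m c (cvec.span (insert y B)) (N * M) \<subseteq> {0}" .
    have "y \<notin> B" using y(2) cvec.span_base by blast
    show ?case
    proof (intro exI conjI)
      show "insert y B \<subseteq> lvecs m" "finite (insert y B)" "card (insert y B) = Suc n"
        using B y(1) \<open>y \<notin> B\<close> by simp_all
      show "cvec.independent (insert y B)" by (rule cvec.independent_insertI[OF y(2) B(3)])
    qed (rule N')
  qed
  then obtain B where B: "B \<subseteq> lvecs m" "cvec.independent B" "card B = Suc m" by blast
  have "B \<subseteq> cvec.span (unitv ` {..<m})"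
  proof
    fix v assume "v \<in> B"
    then have v: "v \<in> lvecs m" using B(1) by blast
    show "v \<in> cvec.span (unitv ` {..<m})"
      by (subst lvecs_expand[OF v]) (intro cvec.span_sum cvec.span_scale cvec.span_base, auto)
  qed
  then have "card B \<le> card (unitv ` {..<m})"
    using cvec.independent_span_bound[of "unitv ` {..<m}" B] B(2) by simp
  also have "\<dots> \<le> m" using card_image_le[of "{..<m}" unitv] by simp
  finally show False using B(3) by simp
qed

section \<open>Nondegeneracy of the Killing form\<close>

lemma simple_lie_perfect:
  assumes "simple_lie m c"
  shows "lvecs m \<subseteq> cvec.span {lbracket m c y z | y z. y \<in> lvecs m \<and> z \<in> lvecs m}" (is "_ \<subseteq> ?S")
proof -
  have "?S \<subseteq> lvecs m" by (rule cvec.span_minimal[OF _ subspace_lvecs]) (auto simp: lbracket_in_lvecs)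
  \<comment> \<open>The derived algebra is an ideal, and it is nonzero because the algebra is not
    abelian.\<close>
  have "lie_ideal m c ?S"
    unfolding lie_ideal_def
  proof (intro conjI ballI allI)
    show "?S \<subseteq> lvecs m" by fact
    show "(\<lambda>_. 0) \<in> ?S" using cvec.span_zero unfolding zero_fun_def .
    show "(\<lambda>i. x i + y i) \<in> ?S" if "x \<in> ?S" "y \<in> ?S" for x y
      using cvec.span_add[OF that] unfolding plus_fun_def .
    show "(\<lambda>i. r * x i) \<in> ?S" if "x \<in> ?S" for r x
      using cvec.span_scale[OF that] unfolding vscale_def .
    show "lbracket m c x s \<in> ?S" if "x \<in> lvecs m" "s \<in> ?S" for x s
      using that \<open>?S \<subseteq> lvecs m\<close> by (intro cvec.span_base) blast
  qed
  then have "?S = {\<lambda>_. 0} \<or> ?S = lvecs m" using assms by (simp add: simple_lie_def)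
  moreover obtain a b k where abk: "a < m" "b < m" "k < m" "c a b k \<noteq> 0"
    using assms unfolding simple_lie_def by blast
  have "lbracket m c (unitv a) (unitv b) \<in> ?S"
    using abk by (intro cvec.span_base) (auto intro: unitv_in_lvecs)
  moreover have "lbracket m c (unitv a) (unitv b) \<noteq> (\<lambda>_. 0)"
    using abk(4) unfolding lbracket_unitv[OF abk(1-3), symmetric] by (auto dest: fun_cong)
  ultimately show ?thesis by blast
qed

lemma killing_nonzero:
  assumes simple: "simple_lie m c"
  shows "\<exists>a<m. \<exists>b<m. killing m c a b \<noteq> 0"
proof (rule ccontr)
  assume "\<not> ?thesis"
  then have K0: "\<And>a b. a < m \<Longrightarrow> b < m \<Longrightarrow> killing m c a b = 0" by blast
  have lie: "lie_alg m c" using simple by (simp add: simple_lie_def)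
  note perfect = simple_lie_perfect[OF simple]
  have "\<exists>M. \<forall>v\<in>lvecs m. (lbracket m c y ^^ M) v = 0" if "y \<in> lvecs m" for y
    by (intro exI[of _ "Suc m"] ballI) (rule ad_nilpotent[OF lie K0 perfect that])
  from engel[OF lie this] obtain N where N: "lower_series m c (lvecs m) N \<subseteq> {0}" by blast
  \<comment> \<open>A perfect algebra does not shrink under brackets with itself, whereas Engel's
    theorem brings the series down to zero.\<close>
  have "lvecs m \<subseteq> lower_series m c (lvecs m) k" for k
  proof (induction k)
    case (Suc k)
    have "cvec.span {lbracket m c y z | y z. y \<in> lvecs m \<and> z \<in> lvecs m} \<subseteq> lower_series m c (lvecs m) (Suc k)"
      unfolding lower_series.simps by (rule cvec.span_mono) (use Suc in blast)
    then show ?case using perfect by blast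
  qed simp
  then have z: "lvecs m \<subseteq> {0}" using N by blast
  obtain a where "a < m" using simple unfolding simple_lie_def by blast
  then have "unitv a = 0" using z unitv_in_lvecs by blast
  then have "unitv a a = 0" by simp
  then show False by (simp add: unitv_def)
qed

lemma killing_sym: "a < m \<Longrightarrow> b < m \<Longrightarrow> killing m c a b = killing m c b a"
  by (simp add: killing_eq_op_trace op_trace_comm[OF lin_op_lbracket lin_op_lbracket])

text \<open>Passing ad x through ad v ad w by the Leibniz rule produces both terms of the claim and
  ad v ad w ad x, whose trace equals that of ad x ad v ad w.\<close>

lemma killing_trace_invariant:
  assumes lie: "lie_alg m c"
  shows "op_trace m (lbracket m c (lbracket m c x v) \<circ> lbracket m c w)
    + op_trace m (lbracket m c v \<circ> lbracket m c (lbracket m c x w)) = 0"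
proof -
  let ?br = "lbracket m c"
  have "?br x \<circ> (?br v \<circ> ?br w) = (\<lambda>u. (?br (?br x v) \<circ> ?br w) u + (?br v \<circ> (?br x \<circ> ?br w)) u)"
    by (rule ext) (simp add: lbracket_derivation[OF lie, of x v])
  then have 1: "op_trace m (?br x \<circ> (?br v \<circ> ?br w))
      = op_trace m (?br (?br x v) \<circ> ?br w) + op_trace m (?br v \<circ> (?br x \<circ> ?br w))"
    by (simp only: op_trace_plus)
  have "?br v \<circ> (?br x \<circ> ?br w) = (\<lambda>u. (?br v \<circ> ?br (?br x w)) u + ((?br v \<circ> ?br w) \<circ> ?br x) u)"
    by (rule ext) (simp add: lbracket_derivation[OF lie, of x w] lbracket_add_right)
  then have 2: "op_trace m (?br v \<circ> (?br x \<circ> ?br w))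
      = op_trace m (?br v \<circ> ?br (?br x w)) + op_trace m ((?br v \<circ> ?br w) \<circ> ?br x)"
    by (simp only: op_trace_plus)
  have "op_trace m (?br x \<circ> (?br v \<circ> ?br w)) = op_trace m ((?br v \<circ> ?br w) \<circ> ?br x)"
    by (intro op_trace_comm lin_op_comp lin_op_lbracket)
  then show ?thesis using 1 2 by simp
qed

text \<open>Invariance makes the radical of the form an ideal, and this ideal is proper because the
  form is not identically zero.\<close>

lemma killing_radical_trivial:
  assumes simple: "simple_lie m c" and v: "v \<in> lvecs m"
    and rad: "\<And>b. b < m \<Longrightarrow> (\<Sum>a<m. v a * killing m c a b) = 0"
  shows "v = 0"
proof -
  let ?br = "lbracket m c"
  have lie: "lie_alg m c" using simple by (simp add: simple_lie_def)
  define R where "R = {v \<in> lvecs m. \<forall>w\<in>lvecs m. op_trace m (?br v \<circ> ?br w) = 0}"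
  have "lie_ideal m c R"
    unfolding lie_ideal_def
  proof (intro conjI ballI allI)
    show "R \<subseteq> lvecs m" by (auto simp: R_def)
    have "0 \<in> R" using cvec.subspace_0[OF subspace_lvecs] by (simp add: R_def op_trace_def lbracket_zero_left)
    then show "(\<lambda>_. 0) \<in> R" by (simp add: zero_fun_def)
    show "(\<lambda>i. x i + y i) \<in> R" if "x \<in> R" "y \<in> R" for x y
    proof -
      have "x + y \<in> R" using that cvec.subspace_add[OF subspace_lvecs]
        by (auto simp: R_def op_trace_def lbracket_add_left sum.distrib)
      then show ?thesis by (simp add: plus_fun_def)
    qed
    show "(\<lambda>i. r * x i) \<in> R" if "x \<in> R" for r x
    proof -
      have "vscale r x \<in> R" using that cvec.subspace_scale[OF subspace_lvecs]
        by (simp add: R_def op_trace_def lbracket_scale_left) (simp add: vscale_def flip: sum_distrib_left)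
      then show ?thesis by (simp add: vscale_def)
    qed
    show "?br x s \<in> R" if "x \<in> lvecs m" "s \<in> R" for x s
      unfolding R_def
    proof (intro CollectI conjI lbracket_in_lvecs ballI)
      fix w assume "w \<in> lvecs m"
      have "op_trace m (?br s \<circ> ?br (?br x w)) = 0"
        using that(2) lbracket_in_lvecs unfolding R_def by blast
      then show "op_trace m (?br (?br x s) \<circ> ?br w) = 0"
        using killing_trace_invariant[OF lie, of x s w] by simp
    qed
  qed
  then have "R = {\<lambda>_. 0} \<or> R = lvecs m" using simple by (simp add: simple_lie_def)
  moreover have "R \<noteq> lvecs m"
  proof
    assume R: "R = lvecs m"
    obtain a b where ab: "a < m" "b < m" "killing m c a b \<noteq> 0" using killing_nonzero[OF simple] by blast
    have "unitv a \<in> R" using R unitv_in_lvecs[OF ab(1)] by simp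
    then have "op_trace m (?br (unitv a) \<circ> ?br (unitv b)) = 0" using unitv_in_lvecs[OF ab(2)] by (simp add: R_def)
    then show False using ab killing_eq_op_trace[OF ab(1,2)] by simp
  qed
  moreover have "v \<in> R"
    unfolding R_def
  proof (intro CollectI conjI v ballI)
    fix w assume w: "w \<in> lvecs m"
    have "op_trace m (?br v \<circ> ?br w) = (\<Sum>a<m. \<Sum>b<m. w b * (v a * killing m c a b))"
      unfolding killing_form_expand[OF v w] by (simp add: mult_ac)
    also have "\<dots> = (\<Sum>b<m. w b * (\<Sum>a<m. v a * killing m c a b))"
      by (subst sum.swap) (simp add: sum_distrib_left)
    also have "\<dots> = 0" using rad by simp
    finally show "op_trace m (?br v \<circ> ?br w) = 0" .
  qed
  ultimately show ?thesis by (auto simp: zero_fun_def)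
qed

text \<open>Supplies the witness for the choice in \<open>ginv\<close>, which would otherwise be an
  arbitrary matrix.\<close>

lemma gform_invertible:
  assumes simple: "simple_lie m c" and lam: "lam \<noteq> 0"
  shows "\<exists>M. \<forall>a<m. \<forall>b<m. (\<Sum>k<m. gform m c lam a k * M k b) = (if a = b then 1 else 0)"
proof -
  define G where "G = mat m m (\<lambda>(i,j). gform m c lam i j)"
  have G: "G \<in> carrier_mat m m" by (simp add: G_def)
  have "det G \<noteq> 0"
  proof
    assume "det G = 0"
    then obtain v where v: "v \<in> carrier_vec m" "v \<noteq> 0\<^sub>v m" "G *\<^sub>v v = 0\<^sub>v m"
      using det_0_iff_vec_prod_zero_field[OF G] by blast
    define u where "u = (\<lambda>i. if i < m then v $ i else 0)"
    have "(\<Sum>a<m. u a * killing m c a b) = 0" if b: "b < m" for b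
    proof -
      have "(\<Sum>k<m. gform m c lam b k * v $ k) = (G *\<^sub>v v) $ b"
        using b v(1) by (simp add: G_def scalar_prod_def atLeast0LessThan)
      also have "\<dots> = 0" using v(3) b by simp
      finally have "lam * (\<Sum>a<m. killing m c b a * v $ a) = 0"
        by (simp add: gform_def sum_distrib_left mult.assoc)
      moreover have "(\<Sum>a<m. u a * killing m c a b) = (\<Sum>a<m. killing m c b a * v $ a)"
        using b by (intro sum.cong) (auto simp: u_def killing_sym[of b])
      ultimately show ?thesis using lam by simp
    qed
    then have "u = 0" by (intro killing_radical_trivial[OF simple]) (auto simp: u_def lvecs_def)
    then have u0: "u i = 0 i" for i by (rule fun_cong)
    have "v $ i = 0" if "i < m" for i using that u0[of i] by (simp add: u_def)
    then have "v = 0\<^sub>v m" using v(1) by (intro eq_vecI) auto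
    then show False using v(2) by simp
  qed
  define M where "M = (1 / det G) \<cdot>\<^sub>m adj_mat G"
  have M: "M \<in> carrier_mat m m" using adj_mat(1)[OF G] by (simp add: M_def)
  have "G * M = 1\<^sub>m m"
    unfolding M_def mult_smult_distrib[OF G adj_mat(1)[OF G]] adj_mat(2)[OF G]
    using \<open>det G \<noteq> 0\<close> by (intro eq_matI) auto
  moreover have "(\<Sum>k<m. gform m c lam a k * M $$ (k,b)) = (G * M) $$ (a,b)" if "a < m" "b < m" for a b
    using that M by (simp add: G_def scalar_prod_def atLeast0LessThan)
  ultimately show ?thesis by (intro exI[of _ "\<lambda>k b. M $$ (k,b)"]) auto
qed

section \<open>The enveloping algebra and the Casimir element\<close>

text \<open>Finite support is imposed because \<open>ug_ideal\<close> is closed under multiplication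
  by words only. Expanding both multipliers into finitely many words turns it into a two-sided ideal
  of a ring.\<close>

typedef fa = "{f :: nat list \<Rightarrow> complex. finite {w. f w \<noteq> 0}}"
  morphisms coef Abs_fa
  by (rule exI[of _ "\<lambda>_. 0"]) simp

setup_lifting type_definition_fa

lemma finite_support_conv:
  assumes "finite {w. f w \<noteq> (0::complex)}" "finite {w. g w \<noteq> 0}"
  shows "finite {w. (\<Sum>k\<le>length w. f (take k w) * g (drop k w)) \<noteq> 0}"
proof (rule finite_subset)
  show "{w. (\<Sum>k\<le>length w. f (take k w) * g (drop k w)) \<noteq> 0}
      \<subseteq> (\<lambda>(u,v). u @ v) ` ({w. f w \<noteq> 0} \<times> {w. g w \<noteq> 0})"
  proof
    fix w assume "w \<in> {w. (\<Sum>k\<le>length w. f (take k w) * g (drop k w)) \<noteq> 0}"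
    then obtain k where "f (take k w) * g (drop k w) \<noteq> 0"
      using sum.neutral[of "{..length w}" "\<lambda>k. f (take k w) * g (drop k w)"] by fastforce
    then show "w \<in> (\<lambda>(u,v). u @ v) ` ({w. f w \<noteq> 0} \<times> {w. g w \<noteq> 0})"
      by (intro image_eqI[of _ _ "(take k w, drop k w)"]) auto
  qed
qed (use assms in auto)

text \<open>Both sides run over the lengths \<open>l\<close> and \<open>d\<close> of the first two
  pieces when a word of length \<open>n\<close> is cut into three.\<close>

lemma conv_assoc_reindex:
  fixes f :: "nat \<Rightarrow> nat \<Rightarrow> 'a::comm_monoid_add"
  shows "(\<Sum>k\<le>n. \<Sum>l\<le>k. f l (k - l)) = (\<Sum>l\<le>n. \<Sum>d\<le>n - l. f l d)"
proof (induction n)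
  case (Suc n)
  have "(\<Sum>l\<le>Suc n. \<Sum>d\<le>Suc n - l. f l d) = (\<Sum>l\<le>n. (\<Sum>d\<le>n - l. f l d) + f l (Suc n - l)) + f (Suc n) 0"
    by (simp add: Suc_diff_le)
  then show ?case by (simp add: Suc sum.distrib add_ac)
qed simp

instantiation fa :: ring_1
begin

lift_definition zero_fa :: fa is "\<lambda>_. 0" by simp
lift_definition one_fa :: fa is "\<lambda>w. if w = [] then 1 else 0" by simp
lift_definition plus_fa :: "fa \<Rightarrow> fa \<Rightarrow> fa" is "\<lambda>f g w. f w + g w"
  subgoal for f g by (rule finite_subset[of _ "{w. f w \<noteq> 0} \<union> {w. g w \<noteq> 0}"]) auto
  done
lift_definition minus_fa :: "fa \<Rightarrow> fa \<Rightarrow> fa" is "\<lambda>f g w. f w - g w"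
  subgoal for f g by (rule finite_subset[of _ "{w. f w \<noteq> 0} \<union> {w. g w \<noteq> 0}"]) auto
  done
lift_definition uminus_fa :: "fa \<Rightarrow> fa" is "\<lambda>f w. - f w" by simp
lift_definition times_fa :: "fa \<Rightarrow> fa \<Rightarrow> fa" is "\<lambda>f g w. \<Sum>k\<le>length w. f (take k w) * g (drop k w)"
  by (rule finite_support_conv)

instance
proof
  fix a b d :: fa
  show "a + b + d = a + (b + d)" by transfer (auto simp: add_ac)
  show "a + b = b + a" by transfer (auto simp: add_ac)
  show "0 + a = a" by transfer auto
  show "- a + a = 0" by transfer auto
  show "a - b = a + - b" by transfer auto
  show "(a + b) * d = a * d + b * d" by transfer (auto simp: distrib_right sum.distrib)
  show "a * (b + d) = a * b + a * d" by transfer (auto simp: distrib_left sum.distrib)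
  show "(0::fa) \<noteq> 1" by transfer (auto simp: fun_eq_iff)
  show "1 * a = a"
  proof (transfer, rule ext)
    fix f :: "nat list \<Rightarrow> complex" and w
    have "(\<Sum>k\<le>length w. (if take k w = [] then 1 else 0) * f (drop k w))
        = (\<Sum>k\<le>length w. if k = 0 then f w else 0)"
      by (intro sum.cong) auto
    then show "(\<Sum>k\<le>length w. (if take k w = [] then 1 else 0) * f (drop k w)) = f w" by simp
  qed
  show "a * 1 = a"
  proof (transfer, rule ext)
    fix f :: "nat list \<Rightarrow> complex" and w
    have "(\<Sum>k\<le>length w. f (take k w) * (if drop k w = [] then 1 else 0))
        = (\<Sum>k\<le>length w. if k = length w then f w else 0)"
      by (intro sum.cong) auto
    then show "(\<Sum>k\<le>length w. f (take k w) * (if drop k w = [] then 1 else 0)) = f w" by simp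
  qed
  show "a * b * d = a * (b * d)"
  proof (transfer, rule ext)
    fix f g h :: "nat list \<Rightarrow> complex" and w :: "nat list"
    let ?F = "\<lambda>l d. f (take l w) * g (take d (drop l w)) * h (drop (l + d) w)"
    have "(\<Sum>k\<le>length w. (\<Sum>l\<le>length (take k w). f (take l (take k w)) * g (drop l (take k w))) * h (drop k w))
        = (\<Sum>k\<le>length w. \<Sum>l\<le>k. ?F l (k - l))"
      unfolding sum_distrib_right
      by (intro sum.cong) (auto simp: min_def drop_take)
    also have "\<dots> = (\<Sum>l\<le>length w. \<Sum>d\<le>length w - l. ?F l d)" by (rule conv_assoc_reindex)
    also have "\<dots> = (\<Sum>l\<le>length w. f (take l w) * (\<Sum>d\<le>length (drop l w). g (take d (drop l w)) * h (drop d (drop l w))))"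
      unfolding sum_distrib_left by (intro sum.cong) (auto simp: mult.assoc add.commute)
    finally show "(\<Sum>k\<le>length w. (\<Sum>l\<le>length (take k w). f (take l (take k w)) * g (drop l (take k w))) * h (drop k w))
      = (\<Sum>l\<le>length w. f (take l w) * (\<Sum>d\<le>length (drop l w). g (take d (drop l w)) * h (drop d (drop l w))))" .
  qed
qed

end

lift_definition scl :: "complex \<Rightarrow> fa \<Rightarrow> fa" is "\<lambda>r f w. r * f w"
  by (rule finite_subset[rotated]) auto

lift_definition word :: "nat list \<Rightarrow> fa" is fa_word
  by (simp add: fa_word_def)

lemma scl_mult_left [simp]: "scl r x * y = scl r (x * y)"
  by transfer (simp add: sum_distrib_left mult.assoc)

lemma scl_mult_right [simp]: "x * scl r y = scl r (x * y)"
  by transfer (simp add: sum_distrib_left mult_ac)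

lemma scl_scl [simp]: "scl r (scl s x) = scl (r * s) x"
  by transfer (simp add: mult.assoc)

lemma scl_one [simp]: "scl 1 x = x"
  by transfer simp

lemma scl_zero [simp]: "scl 0 x = 0"
  by transfer simp

lemma scl_zero_right [simp]: "scl r 0 = 0"
  by transfer simp

lemma scl_add_left: "scl (r + s) x = scl r x + scl s x"
  by transfer (simp add: distrib_right)

lemma scl_add_right: "scl r (x + y) = scl r x + scl r y"
  by transfer (simp add: distrib_left)

lemma scl_minus_left: "scl (- r) x = - scl r x"
  by transfer simp

lemma scl_diff_right: "scl r (x - y) = scl r x - scl r y"
  by transfer (simp add: right_diff_distrib)

lemma scl_sum_left: "scl (\<Sum>i\<in>A. f i) x = (\<Sum>i\<in>A. scl (f i) x)"
  by (induction A rule: infinite_finite_induct) (auto simp: scl_add_left)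

lemma scl_sum_right: "scl r (\<Sum>i\<in>A. f i) = (\<Sum>i\<in>A. scl r (f i))"
  by (induction A rule: infinite_finite_induct) (auto simp: scl_add_right)

lemma word_Nil: "word [] = 1"
  by transfer (auto simp: fa_word_def)

lemma word_append: "word (u @ v) = word u * word v"
proof (transfer, rule ext)
  fix u v w :: "nat list"
  have "fa_word u (take k w) * fa_word v (drop k w) = (if k = length u then fa_word (u @ v) w else 0)"
    if "k \<le> length w" for k
  proof (cases "k = length u \<and> w = u @ v")
    case False
    have "\<not> (take k w = u \<and> drop k w = v)"
    proof
      assume *: "take k w = u \<and> drop k w = v"
      then have "w = u @ v" using append_take_drop_id[of k w] by simp
      moreover have "k = length u" using * that by auto
      ultimately show False using False by simp
    qed
    then show ?thesis using False by (auto simp: fa_word_def)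
  qed (simp add: fa_word_def)
  then have "(\<Sum>k\<le>length w. fa_word u (take k w) * fa_word v (drop k w))
      = (\<Sum>k\<le>length w. if k = length u then fa_word (u @ v) w else 0)"
    by (intro sum.cong) auto
  also have "\<dots> = fa_word (u @ v) w"
    by (auto simp: fa_word_def)
  finally show "fa_word (u @ v) w = (\<Sum>k\<le>length w. fa_word u (take k w) * fa_word v (drop k w))" by simp
qed

lemma coef_add: "coef (x + y) = fa_add (coef x) (coef y)"
  by (simp add: plus_fa.rep_eq fa_add_def)

lemma coef_diff: "coef (x - y) = fa_sub (coef x) (coef y)"
  by (simp add: minus_fa.rep_eq fa_sub_def)

lemma coef_scl: "coef (scl r x) = fa_smult r (coef x)"
  by (simp add: scl.rep_eq fa_smult_def)

lemma coef_mult: "coef (x * y) = fa_mult (coef x) (coef y)"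
  by (simp add: times_fa.rep_eq fa_mult_def)

lemma coef_sum_apply: "coef (\<Sum>i\<in>A. f i) w = (\<Sum>i\<in>A. coef (f i) w)"
  by (induction A rule: infinite_finite_induct) (auto simp: zero_fa.rep_eq plus_fa.rep_eq)

lemma fa_expand: "x = (\<Sum>w\<in>{w. coef x w \<noteq> 0}. scl (coef x w) (word w))"
proof -
  have fin: "finite {w. coef x w \<noteq> 0}" using coef[of x] by simp
  have "coef x v = coef (\<Sum>w\<in>{w. coef x w \<noteq> 0}. scl (coef x w) (word w)) v" for v
  proof -
    have "coef (\<Sum>w\<in>{w. coef x w \<noteq> 0}. scl (coef x w) (word w)) v
        = (\<Sum>w\<in>{w. coef x w \<noteq> 0}. if v = w then coef x w else 0)"
      unfolding coef_sum_apply by (intro sum.cong) (auto simp: scl.rep_eq word.rep_eq fa_word_def)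
    then show ?thesis using fin by (simp add: sum.delta')
  qed
  then have "coef x = coef (\<Sum>w\<in>{w. coef x w \<noteq> 0}. scl (coef x w) (word w))" by (rule ext)
  then show ?thesis by (rule coef_inject[THEN iffD1])
qed

section \<open>Congruence modulo the defining ideal of the enveloping algebra\<close>

definition ucong :: "nat \<Rightarrow> (nat \<Rightarrow> nat \<Rightarrow> nat \<Rightarrow> complex) \<Rightarrow> fa \<Rightarrow> fa \<Rightarrow> bool" where
  "ucong m c x y \<longleftrightarrow> coef (x - y) \<in> ug_ideal m c"

lemma U_eq_coef: "U_eq m c (coef x) (coef y) \<longleftrightarrow> ucong m c x y"
  by (simp add: U_eq_def ucong_def coef_diff)

context
  fixes m :: nat and c :: "nat \<Rightarrow> nat \<Rightarrow> nat \<Rightarrow> complex"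
begin

private definition I where "I = {x. coef x \<in> ug_ideal m c}"

private lemma I_add: "x \<in> I \<Longrightarrow> y \<in> I \<Longrightarrow> x + y \<in> I"
  by (simp add: I_def coef_add ug_ideal.add)

private lemma I_scl: "x \<in> I \<Longrightarrow> scl r x \<in> I"
  by (simp add: I_def coef_scl ug_ideal.smult)

private lemma I_zero: "0 \<in> I"
  by (simp add: I_def zero_fa.rep_eq ug_ideal.zero)

private lemma I_sum: "(\<And>i. i \<in> A \<Longrightarrow> f i \<in> I) \<Longrightarrow> (\<Sum>i\<in>A. f i) \<in> I"
  by (induction A rule: infinite_finite_induct) (auto intro: I_zero I_add)

private lemma I_word: "x \<in> I \<Longrightarrow> word u * x * word v \<in> I"
  by (simp add: I_def coef_mult word.rep_eq ug_ideal.mult)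

private lemma I_mult: "x \<in> I \<Longrightarrow> y * x * z \<in> I"
proof -
  assume x: "x \<in> I"
  have "y * x * z = (\<Sum>w\<in>{w. coef y w \<noteq> 0}. scl (coef y w) (word w)) * x * (\<Sum>w\<in>{w. coef z w \<noteq> 0}. scl (coef z w) (word w))"
    by (intro arg_cong2[of _ _ _ _ "(*)"] refl fa_expand)
  also have "\<dots> \<in> I"
    unfolding sum_distrib_left sum_distrib_right by (simp add: x I_sum I_scl I_word)
  finally show ?thesis .
qed

lemma ucong_refl [simp]: "ucong m c x x"
  using I_zero by (simp add: ucong_def I_def)

lemma ucong_sym: "ucong m c x y \<Longrightarrow> ucong m c y x"
  using I_scl[of "x - y" "-1"] by (simp add: ucong_def I_def scl_minus_left)

lemma ucong_add: "ucong m c x y \<Longrightarrow> ucong m c x' y' \<Longrightarrow> ucong m c (x + x') (y + y')"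
  using I_add[of "x - y" "x' - y'"] by (simp add: ucong_def I_def algebra_simps)

lemma ucong_trans [trans]: "ucong m c x y \<Longrightarrow> ucong m c y z \<Longrightarrow> ucong m c x z"
  using I_add[of "x - y" "y - z"] by (simp add: ucong_def I_def)

lemma ucong_scl: "ucong m c x y \<Longrightarrow> ucong m c (scl r x) (scl r y)"
  using I_scl[of "x - y" r] by (simp add: ucong_def I_def scl_diff_right)

lemma ucong_minus: "ucong m c x y \<Longrightarrow> ucong m c (- x) (- y)"
  using ucong_scl[of x y "-1"] by (simp add: scl_minus_left)

lemma ucong_diff: "ucong m c x y \<Longrightarrow> ucong m c x' y' \<Longrightarrow> ucong m c (x - x') (y - y')"
  using ucong_add[of x y "- x'" "- y'"] ucong_minus[of x' y'] by simp

lemma ucong_sum: "(\<And>i. i \<in> A \<Longrightarrow> ucong m c (f i) (g i)) \<Longrightarrow> ucong m c (\<Sum>i\<in>A. f i) (\<Sum>i\<in>A. g i)"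
  by (induction A rule: infinite_finite_induct) (auto intro: ucong_add)

lemma ucong_mult: "ucong m c x y \<Longrightarrow> ucong m c x' y' \<Longrightarrow> ucong m c (x * x') (y * y')"
proof -
  assume "ucong m c x y" "ucong m c x' y'"
  then have "1 * (x - y) * x' + y * (x' - y') * 1 \<in> I"
    by (intro I_add I_mult) (simp_all add: ucong_def I_def)
  then show ?thesis by (simp add: ucong_def I_def algebra_simps)
qed

lemma ucong_commutator:
  assumes "a < m" "b < m"
  shows "ucong m c (word [a] * word [b] - word [b] * word [a]) (\<Sum>k<m. scl (c a b k) (word [k]))"
proof -
  have "coef (word [a] * word [b] - word [b] * word [a] - (\<Sum>k<m. scl (c a b k) (word [k])))
      = (\<lambda>w. fa_word [a,b] w - fa_word [b,a] w - (\<Sum>k<m. c a b k * fa_word [k] w))"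
    unfolding word_append[symmetric]
    by (rule ext) (simp add: minus_fa.rep_eq coef_sum_apply scl.rep_eq word.rep_eq)
  then show ?thesis unfolding ucong_def using ug_ideal.gen[OF assms] by simp
qed

end

lemma eq_ucong_trans [trans]: "x = y \<Longrightarrow> ucong m c y z \<Longrightarrow> ucong m c x z"
  and ucong_eq_trans [trans]: "ucong m c x y \<Longrightarrow> y = z \<Longrightarrow> ucong m c x z"
  by simp_all

text \<open>Invariance under ad of the \<open>b\<close>-th basis vector, with the sign absorbed by
  antisymmetry, in the index form behind \<open>trip_cyclic\<close>.\<close>

lemma killing_bracket:
  assumes lie: "lie_alg m c" and abd: "a < m" "b < m" "d < m"
  shows "(\<Sum>k<m. c a b k * killing m c k d) = (\<Sum>k<m. c b d k * killing m c a k)"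
proof -
  let ?br = "lbracket m c" and ?e = unitv
  have "op_trace m (?br (?br (?e b) (?e a)) \<circ> ?br (?e d)) = (\<Sum>k<m. c b a k * killing m c k d)"
    using abd by (simp add: killing_form_expand lbracket_in_lvecs unitv_in_lvecs mult.assoc sum_unitv lbracket_unitv
        flip: sum_distrib_left)
  moreover have "op_trace m (?br (?e a) \<circ> ?br (?br (?e b) (?e d))) = (\<Sum>k<m. c b d k * killing m c a k)"
    using abd by (simp add: killing_form_expand lbracket_in_lvecs unitv_in_lvecs mult.assoc sum_unitv lbracket_unitv
        flip: sum_distrib_left)
  moreover have "(\<Sum>k<m. c b a k * killing m c k d) = - (\<Sum>k<m. c a b k * killing m c k d)"
    unfolding sum_negf[symmetric]
    by (intro sum.cong refl) (subst lie_alg_antisym[OF lie abd(2,1)], auto)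
  ultimately show ?thesis using killing_trace_invariant[OF lie, of "?e b" "?e a" "?e d"] by simp
qed

section \<open>Invariant tensors and the Casimir element\<close>

locale simple_lie_form =
  fixes m :: nat and c :: "nat \<Rightarrow> nat \<Rightarrow> nat \<Rightarrow> complex" and lam :: complex
  assumes simple: "simple_lie m c" and lam: "lam \<noteq> 0"
begin

abbreviation K where "K \<equiv> killing m c"
abbreviation G where "G \<equiv> gform m c lam"
abbreviation g where "g \<equiv> ginv m c lam"
abbreviation t where "t \<equiv> trip m c lam"
abbreviation E where "E a \<equiv> word [a]"
abbreviation cong (infix "\<approx>" 50) where "x \<approx> y \<equiv> ucong m c x y"

lemma lie: "lie_alg m c"
  using simple by (simp add: simple_lie_def)

lemma G_sym: "a < m \<Longrightarrow> b < m \<Longrightarrow> G a b = G b a"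
  by (simp add: gform_def killing_sym[of a m b])

lemma G_g: "a < m \<Longrightarrow> b < m \<Longrightarrow> (\<Sum>k<m. G a k * g k b) = (if a = b then 1 else 0)"
  using someI_ex[OF gform_invertible[OF simple lam]] unfolding ginv_def by blast

text \<open>\<open>ginv\<close> is chosen only as a right inverse. The product of the transpose of
  \<open>g\<close>, \<open>G\<close> and \<open>g\<close>, evaluated with both bracketings, is
  \<open>g\<close> on one hand and its transpose on the other, as \<open>G\<close> is
  symmetric.\<close>

lemma g_sym:
  assumes "a < m" "b < m"
  shows "g a b = g b a"
proof -
  have "g a b = (\<Sum>l<m. if l = a then g l b else 0)" using assms by simp
  also have "\<dots> = (\<Sum>l<m. (\<Sum>k<m. G l k * g k a) * g l b)"
    using assms by (intro sum.cong) (auto simp: G_g)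
  also have "\<dots> = (\<Sum>l<m. \<Sum>k<m. g k a * (G k l * g l b))"
    unfolding sum_distrib_right by (intro sum.cong refl) (simp add: G_sym)
  also have "\<dots> = (\<Sum>k<m. g k a * (\<Sum>l<m. G k l * g l b))"
    unfolding sum_distrib_left by (rule sum.swap)
  also have "\<dots> = (\<Sum>k<m. if k = b then g k a else 0)"
    using assms by (intro sum.cong) (auto simp: G_g)
  also have "\<dots> = g b a" using assms by simp
  finally show ?thesis .
qed

lemma trip_cyclic:
  assumes "a < m" "b < m" "d < m"
  shows "t a b d = t b d a"
proof -
  have "t a b d = lam * (\<Sum>k<m. c a b k * K k d)"
    by (simp add: trip_def gform_def sum_distrib_left mult_ac)
  also have "\<dots> = lam * (\<Sum>k<m. c b d k * K a k)" by (simp add: killing_bracket[OF lie assms])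
  also have "\<dots> = t b d a"
    unfolding trip_def gform_def sum_distrib_left
    by (intro sum.cong refl) (use assms killing_sym in auto)
  finally show ?thesis .
qed

lemma trip_antisym:
  assumes "a < m" "b < m"
  shows "t a b d = - t b a d"
  unfolding trip_def sum_negf[symmetric]
  by (intro sum.cong refl) (subst lie_alg_antisym[OF lie assms], auto)

text \<open>The inverse Gram matrix raises the index that \<open>trip\<close> lowers.\<close>

lemma trip_g:
  assumes "a < m" "b < m" "k < m"
  shows "(\<Sum>q<m. t a b q * g q k) = c a b k"
proof -
  have "(\<Sum>q<m. t a b q * g q k) = (\<Sum>q<m. \<Sum>r<m. c a b r * (G r q * g q k))"
    by (simp add: trip_def sum_distrib_right mult.assoc)
  also have "\<dots> = (\<Sum>r<m. c a b r * (\<Sum>q<m. G r q * g q k))"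
    unfolding sum_distrib_left by (rule sum.swap)
  also have "\<dots> = (\<Sum>r<m. if r = k then c a b r else 0)"
    using assms by (intro sum.cong) (auto simp: G_g)
  finally show ?thesis using assms by simp
qed

text \<open>The adjoint action annihilates the dual-basis tensor: after inserting
  \<open>trip_g\<close> the two sums differ by the exchange of two indices of the totally
  antisymmetric \<open>t\<close>, hence by a sign.\<close>

lemma g_invariant:
  assumes "d < m" "a < m" "b < m"
  shows "(\<Sum>l<m. c d l a * g l b) + (\<Sum>l<m. c d l b * g a l) = 0"
proof -
  have "(\<Sum>l<m. c d l a * g l b) = (\<Sum>l<m. \<Sum>q<m. t d l q * g q a * g l b)"
    using assms by (intro sum.cong refl) (simp add: trip_g flip: sum_distrib_right)
  moreover have "(\<Sum>l<m. c d l b * g a l) = (\<Sum>l<m. \<Sum>q<m. t d l q * g q b * g a l)"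
    using assms by (intro sum.cong refl) (simp add: trip_g flip: sum_distrib_right)
  moreover have "\<dots> = (\<Sum>q<m. \<Sum>l<m. t d l q * g q b * g a l)" by (rule sum.swap)
  moreover have "\<dots> = (\<Sum>l<m. \<Sum>q<m. - (t d l q * g q a * g l b))"
  proof (intro sum.cong refl)
    fix l q assume lq: "l \<in> {..<m}" "q \<in> {..<m}"
    then have "t d q l = - t d l q"
      using assms trip_cyclic[of d q l] trip_cyclic[of d l q] trip_antisym[of q l d] by simp
    then show "t d q l * g l b * g a q = - (t d l q * g q a * g l b)"
      using lq assms g_sym[of a q] by simp
  qed
  ultimately show ?thesis by (simp add: sum_negf)
qed

definition Phi :: "fa \<Rightarrow> fa" where
  "Phi X = (\<Sum>a<m. \<Sum>b<m. scl (g a b) (E a * X * E b))"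

definition Cas :: fa where "Cas = Phi 1"

definition lie_elem :: "nat \<Rightarrow> nat \<Rightarrow> fa" where
  "lie_elem a b = (\<Sum>k<m. scl (c a b k) (E k))"

lemma Phi_add: "Phi (X + Y) = Phi X + Phi Y"
  by (simp add: Phi_def distrib_left distrib_right scl_add_right sum.distrib)

lemma Phi_scl: "Phi (scl r X) = scl r (Phi X)"
  by (simp add: Phi_def scl_sum_right mult.commute)

lemma Phi_zero: "Phi 0 = 0"
  by (simp add: Phi_def)

lemma Phi_cong: "X \<approx> Y \<Longrightarrow> Phi X \<approx> Phi Y"
  unfolding Phi_def by (intro ucong_sum ucong_scl ucong_mult ucong_refl)

lemma commute: "a < m \<Longrightarrow> b < m \<Longrightarrow> E a * E b \<approx> E b * E a + lie_elem a b"
  using ucong_add[OF ucong_commutator[of a m b c] ucong_refl[of m c "E b * E a"]]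
  by (simp add: lie_elem_def add.commute)

lemma commute_diff: "a < m \<Longrightarrow> b < m \<Longrightarrow> lie_elem a b \<approx> E a * E b - E b * E a"
  unfolding lie_elem_def by (rule ucong_sym) (rule ucong_commutator)

lemma Cas_commute_gen:
  assumes "d < m"
  shows "E d * Cas \<approx> Cas * E d"
proof -
  have 1: "E d * (E a * E b) \<approx> E a * E b * E d + (E a * lie_elem d b + lie_elem d a * E b)" if "a < m" "b < m" for a b
  proof -
    have "E d * (E a * E b) = (E d * E a) * E b" by (simp add: mult.assoc)
    also have "\<dots> \<approx> (E a * E d + lie_elem d a) * E b"
      by (intro ucong_mult ucong_refl commute assms that)
    also have "\<dots> = E a * (E d * E b) + lie_elem d a * E b" by (simp add: algebra_simps)
    also have "\<dots> \<approx> E a * (E b * E d + lie_elem d b) + lie_elem d a * E b"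
      by (intro ucong_add ucong_mult ucong_refl commute assms that)
    also have "\<dots> = E a * E b * E d + (E a * lie_elem d b + lie_elem d a * E b)" by (simp add: algebra_simps)
    finally show ?thesis .
  qed
  have "E d * Cas = (\<Sum>a<m. \<Sum>b<m. scl (g a b) (E d * (E a * E b)))"
    by (simp add: Cas_def Phi_def sum_distrib_left)
  also have "\<dots> \<approx> (\<Sum>a<m. \<Sum>b<m. scl (g a b) (E a * E b * E d + (E a * lie_elem d b + lie_elem d a * E b)))"
    by (intro ucong_sum ucong_scl 1) auto
  also have "\<dots> = Cas * E d + ((\<Sum>a<m. \<Sum>b<m. scl (g a b) (E a * lie_elem d b)) + (\<Sum>a<m. \<Sum>b<m. scl (g a b) (lie_elem d a * E b)))"
    by (simp add: Cas_def Phi_def sum_distrib_right scl_add_right sum.distrib)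
  \<comment> \<open>Collected over common monomials, the two correction sums have the two halves of
    \<open>g_invariant\<close> as coefficients.\<close>
  also have "(\<Sum>a<m. \<Sum>b<m. scl (g a b) (E a * lie_elem d b)) + (\<Sum>a<m. \<Sum>b<m. scl (g a b) (lie_elem d a * E b)) = 0"
  proof -
    have "(\<Sum>a<m. \<Sum>b<m. scl (g a b) (E a * lie_elem d b)) = (\<Sum>a<m. \<Sum>b<m. \<Sum>k<m. scl (c d b k * g a b) (E a * E k))"
      by (simp add: lie_elem_def sum_distrib_left scl_sum_right mult.commute)
    also have "\<dots> = (\<Sum>a<m. \<Sum>k<m. \<Sum>b<m. scl (c d b k * g a b) (E a * E k))"
      by (intro sum.cong refl sum.swap)
    also have "\<dots> = (\<Sum>a<m. \<Sum>k<m. scl (\<Sum>b<m. c d b k * g a b) (E a * E k))"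
      by (simp add: scl_sum_left)
    finally have S1: "(\<Sum>a<m. \<Sum>b<m. scl (g a b) (E a * lie_elem d b)) = \<dots>" .
    have "(\<Sum>a<m. \<Sum>b<m. scl (g a b) (lie_elem d a * E b)) = (\<Sum>a<m. \<Sum>b<m. \<Sum>k<m. scl (c d a k * g a b) (E k * E b))"
      by (simp add: lie_elem_def sum_distrib_right scl_sum_right mult.commute)
    also have "\<dots> = (\<Sum>a<m. \<Sum>k<m. \<Sum>b<m. scl (c d a k * g a b) (E k * E b))"
      by (intro sum.cong refl sum.swap)
    also have "\<dots> = (\<Sum>k<m. \<Sum>a<m. \<Sum>b<m. scl (c d a k * g a b) (E k * E b))"
      by (rule sum.swap)
    also have "\<dots> = (\<Sum>k<m. \<Sum>b<m. \<Sum>a<m. scl (c d a k * g a b) (E k * E b))"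
      by (intro sum.cong refl sum.swap)
    also have "\<dots> = (\<Sum>k<m. \<Sum>b<m. scl (\<Sum>a<m. c d a k * g a b) (E k * E b))"
      by (simp add: scl_sum_left)
    finally have S2: "(\<Sum>a<m. \<Sum>b<m. scl (g a b) (lie_elem d a * E b)) = \<dots>" .
    show ?thesis
      unfolding S1 S2 sum.distrib[symmetric] scl_add_left[symmetric]
      by (intro sum.neutral ballI)
        (use g_invariant[OF assms] in \<open>simp add: add.commute\<close>)
  qed
  finally show ?thesis by simp
qed

text \<open>The left side is the matrix of minus the Casimir element in the adjoint representation.
  Paired with a basis vector \<open>y\<close> it becomes minus the trace form of that
  representation, \<open>- K y x\<close>, and the Killing form is 1/\<lambda> times the chosen
  form.\<close>

lemma adjoint_casimir:
  assumes "x < m" "r < m"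
  shows "(\<Sum>a<m. \<Sum>k<m. (\<Sum>b<m. g a b * c x b k) * c a k r) = (if x = r then - (1 / lam) else 0)"
proof -
  define n where "n a k = (\<Sum>b<m. g a b * c x b k)" for a k
  have n: "n a k = - (\<Sum>l<m. c x l a * g l k)" if "a < m" "k < m" for a k
    using g_invariant[OF assms(1) that] by (simp add: n_def eq_neg_iff_add_eq_0 add.commute mult.commute)
  define M where "M r = (\<Sum>a<m. \<Sum>k<m. n a k * c a k r)" for r
  have MG: "(\<Sum>r<m. M r * G r y) = - (1 / lam) * G x y" if y: "y < m" for y
  proof -
    have "(\<Sum>r<m. M r * G r y) = (\<Sum>r<m. \<Sum>a<m. \<Sum>k<m. n a k * (c a k r * G r y))"
      by (simp add: M_def sum_distrib_right mult.assoc)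
    also have "\<dots> = (\<Sum>a<m. \<Sum>r<m. \<Sum>k<m. n a k * (c a k r * G r y))" by (rule sum.swap)
    also have "\<dots> = (\<Sum>a<m. \<Sum>k<m. \<Sum>r<m. n a k * (c a k r * G r y))" by (intro sum.cong refl sum.swap)
    also have "\<dots> = (\<Sum>a<m. \<Sum>k<m. n a k * t a k y)" by (simp add: trip_def sum_distrib_left)
    also have "\<dots> = (\<Sum>a<m. \<Sum>k<m. - (\<Sum>l<m. \<Sum>s<m. c x l a * c y a s * (G s k * g k l)))"
    proof (intro sum.cong refl)
      fix a k assume ak: "a \<in> {..<m}" "k \<in> {..<m}"
      then have "t a k y = t y a k" using y trip_cyclic[of y a k] by simp
      then have "n a k * t a k y = - ((\<Sum>l<m. c x l a * g l k) * (\<Sum>s<m. c y a s * G s k))"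
        using ak by (simp add: n trip_def)
      also have "(\<Sum>l<m. c x l a * g l k) * (\<Sum>s<m. c y a s * G s k) = (\<Sum>l<m. \<Sum>s<m. c x l a * c y a s * (G s k * g k l))"
        unfolding sum_product using ak by (intro sum.cong refl) (use g_sym in auto)
      finally show "n a k * t a k y = - (\<Sum>l<m. \<Sum>s<m. c x l a * c y a s * (G s k * g k l))" .
    qed
    also have "\<dots> = - (\<Sum>a<m. \<Sum>k<m. \<Sum>l<m. \<Sum>s<m. c x l a * c y a s * (G s k * g k l))"
      by (simp add: sum_negf)
    also have "(\<Sum>a<m. \<Sum>k<m. \<Sum>l<m. \<Sum>s<m. c x l a * c y a s * (G s k * g k l))
        = (\<Sum>a<m. \<Sum>l<m. \<Sum>k<m. \<Sum>s<m. c x l a * c y a s * (G s k * g k l))"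
      by (intro sum.cong refl sum.swap)
    also have "\<dots> = (\<Sum>a<m. \<Sum>l<m. \<Sum>s<m. \<Sum>k<m. c x l a * c y a s * (G s k * g k l))"
      by (intro sum.cong refl sum.swap)
    also have "\<dots> = (\<Sum>a<m. \<Sum>l<m. \<Sum>s<m. if s = l then c x l a * c y a s else 0)"
      by (intro sum.cong refl) (simp add: G_g flip: sum_distrib_left)
    also have "\<dots> = (\<Sum>a<m. \<Sum>l<m. c x l a * c y a l)" by simp
    also have "\<dots> = K y x" unfolding killing_def by (rule sum.swap)
    also have "\<dots> = (1 / lam) * G x y" using lam killing_sym[OF assms(1) y] by (simp add: gform_def)
    finally show ?thesis by simp
  qed
  \<comment> \<open>The inverse Gram matrix strips off the pairing with \<open>y\<close>.\<close>
  have "M r = (\<Sum>s<m. M s * (\<Sum>y<m. G s y * g y r))"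
  proof -
    have "(\<Sum>s<m. M s * (\<Sum>y<m. G s y * g y r)) = (\<Sum>s<m. if s = r then M s else 0)"
      using assms by (intro sum.cong) (auto simp: G_g)
    then show ?thesis using assms by simp
  qed
  also have "\<dots> = (\<Sum>y<m. (\<Sum>s<m. M s * G s y) * g y r)"
    unfolding sum_distrib_left sum_distrib_right by (subst sum.swap) (simp add: mult.assoc)
  also have "\<dots> = - (1 / lam) * (\<Sum>y<m. G x y * g y r)"
    unfolding sum_distrib_left by (intro sum.cong refl) (simp add: MG mult.assoc)
  also have "\<dots> = (if x = r then - (1 / lam) else 0)" using assms by (simp add: G_g)
  finally show ?thesis by (simp add: M_def n_def)
qed

text \<open>Moving \<open>E x\<close> to the right of \<open>E b\<close> leaves \<open>N\<close>,
  whose coefficient tensor is antisymmetric. So \<open>2 N\<close> is a sum of commutators, equal to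
  -1/\<lambda> times \<open>E x\<close> by \<open>adjoint_casimir\<close>; halving gives
  1/(2\<lambda>).\<close>

lemma Phi_gen:
  assumes "x < m"
  shows "Phi (E x) \<approx> Cas * E x - scl (1 / (2 * lam)) (E x)"
proof -
  define n where "n a k = (\<Sum>b<m. g a b * c x b k)" for a k
  have anti: "n a k = - n k a" if "a < m" "k < m" for a k
  proof -
    have "n a k = (\<Sum>l<m. c x l k * g a l)" by (simp add: n_def mult.commute)
    moreover have "n k a = (\<Sum>l<m. c x l a * g l k)"
      unfolding n_def by (intro sum.cong refl) (use g_sym that in auto)
    ultimately show ?thesis using g_invariant[OF assms that] by (simp add: eq_neg_iff_add_eq_0 add.commute)
  qed
  define N where "N = (\<Sum>a<m. \<Sum>k<m. scl (n a k) (E a * E k))"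
  have "Phi (E x) = (\<Sum>a<m. \<Sum>b<m. scl (g a b) (E a * (E x * E b)))" by (simp add: Phi_def mult.assoc)
  also have "\<dots> \<approx> (\<Sum>a<m. \<Sum>b<m. scl (g a b) (E a * (E b * E x + lie_elem x b)))"
    by (intro ucong_sum ucong_scl ucong_mult ucong_refl commute assms) auto
  also have "\<dots> = Cas * E x + (\<Sum>a<m. \<Sum>b<m. scl (g a b) (E a * lie_elem x b))"
    by (simp add: Cas_def Phi_def sum_distrib_right scl_add_right sum.distrib distrib_left mult.assoc)
  also have "(\<Sum>a<m. \<Sum>b<m. scl (g a b) (E a * lie_elem x b)) = (\<Sum>a<m. \<Sum>b<m. \<Sum>k<m. scl (g a b * c x b k) (E a * E k))"
    by (simp add: lie_elem_def sum_distrib_left scl_sum_right)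
  also have "\<dots> = (\<Sum>a<m. \<Sum>k<m. \<Sum>b<m. scl (g a b * c x b k) (E a * E k))"
    by (intro sum.cong refl sum.swap)
  also have "\<dots> = N" by (simp add: N_def n_def scl_sum_left)
  finally have 1: "Phi (E x) \<approx> Cas * E x + N" .
  have "N = (\<Sum>k<m. \<Sum>a<m. scl (n a k) (E a * E k))" unfolding N_def by (rule sum.swap)
  also have "\<dots> = (\<Sum>k<m. \<Sum>a<m. - scl (n k a) (E a * E k))"
  proof (intro sum.cong refl)
    fix k a assume "k \<in> {..<m}" "a \<in> {..<m}"
    then have "n a k = - n k a" by (intro anti) auto
    then show "scl (n a k) (E a * E k) = - scl (n k a) (E a * E k)" by (simp add: scl_minus_left)
  qed
  finally have "scl 2 N = (\<Sum>a<m. \<Sum>k<m. scl (n a k) (E a * E k)) + (\<Sum>k<m. \<Sum>a<m. - scl (n k a) (E a * E k))"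
    using scl_add_left[of 1 1 N] by (simp add: N_def[symmetric])
  also have "\<dots> = (\<Sum>a<m. \<Sum>k<m. scl (n a k) (E a * E k - E k * E a))"
    by (simp add: scl_diff_right sum_subtractf sum_negf)
  also have "\<dots> \<approx> (\<Sum>a<m. \<Sum>k<m. scl (n a k) (lie_elem a k))"
    by (intro ucong_sum ucong_scl ucong_sym[OF commute_diff]) auto
  also have "\<dots> = (\<Sum>a<m. \<Sum>k<m. \<Sum>r<m. scl (n a k * c a k r) (E r))"
    by (simp add: lie_elem_def scl_sum_right)
  also have "\<dots> = (\<Sum>a<m. \<Sum>r<m. \<Sum>k<m. scl (n a k * c a k r) (E r))"
    by (intro sum.cong refl sum.swap)
  also have "\<dots> = (\<Sum>r<m. \<Sum>a<m. \<Sum>k<m. scl (n a k * c a k r) (E r))"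
    by (rule sum.swap)
  also have "\<dots> = (\<Sum>r<m. scl (\<Sum>a<m. \<Sum>k<m. n a k * c a k r) (E r))"
    by (simp add: scl_sum_left)
  also have "\<dots> = (\<Sum>r<m. if r = x then scl (- (1 / lam)) (E r) else 0)"
    by (intro sum.cong refl) (use adjoint_casimir[OF assms] in \<open>auto simp: n_def\<close>)
  also have "\<dots> = scl (- (1 / lam)) (E x)" using assms by simp
  finally have "scl (1/2) (scl 2 N) \<approx> scl (1/2) (scl (- (1 / lam)) (E x))" by (rule ucong_scl)
  moreover have "scl (1/2) (scl (- (1 / lam)) (E x)) = - scl (1 / (2 * lam)) (E x)"
    unfolding scl_scl scl_minus_left[symmetric] by (simp add: mult.commute)
  ultimately have "N \<approx> - scl (1 / (2 * lam)) (E x)" by simp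
  from ucong_trans[OF 1 ucong_add[OF ucong_refl this]] show ?thesis by simp
qed

text \<open>The four positions of the chord after STU at both ends of a rung; \<open>Phi_gen\<close> evaluates the two of them in which it
  crosses a single leg.\<close>
lemma rung_relation:
  assumes "x < m" "y < m"
  shows "(\<Sum>d<m. \<Sum>u<m. scl (g u d) (lie_elem d x * lie_elem y u))
    \<approx> Phi (E x * E y) + scl (1 / lam) (E x * E y) - Cas * (E x * E y)"
proof -
  have "(\<Sum>d<m. \<Sum>u<m. scl (g u d) (lie_elem d x * lie_elem y u))
     \<approx> (\<Sum>d<m. \<Sum>u<m. scl (g u d) ((E d * E x - E x * E d) * (E y * E u - E u * E y)))"
    by (intro ucong_sum ucong_scl ucong_mult commute_diff assms) auto
  also have "\<dots> = (\<Sum>d<m. \<Sum>u<m. scl (g d u) ((E d * E x - E x * E d) * (E y * E u - E u * E y)))"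
    by (intro sum.cong refl) (use g_sym in auto)
  \<comment> \<open>The four products place the pair \<open>E d\<close>, \<open>E u\<close> around
    both letters, around \<open>x\<close>, around \<open>y\<close>, or between them. After
    \<open>Phi_gen\<close> the two occurrences of \<open>E x * Cas * E y\<close> cancel
    exactly.\<close>
  also have "\<dots> = Phi (E x * E y) - Phi (E x) * E y - E x * Phi (E y) + E x * Cas * E y"
    by (simp add: Phi_def Cas_def sum_distrib_left sum_distrib_right algebra_simps scl_diff_right scl_add_right
        sum.distrib sum_subtractf)
  also have "\<dots> \<approx> Phi (E x * E y) - (Cas * E x - scl (1 / (2 * lam)) (E x)) * E y
      - E x * (Cas * E y - scl (1 / (2 * lam)) (E y)) + E x * Cas * E y"
    by (intro ucong_add ucong_diff ucong_mult ucong_refl Phi_gen assms)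
  also have "\<dots> = Phi (E x * E y) + scl (1 / lam) (E x * E y) - Cas * (E x * E y)"
  proof -
    have "scl (1 / lam) (E x * E y) = scl (1 / (2 * lam)) (E x * E y) + scl (1 / (2 * lam)) (E x * E y)"
      unfolding scl_add_left[symmetric] by simp
    then show ?thesis by (simp add: algebra_simps)
  qed
  finally show ?thesis .
qed

text \<open>Elements of \<open>fa\<close> may contain letters beyond \<open>m\<close>, on which the
  ideal imposes no relations; so commuting with \<open>Cas\<close> is a property of individual
  elements here.\<close>

definition comm_Cas :: "fa \<Rightarrow> bool" where
  "comm_Cas x \<longleftrightarrow> x * Cas \<approx> Cas * x"

lemma comm_Cas_gen: "a < m \<Longrightarrow> comm_Cas (E a)"
  by (simp add: comm_Cas_def Cas_commute_gen)

lemma comm_Cas_mult: "comm_Cas x \<Longrightarrow> comm_Cas y \<Longrightarrow> comm_Cas (x * y)"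
proof -
  assume x: "comm_Cas x" and y: "comm_Cas y"
  have "x * y * Cas = x * (y * Cas)" by (simp add: mult.assoc)
  also have "\<dots> \<approx> x * (Cas * y)" by (intro ucong_mult ucong_refl y[unfolded comm_Cas_def])
  also have "\<dots> = (x * Cas) * y" by (simp add: mult.assoc)
  also have "\<dots> \<approx> (Cas * x) * y" by (intro ucong_mult ucong_refl x[unfolded comm_Cas_def])
  finally show ?thesis by (simp add: comm_Cas_def mult.assoc)
qed

lemma comm_Cas_scl: "comm_Cas x \<Longrightarrow> comm_Cas (scl r x)"
  unfolding comm_Cas_def using ucong_scl by simp

lemma comm_Cas_sum: "(\<And>i. i \<in> A \<Longrightarrow> comm_Cas (f i)) \<Longrightarrow> comm_Cas (\<Sum>i\<in>A. f i)"
  unfolding comm_Cas_def sum_distrib_left sum_distrib_right by (rule ucong_sum)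

lemma comm_Cas_Phi: "comm_Cas X \<Longrightarrow> comm_Cas (Phi X)"
  unfolding Phi_def by (intro comm_Cas_sum comm_Cas_scl comm_Cas_mult comm_Cas_gen) auto

lemma Phi_Cas: "Phi (Cas * X) \<approx> Cas * Phi X"
proof -
  have "Phi (Cas * X) = (\<Sum>a<m. \<Sum>b<m. scl (g a b) ((E a * Cas) * X * E b))" by (simp add: Phi_def mult.assoc)
  also have "\<dots> \<approx> (\<Sum>a<m. \<Sum>b<m. scl (g a b) ((Cas * E a) * X * E b))"
    by (intro ucong_sum ucong_scl ucong_mult ucong_refl Cas_commute_gen) auto
  also have "\<dots> = Cas * Phi X" by (simp add: Phi_def sum_distrib_left mult.assoc)
  finally show ?thesis .
qed

end

section \<open>State sums\<close>

lemma sum_PiE_Un: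
  assumes "A \<inter> B = {}"
  shows "(\<Sum>f\<in>(A \<union> B) \<rightarrow>\<^sub>E S. F f) = (\<Sum>f\<in>A \<rightarrow>\<^sub>E S. \<Sum>h\<in>B \<rightarrow>\<^sub>E S. F (\<lambda>x. if x \<in> A then f x else h x))"
  unfolding sum.cartesian_product
proof (rule sum.reindex_bij_witness[where i = "\<lambda>(f,h) x. if x \<in> A then f x else h x"
      and j = "\<lambda>f. (restrict f A, restrict f B)"])
  fix f assume f: "f \<in> (A \<union> B) \<rightarrow>\<^sub>E S"
  show eq: "(case (restrict f A, restrict f B) of (f, h) \<Rightarrow> \<lambda>x. if x \<in> A then f x else h x) = f"
    using f by (auto simp: fun_eq_iff restrict_def PiE_def extensional_def)
  show "(restrict f A, restrict f B) \<in> (A \<rightarrow>\<^sub>E S) \<times> (B \<rightarrow>\<^sub>E S)"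
    using f by (auto simp: PiE_def Pi_def)
  show "(case (restrict f A, restrict f B) of (f, h) \<Rightarrow> F (\<lambda>x. if x \<in> A then f x else h x)) = F f"
    using eq by simp
next
  fix p assume p: "p \<in> (A \<rightarrow>\<^sub>E S) \<times> (B \<rightarrow>\<^sub>E S)"
  then show "(\<lambda>f. (restrict f A, restrict f B)) (case p of (f,h) \<Rightarrow> \<lambda>x. if x \<in> A then f x else h x) = p"
    using assms by (auto simp: fun_eq_iff restrict_def PiE_def extensional_def split: prod.splits)
  show "(case p of (f,h) \<Rightarrow> \<lambda>x. if x \<in> A then f x else h x) \<in> (A \<union> B) \<rightarrow>\<^sub>E S"
    using p by (auto simp: PiE_def Pi_def extensional_def split: prod.splits)
qed

lemma sum_PiE_insert:
  assumes "x \<notin> A"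
  shows "(\<Sum>f\<in>insert x A \<rightarrow>\<^sub>E S. F f) = (\<Sum>a\<in>S. \<Sum>f\<in>A \<rightarrow>\<^sub>E S. F (f(x := a)))"
proof -
  have "inj_on (\<lambda>(y, g). g(x := y)) (S \<times> (A \<rightarrow>\<^sub>E S))" using inj_combinator[OF assms, of "\<lambda>_. S"] .
  then show ?thesis
    unfolding PiE_insert_eq sum.cartesian_product by (subst sum.reindex) (auto simp: o_def case_prod_unfold)
qed

lemma sum_PiE_insert':
  assumes "x \<notin> A"
  shows "(\<Sum>f\<in>insert x A \<rightarrow>\<^sub>E S. F f) = (\<Sum>f\<in>A \<rightarrow>\<^sub>E S. \<Sum>a\<in>S. F (f(x := a)))"
  unfolding sum_PiE_insert[OF assms] by (rule sum.swap)

context simple_lie_form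
begin

definition ew :: "(nat \<times> nat) list \<Rightarrow> (nat \<Rightarrow> nat) \<Rightarrow> complex" where
  "ew es f = prod_list (map (\<lambda>(x,y). g (f y) (f x)) es)"

definition vw :: "(nat \<times> nat \<times> nat) list \<Rightarrow> (nat \<Rightarrow> nat) \<Rightarrow> complex" where
  "vw vs f = prod_list (map (\<lambda>(a,b,d). t (f a) (f b) (f d)) vs)"

definition wval :: "diagram \<Rightarrow> fa" where
  "wval D = (\<Sum>f\<in>halfedges D \<rightarrow>\<^sub>E {..<m}. scl (ew (dedges D) f * vw (dverts D) f) (word (map f (dloop D))))"

lemma coef_wval: "coef (wval D) = wsys m c lam D"
  by (rule ext) (auto simp: wval_def wsys_def coef_sum_apply scl.rep_eq word.rep_eq fa_word_def ew_def vw_def intro!: sum.cong)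

text \<open>State sums run over extensional labellings of the half-edges. An edge leaving that set
  would read an uncontrolled label, and multiplicativity could fail.\<close>

definition wf_diag :: "diagram \<Rightarrow> bool" where
  "wf_diag D \<longleftrightarrow> (\<forall>(x,y)\<in>set (dedges D). x \<in> halfedges D \<and> y \<in> halfedges D)"

lemma halfedges_dmult: "halfedges (dmult D1 D2) = halfedges D1 \<union> halfedges D2"
  by (auto simp: halfedges_def dmult_def)

lemma ew_cong: "(\<And>x. x \<in> H \<Longrightarrow> f x = h x) \<Longrightarrow> \<forall>(x,y)\<in>set es. x \<in> H \<and> y \<in> H \<Longrightarrow> ew es f = ew es h"
  unfolding ew_def by (intro arg_cong[of _ _ prod_list] map_cong refl) auto

lemma vw_cong: "(\<And>x. x \<in> H \<Longrightarrow> f x = h x) \<Longrightarrow> \<forall>(a,b,d)\<in>set vs. a \<in> H \<and> b \<in> H \<and> d \<in> H \<Longrightarrow> vw vs f = vw vs h"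
  unfolding vw_def by (intro arg_cong[of _ _ prod_list] map_cong refl) auto

lemma verts_halfedges: "\<forall>(a,b,d)\<in>set (dverts D). a \<in> halfedges D \<and> b \<in> halfedges D \<and> d \<in> halfedges D"
  by (fastforce simp: halfedges_def)

lemma wval_dmult:
  assumes wf: "wf_diag D1" "wf_diag D2" and disj: "halfedges D1 \<inter> halfedges D2 = {}"
  shows "wval (dmult D1 D2) = wval D1 * wval D2"
proof -
  let ?w = "\<lambda>D f. scl (ew (dedges D) f * vw (dverts D) f) (word (map f (dloop D)))"
  have cong: "?w D f = ?w D h" if "wf_diag D" "\<And>x. x \<in> halfedges D \<Longrightarrow> f x = h x" for D f h
  proof -
    have "ew (dedges D) f = ew (dedges D) h"
      using that by (intro ew_cong[of "halfedges D"]) (auto simp: wf_diag_def)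
    moreover have "vw (dverts D) f = vw (dverts D) h"
      using that verts_halfedges by (intro vw_cong[of "halfedges D"])
    moreover have "map f (dloop D) = map h (dloop D)"
      using that(2) by (intro map_cong) (auto simp: halfedges_def)
    ultimately show ?thesis by (simp only:)
  qed
  have "wval (dmult D1 D2) = (\<Sum>f\<in>(halfedges D1 \<union> halfedges D2) \<rightarrow>\<^sub>E {..<m}. ?w D1 f * ?w D2 f)"
    unfolding wval_def halfedges_dmult
    by (intro sum.cong refl) (simp add: dmult_def ew_def vw_def word_append mult_ac)
  also have "\<dots> = (\<Sum>f\<in>halfedges D1 \<rightarrow>\<^sub>E {..<m}. \<Sum>h\<in>halfedges D2 \<rightarrow>\<^sub>E {..<m}. ?w D1 f * ?w D2 h)"
    unfolding sum_PiE_Un[OF disj]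
    by (intro sum.cong refl arg_cong2[of _ _ _ _ "(*)"] cong wf) (use disj in auto)
  also have "\<dots> = wval D1 * wval D2"
    unfolding wval_def by (simp add: sum_product)
  finally show ?thesis .
qed

lemma wval_dunit: "wval dunit = 1"
  by (simp add: wval_def dunit_def halfedges_def ew_def vw_def word_Nil)

definition depends_on :: "nat set \<Rightarrow> ((nat \<Rightarrow> nat) \<Rightarrow> 'b) \<Rightarrow> bool" where
  "depends_on H F \<longleftrightarrow> (\<forall>f h. (\<forall>x\<in>H. f x = h x) \<longrightarrow> F f = F h)"

lemma funpow_Phi_add: "(Phi ^^ n) (X + Y) = (Phi ^^ n) X + (Phi ^^ n) Y"
  by (induction n) (auto simp: Phi_add)

lemma funpow_Phi_scl: "(Phi ^^ n) (scl r X) = scl r ((Phi ^^ n) X)"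
  by (induction n) (auto simp: Phi_scl)

lemma funpow_Phi_zero: "(Phi ^^ n) 0 = 0"
  by (induction n) (auto simp: Phi_zero)

lemma funpow_Phi_sum: "(Phi ^^ n) (\<Sum>i\<in>A. f i) = (\<Sum>i\<in>A. (Phi ^^ n) (f i))"
  by (induction A rule: infinite_finite_induct) (auto simp: funpow_Phi_zero funpow_Phi_add)

lemma funpow_Phi_cong: "X \<approx> Y \<Longrightarrow> (Phi ^^ n) X \<approx> (Phi ^^ n) Y"
  by (induction n) (auto intro: Phi_cong)

lemma funpow_Phi_Cas: "(Phi ^^ n) (Cas * X) \<approx> Cas * (Phi ^^ n) X"
proof (induction n)
  case (Suc n)
  from ucong_trans[OF Phi_cong[OF Suc] Phi_Cas] show ?case by simp
qed simp

text \<open>Parallel chords are nested around the middle word, and summing over the labels of the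
  innermost one is one application of \<open>Phi\<close>. The last chord of \<open>T\<close> is the
  innermost, hence the induction from the end; \<open>H\<close>, \<open>F\<close> and
  \<open>l2\<close> are general because the peeled chord is first absorbed into them.\<close>

lemma chord_sum:
  fixes a b :: "nat \<Rightarrow> nat"
  assumes "depends_on H F" "set l1 \<subseteq> H" "set l2 \<subseteq> H" "set l3 \<subseteq> H"
    and "distinct T" "inj_on a (set T)" "inj_on b (set T)" "a ` set T \<inter> b ` set T = {}"
    and "H \<inter> (a ` set T \<union> b ` set T) = {}"
  shows "(\<Sum>f\<in>(H \<union> (a ` set T \<union> b ` set T)) \<rightarrow>\<^sub>E {..<m}.
      scl (F f * (\<Prod>k\<leftarrow>T. g (f (b k)) (f (a k)))) (word (map f (l1 @ map a T @ l2 @ rev (map b T) @ l3))))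
    = (\<Sum>f\<in>H \<rightarrow>\<^sub>E {..<m}. scl (F f) (word (map f l1) * (Phi ^^ length T) (word (map f l2)) * word (map f l3)))"
  using assms
proof (induction T arbitrary: H F l2 rule: rev_induct)
  case Nil
  then show ?case by (simp add: word_append mult.assoc)
next
  case (snoc k T)
  define H' where "H' = insert (a k) (insert (b k) H)"
  define F' where "F' f = F f * g (f (b k)) (f (a k))" for f
  have ak: "a k \<notin> insert (b k) H" and bk: "b k \<notin> H" using snoc.prems by auto
  have H': "H \<union> (a ` set (T @ [k]) \<union> b ` set (T @ [k])) = H' \<union> (a ` set T \<union> b ` set T)"
    by (auto simp: H'_def)
  have "(\<Sum>f\<in>(H \<union> (a ` set (T @ [k]) \<union> b ` set (T @ [k]))) \<rightarrow>\<^sub>E {..<m}.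
      scl (F f * (\<Prod>k\<leftarrow>T @ [k]. g (f (b k)) (f (a k))))
        (word (map f (l1 @ map a (T @ [k]) @ l2 @ rev (map b (T @ [k])) @ l3))))
    = (\<Sum>f\<in>(H' \<union> (a ` set T \<union> b ` set T)) \<rightarrow>\<^sub>E {..<m}.
      scl (F' f * (\<Prod>k\<leftarrow>T. g (f (b k)) (f (a k))))
        (word (map f (l1 @ map a T @ ([a k] @ l2 @ [b k]) @ rev (map b T) @ l3))))"
    unfolding H' by (intro sum.cong refl) (simp add: F'_def mult_ac)
  also have "\<dots> = (\<Sum>f\<in>H' \<rightarrow>\<^sub>E {..<m}. scl (F' f)
      (word (map f l1) * (Phi ^^ length T) (word (map f ([a k] @ l2 @ [b k]))) * word (map f l3)))"
  proof (rule snoc.IH)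
    show "depends_on H' F'"
      using snoc.prems(1) unfolding depends_on_def F'_def H'_def by (metis insert_iff)
    show "inj_on a (set T)" "inj_on b (set T)" using snoc.prems(6,7) by (auto simp: inj_on_def)
    show "H' \<inter> (a ` set T \<union> b ` set T) = {}"
      using snoc.prems(5-9) by (auto simp: H'_def inj_on_def)
  qed (use snoc.prems in \<open>auto simp: H'_def\<close>)
  also have "\<dots> = (\<Sum>f\<in>H \<rightarrow>\<^sub>E {..<m}. \<Sum>y<m. \<Sum>x<m. scl (F f * g y x)
      (word (map f l1) * (Phi ^^ length T) (E x * word (map f l2) * E y) * word (map f l3)))"
    unfolding H'_def sum_PiE_insert'[OF ak] sum_PiE_insert'[OF bk]
  proof (intro sum.cong refl)
    fix f :: "nat \<Rightarrow> nat" and y x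
    let ?f = "f(b k := y, a k := x)"
    have l: "map ?f l = map f l" if "set l \<subseteq> H" for l
      using that ak bk by (intro map_cong) auto
    have F: "F ?f = F f"
      using snoc.prems(1) ak bk unfolding depends_on_def by (metis fun_upd_apply insertCI)
    have "map ?f [a k] = [x]" "map ?f [b k] = [y]" using ak by auto
    then have "word (map ?f ([a k] @ l2 @ [b k])) = E x * word (map f l2) * E y"
      unfolding map_append word_append by (simp only: l[OF snoc.prems(3)] mult.assoc)
    then show "scl (F' ?f) (word (map ?f l1) * (Phi ^^ length T) (word (map ?f ([a k] @ l2 @ [b k]))) * word (map ?f l3))
      = scl (F f * g y x) (word (map f l1) * (Phi ^^ length T) (E x * word (map f l2) * E y) * word (map f l3))"
      using ak unfolding F'_def F l[OF snoc.prems(2)] l[OF snoc.prems(4)] by simp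
  qed
  also have "\<dots> = (\<Sum>f\<in>H \<rightarrow>\<^sub>E {..<m}. scl (F f) (word (map f l1) * (Phi ^^ length T) (Phi (word (map f l2))) * word (map f l3)))"
  proof (intro sum.cong refl)
    fix f :: "nat \<Rightarrow> nat"
    have "Phi X = (\<Sum>y<m. \<Sum>x<m. scl (g y x) (E x * X * E y))" for X
      unfolding Phi_def by (subst sum.swap) (intro sum.cong refl, use g_sym in auto)
    then show "(\<Sum>y<m. \<Sum>x<m. scl (F f * g y x)
      (word (map f l1) * (Phi ^^ length T) (E x * word (map f l2) * E y) * word (map f l3)))
      = scl (F f) (word (map f l1) * (Phi ^^ length T) (Phi (word (map f l2))) * word (map f l3))"
      by (simp add: funpow_Phi_sum funpow_Phi_scl sum_distrib_left sum_distrib_right scl_sum_right)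
  qed
  finally show ?case by (simp add: funpow_swap1)
qed

section \<open>The ladder as a product of transfer operators\<close>

text \<open>Half-edges of the ladder that carry the upper and lower rail to the left of rung \<open>k\<close> (rungs are counted
  from 0, the six half-edges of rung \<open>k\<close> start at \<open>s + 6 k\<close>).\<close>
definition port1 :: "nat \<Rightarrow> nat \<Rightarrow> nat" where
  "port1 s k = (if k = 0 then 1 else s + 6 * (k - 1))"

definition port2 :: "nat \<Rightarrow> nat \<Rightarrow> nat" where
  "port2 s k = (if k = 0 then 2 else s + 6 * (k - 1) + 3)"

text \<open>Each rung takes along the two rail edges on its left; its right half-edges stay open for
  the next rung or for the final legs.\<close>

definition rung_weight :: "nat \<Rightarrow> nat \<Rightarrow> (nat \<Rightarrow> nat) \<Rightarrow> complex" where
  "rung_weight s k f = t (f (s + 6*k)) (f (s + 6*k + 1)) (f (s + 6*k + 2)) *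
     t (f (s + 6*k + 3)) (f (s + 6*k + 4)) (f (s + 6*k + 5)) * g (f (s + 6*k + 4)) (f (s + 6*k + 2)) *
     g (f (s + 6*k + 1)) (f (port1 s k)) * g (f (s + 6*k + 5)) (f (port2 s k))"

definition rung_tensor :: "nat \<Rightarrow> nat \<Rightarrow> nat \<Rightarrow> nat \<Rightarrow> complex" where
  "rung_tensor x y p q = (\<Sum>z1<m. \<Sum>z2<m. \<Sum>z4<m. \<Sum>z5<m.
     t x z1 z2 * t y z4 z5 * g z4 z2 * g z1 p * g z5 q)"

text \<open>The transfer operator of one rung: it turns the value of everything to the left, as a
  function of the two rail labels, into the value including the rung.\<close>

definition rho :: "(nat \<Rightarrow> nat \<Rightarrow> fa) \<Rightarrow> nat \<Rightarrow> nat \<Rightarrow> fa" where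
  "rho V x y = (\<Sum>p<m. \<Sum>q<m. scl (rung_tensor x y p q) (V p q))"

text \<open>The labels \<open>z0\<close> and \<open>z3\<close> of the right half-edges stand
  outermost because they become the open ends after the rung is summed out.\<close>

lemma sum_six:
  fixes s :: nat
  shows "(\<Sum>f\<in>{s..<s+6} \<rightarrow>\<^sub>E {..<m}. F (f s) (f (s+1)) (f (s+2)) (f (s+3)) (f (s+4)) (f (s+5)))
   = (\<Sum>z0<m. \<Sum>z3<m. \<Sum>z1<m. \<Sum>z2<m. \<Sum>z4<m. \<Sum>z5<m. F z0 z1 z2 z3 z4 z5)"
proof -
  have "{s..<s+6} = insert s (insert (s+3) (insert (s+1) (insert (s+2) (insert (s+4) (insert (s+5) {})))))" by auto
  then show ?thesis by (simp add: sum_PiE_insert)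
qed

text \<open>The induction removes the rightmost rung and hides its weight in the boundary weight,
  which is why \<open>B\<close> is arbitrary. The bound on \<open>s\<close> keeps the ladder apart
  from the four core half-edges on the loop.\<close>

lemma ladder_sum:
  assumes s: "4 \<le> s"
  shows "(\<Sum>f\<in>({1,2} \<union> {s..<s+6*n}) \<rightarrow>\<^sub>E {..<m}.
      scl ((\<Prod>k<n. rung_weight s k f) * B (f (port1 s n)) (f (port2 s n))) (Z (f 1) (f 2)))
    = (\<Sum>x<m. \<Sum>y<m. scl (B x y) ((rho ^^ n) Z x y))"
proof (induction n arbitrary: B)
  case 0
  show ?case by (simp add: port1_def port2_def sum_PiE_insert)
next
  case (Suc n)
  let ?H = "{1,2} \<union> {s..<s+6*n}" and ?s = "s + 6*n"
  let ?w = "\<lambda>x y z0 z1 z2 z3 z4 z5. t z0 z1 z2 * t z3 z4 z5 * g z4 z2 * g z1 x * g z5 y * B z0 z3"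
  define B' where "B' x y = (\<Sum>h\<in>{?s..<?s+6} \<rightarrow>\<^sub>E {..<m}.
    ?w x y (h ?s) (h (?s+1)) (h (?s+2)) (h (?s+3)) (h (?s+4)) (h (?s+5)))" for x y
  have un: "{1,2} \<union> {s..<s+6*Suc n} = ?H \<union> {?s..<?s+6}" by auto
  have disj: "?H \<inter> {?s..<?s+6} = {}" using s by auto
  have ports: "port1 s n \<in> ?H" "port2 s n \<in> ?H" by (auto simp: port1_def port2_def)
  have "(\<Sum>f\<in>({1,2} \<union> {s..<s+6*Suc n}) \<rightarrow>\<^sub>E {..<m}.
      scl ((\<Prod>k<Suc n. rung_weight s k f) * B (f (port1 s (Suc n))) (f (port2 s (Suc n)))) (Z (f 1) (f 2)))
    = (\<Sum>f\<in>?H \<rightarrow>\<^sub>E {..<m}. \<Sum>h\<in>{?s..<?s+6} \<rightarrow>\<^sub>E {..<m}.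
      scl ((\<Prod>k<n. rung_weight s k f) *
        ?w (f (port1 s n)) (f (port2 s n)) (h ?s) (h (?s+1)) (h (?s+2)) (h (?s+3)) (h (?s+4)) (h (?s+5))) (Z (f 1) (f 2)))"
    unfolding un sum_PiE_Un[OF disj]
  proof (intro sum.cong refl)
    fix f h :: "nat \<Rightarrow> nat"
    let ?f = "\<lambda>x. if x \<in> ?H then f x else h x"
    have "rung_weight s k ?f = rung_weight s k f" if "k < n" for k
      using that by (auto simp: rung_weight_def port1_def port2_def)
    then have 1: "(\<Prod>k<n. rung_weight s k ?f) = (\<Prod>k<n. rung_weight s k f)" by simp
    have "\<not> ?s + r \<in> ?H" for r using s by auto
    then have new: "?f (?s + r) = h (?s + r)" for r by (simp only: if_False)
    have p: "port1 s (Suc n) = ?s" "port2 s (Suc n) = ?s + 3" by (auto simp: port1_def port2_def)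
    have old: "?f (port1 s n) = f (port1 s n)" "?f (port2 s n) = f (port2 s n)" "?f 1 = f 1" "?f 2 = f 2"
      using ports by auto
    have 2: "rung_weight s n ?f * B (?f (port1 s (Suc n))) (?f (port2 s (Suc n)))
      = ?w (f (port1 s n)) (f (port2 s n)) (h ?s) (h (?s+1)) (h (?s+2)) (h (?s+3)) (h (?s+4)) (h (?s+5))"
      unfolding rung_weight_def p old new new[of 0, unfolded add_0_right] ..
    have "(\<Prod>k<Suc n. rung_weight s k ?f) * B (?f (port1 s (Suc n))) (?f (port2 s (Suc n)))
       = (\<Prod>k<n. rung_weight s k f) * (rung_weight s n ?f * B (?f (port1 s (Suc n))) (?f (port2 s (Suc n))))"
      unfolding prod.lessThan_Suc 1 by (simp only: mult.assoc)
    then show "scl ((\<Prod>k<Suc n. rung_weight s k ?f) * B (?f (port1 s (Suc n))) (?f (port2 s (Suc n)))) (Z (?f 1) (?f 2))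
      = scl ((\<Prod>k<n. rung_weight s k f) *
        ?w (f (port1 s n)) (f (port2 s n)) (h ?s) (h (?s+1)) (h (?s+2)) (h (?s+3)) (h (?s+4)) (h (?s+5))) (Z (f 1) (f 2))"
      unfolding 2 old by (simp only:)
  qed
  also have "\<dots> = (\<Sum>f\<in>?H \<rightarrow>\<^sub>E {..<m}.
      scl ((\<Prod>k<n. rung_weight s k f) * B' (f (port1 s n)) (f (port2 s n))) (Z (f 1) (f 2)))"
    unfolding B'_def sum_distrib_left scl_sum_left ..
  also have "\<dots> = (\<Sum>x<m. \<Sum>y<m. scl (B' x y) ((rho ^^ n) Z x y))" by (rule Suc.IH)
  also have "\<dots> = (\<Sum>x<m. \<Sum>y<m. \<Sum>z0<m. \<Sum>z3<m. scl (B z0 z3 * rung_tensor z0 z3 x y) ((rho ^^ n) Z x y))"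
  proof (intro sum.cong refl)
    fix x y
    have "B' x y = (\<Sum>z0<m. \<Sum>z3<m. \<Sum>z1<m. \<Sum>z2<m. \<Sum>z4<m. \<Sum>z5<m. ?w x y z0 z1 z2 z3 z4 z5)"
      unfolding B'_def by (rule sum_six)
    also have "\<dots> = (\<Sum>z0<m. \<Sum>z3<m. B z0 z3 * rung_tensor z0 z3 x y)"
      unfolding rung_tensor_def sum_distrib_left by (intro sum.cong refl) (simp only: mult_ac)
    finally show "scl (B' x y) ((rho ^^ n) Z x y)
        = (\<Sum>z0<m. \<Sum>z3<m. scl (B z0 z3 * rung_tensor z0 z3 x y) ((rho ^^ n) Z x y))"
      by (simp only: scl_sum_left)
  qed
  also have "\<dots> = (\<Sum>z0<m. \<Sum>z3<m. \<Sum>x<m. \<Sum>y<m. scl (B z0 z3 * rung_tensor z0 z3 x y) ((rho ^^ n) Z x y))"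
  proof -
    have "(\<Sum>x<m. \<Sum>y<m. \<Sum>z0<m. \<Sum>z3<m. R x y z0 z3) = (\<Sum>z0<m. \<Sum>z3<m. \<Sum>x<m. \<Sum>y<m. R x y z0 z3)"
      for R :: "nat \<Rightarrow> nat \<Rightarrow> nat \<Rightarrow> nat \<Rightarrow> fa"
    proof -
      have "(\<Sum>x<m. \<Sum>y<m. \<Sum>z0<m. \<Sum>z3<m. R x y z0 z3) = (\<Sum>x<m. \<Sum>z0<m. \<Sum>y<m. \<Sum>z3<m. R x y z0 z3)"
        by (intro sum.cong refl sum.swap)
      also have "\<dots> = (\<Sum>z0<m. \<Sum>x<m. \<Sum>y<m. \<Sum>z3<m. R x y z0 z3)" by (rule sum.swap)
      also have "\<dots> = (\<Sum>z0<m. \<Sum>x<m. \<Sum>z3<m. \<Sum>y<m. R x y z0 z3)" by (intro sum.cong refl sum.swap)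
      also have "\<dots> = (\<Sum>z0<m. \<Sum>z3<m. \<Sum>x<m. \<Sum>y<m. R x y z0 z3)" by (intro sum.cong refl sum.swap)
      finally show ?thesis .
    qed
    then show ?thesis .
  qed
  also have "\<dots> = (\<Sum>x<m. \<Sum>y<m. scl (B x y) ((rho ^^ Suc n) Z x y))"
    by (simp add: rho_def scl_sum_right)
  finally show ?case .
qed

text \<open>The last two factors close the right ends at p1 and p4. For \<open>i = 0\<close> the
  ports are p2 and p3, and these factors are the two core chords.\<close>

definition ladder_weight :: "nat \<Rightarrow> nat \<Rightarrow> (nat \<Rightarrow> nat) \<Rightarrow> complex" where
  "ladder_weight s i f = (\<Prod>k<i. rung_weight s k f) * (g (f 0) (f (port1 s i)) * g (f 3) (f (port2 s i)))"

definition nest :: "nat \<Rightarrow> nat \<Rightarrow> nat \<Rightarrow> fa" where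
  "nest n x y = (Phi ^^ n) (E x * E y)"

text \<open>The value of the ladder with \<open>i\<close> rungs crossed by \<open>n\<close> parallel chords.\<close>
definition ladder_val :: "nat \<Rightarrow> nat \<Rightarrow> fa" where
  "ladder_val i n = (\<Sum>p<m. \<Sum>q<m. \<Sum>x<m. \<Sum>y<m. scl (g p x * g q y) (E p * (rho ^^ i) (nest n) x y * E q))"

lemma rho_sandwich: "(rho ^^ i) (\<lambda>x y. A * V x y * B) = (\<lambda>x y. A * (rho ^^ i) V x y * B)"
  by (induction i) (auto simp: rho_def sum_distrib_left sum_distrib_right fun_eq_iff)

lemma ladder_core_sum:
  assumes s: "4 \<le> s"
  shows "(\<Sum>f\<in>({0,1,2,3} \<union> {s..<s+6*i}) \<rightarrow>\<^sub>E {..<m}.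
      scl (ladder_weight s i f) (E (f 0) * (Phi ^^ n) (E (f 1) * E (f 2)) * E (f 3))) = ladder_val i n"
proof -
  let ?H = "{1,2} \<union> {s..<s+6*i}"
  have H: "{0,1,2,3} \<union> {s..<s+6*i} = insert 0 (insert 3 ?H)" by auto
  have n03: "0 \<notin> insert 3 ?H" "3 \<notin> ?H" using s by auto
  have "(\<Sum>f\<in>({0,1,2,3} \<union> {s..<s+6*i}) \<rightarrow>\<^sub>E {..<m}.
      scl (ladder_weight s i f) (E (f 0) * (Phi ^^ n) (E (f 1) * E (f 2)) * E (f 3)))
    = (\<Sum>p<m. \<Sum>q<m. \<Sum>f\<in>?H \<rightarrow>\<^sub>E {..<m}.
      scl ((\<Prod>k<i. rung_weight s k f) * (g p (f (port1 s i)) * g q (f (port2 s i)))) (E p * nest n (f 1) (f 2) * E q))"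
    unfolding H sum_PiE_insert[OF n03(1)] sum_PiE_insert[OF n03(2)]
  proof (intro sum.cong refl)
    fix f :: "nat \<Rightarrow> nat" and p q
    let ?f = "f(3 := q, 0 := p)"
    have f: "?f x = f x" if "x \<noteq> 0" "x \<noteq> 3" for x using that by simp
    have pn: "port1 s k \<noteq> 0" "port1 s k \<noteq> 3" "port2 s k \<noteq> 0" "port2 s k \<noteq> 3" for k
      using s by (auto simp: port1_def port2_def)
    have "rung_weight s k ?f = rung_weight s k f" for k
      unfolding rung_weight_def f[OF pn(1,2)] f[OF pn(3,4)] using s by simp
    then have "ladder_weight s i ?f = (\<Prod>k<i. rung_weight s k f) * (g p (f (port1 s i)) * g q (f (port2 s i)))"
      unfolding ladder_weight_def f[OF pn(1,2)] f[OF pn(3,4)] by simp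
    then show "scl (ladder_weight s i ?f) (E (?f 0) * (Phi ^^ n) (E (?f 1) * E (?f 2)) * E (?f 3))
      = scl ((\<Prod>k<i. rung_weight s k f) * (g p (f (port1 s i)) * g q (f (port2 s i)))) (E p * nest n (f 1) (f 2) * E q)"
      by (simp add: nest_def)
  qed
  also have "\<dots> = ladder_val i n"
    unfolding ladder_val_def
  proof (intro sum.cong refl)
    fix p q
    show "(\<Sum>f\<in>?H \<rightarrow>\<^sub>E {..<m}. scl ((\<Prod>k<i. rung_weight s k f) * (g p (f (port1 s i)) * g q (f (port2 s i))))
        (E p * nest n (f 1) (f 2) * E q))
      = (\<Sum>x<m. \<Sum>y<m. scl (g p x * g q y) (E p * (rho ^^ i) (nest n) x y * E q))"
      using ladder_sum[OF s, of i "\<lambda>x y. g p x * g q y" "\<lambda>x y. E p * nest n x y * E q"]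
      unfolding rho_sandwich .
  qed
  finally show ?thesis .
qed

text \<open>STU at both ends of the rung: raising the rail indices by \<open>trip_g\<close> turns
  each vertex into a bracket with one half of a dual pair \<open>d\<close>,
  \<open>u\<close>.\<close>

lemma rung_tensor_eq:
  assumes "x < m" "y < m" "p < m" "q < m"
  shows "rung_tensor x y p q = (\<Sum>d<m. \<Sum>u<m. g u d * (c d x p * c y u q))"
proof -
  have "rung_tensor x y p q = (\<Sum>z2<m. \<Sum>z1<m. \<Sum>z4<m. \<Sum>z5<m. t x z1 z2 * t y z4 z5 * g z4 z2 * g z1 p * g z5 q)"
    unfolding rung_tensor_def by (rule sum.swap)
  also have "\<dots> = (\<Sum>z2<m. \<Sum>z4<m. \<Sum>z1<m. \<Sum>z5<m. t x z1 z2 * t y z4 z5 * g z4 z2 * g z1 p * g z5 q)"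
    by (intro sum.cong refl sum.swap)
  also have "\<dots> = (\<Sum>d<m. \<Sum>u<m. g u d * (c d x p * c y u q))"
  proof (intro sum.cong refl)
    fix d u assume du: "d \<in> {..<m}" "u \<in> {..<m}"
    have "(\<Sum>z1<m. \<Sum>z5<m. t x z1 d * t y u z5 * g u d * g z1 p * g z5 q)
      = (\<Sum>z1<m. \<Sum>z5<m. g u d * ((t d x z1 * g z1 p) * (t y u z5 * g z5 q)))"
      by (intro sum.cong refl) (use du assms trip_cyclic in auto)
    also have "\<dots> = g u d * ((\<Sum>z1<m. t d x z1 * g z1 p) * (\<Sum>z5<m. t y u z5 * g z5 q))"
      unfolding sum_product by (simp only: sum_distrib_left)
    finally show "(\<Sum>z1<m. \<Sum>z5<m. t x z1 d * t y u z5 * g u d * g z1 p * g z5 q) = g u d * (c d x p * c y u q)"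
      using du assms by (simp add: trip_g)
  qed
  finally show ?thesis .
qed

text \<open>The rung acts only on the labels inside all chords, so by linearity the relation for one
  rung is applied under \<open>Phi ^^ n\<close>. Its new chord extends the nest, and
  \<open>Cas\<close> passes outwards through \<open>Phi ^^ n\<close>.\<close>

lemma rho_nest:
  assumes "x < m" "y < m"
  shows "rho (nest n) x y \<approx> nest (Suc n) x y + scl (1 / lam) (nest n x y) - Cas * nest n x y"
proof -
  have "rho (nest n) x y = (\<Sum>p<m. \<Sum>q<m. \<Sum>d<m. \<Sum>u<m. scl (g u d * (c d x p * c y u q)) (nest n p q))"
    unfolding rho_def using assms by (intro sum.cong refl) (simp add: rung_tensor_eq scl_sum_left)
  also have "\<dots> = (\<Sum>p<m. \<Sum>d<m. \<Sum>q<m. \<Sum>u<m. scl (g u d * (c d x p * c y u q)) (nest n p q))"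
    by (intro sum.cong refl sum.swap)
  also have "\<dots> = (\<Sum>d<m. \<Sum>p<m. \<Sum>q<m. \<Sum>u<m. scl (g u d * (c d x p * c y u q)) (nest n p q))"
    by (rule sum.swap)
  also have "\<dots> = (\<Sum>d<m. \<Sum>p<m. \<Sum>u<m. \<Sum>q<m. scl (g u d * (c d x p * c y u q)) (nest n p q))"
    by (intro sum.cong refl sum.swap)
  also have "\<dots> = (\<Sum>d<m. \<Sum>u<m. \<Sum>p<m. \<Sum>q<m. scl (g u d * (c d x p * c y u q)) (nest n p q))"
    by (intro sum.cong refl sum.swap)
  also have "\<dots> = (Phi ^^ n) (\<Sum>d<m. \<Sum>u<m. scl (g u d) (lie_elem d x * lie_elem y u))"
    by (simp add: lie_elem_def nest_def sum_product funpow_Phi_sum funpow_Phi_scl scl_sum_right mult.commute)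
  also have "\<dots> \<approx> (Phi ^^ n) (Phi (E x * E y) + scl (1 / lam) (E x * E y) - Cas * (E x * E y))"
    by (intro funpow_Phi_cong rung_relation assms)
  also have "\<dots> = nest (Suc n) x y + scl (1 / lam) (nest n x y) + scl (-1) ((Phi ^^ n) (Cas * (E x * E y)))"
  proof -
    have "Phi (E x * E y) + scl (1 / lam) (E x * E y) - Cas * (E x * E y)
      = Phi (E x * E y) + scl (1 / lam) (E x * E y) + scl (-1) (Cas * (E x * E y))"
      by (simp add: scl_minus_left)
    then show ?thesis by (simp only: funpow_Phi_add funpow_Phi_scl nest_def funpow_swap1 funpow.simps o_apply)
  qed
  also have "\<dots> \<approx> nest (Suc n) x y + scl (1 / lam) (nest n x y) + scl (-1) (Cas * nest n x y)"
    unfolding nest_def by (intro ucong_add ucong_scl ucong_refl funpow_Phi_Cas)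
  finally show ?thesis by (simp add: scl_minus_left)
qed

lemma rho_cong: "(\<And>x y. x < m \<Longrightarrow> y < m \<Longrightarrow> V x y \<approx> V' x y) \<Longrightarrow> rho V x y \<approx> rho V' x y"
  unfolding rho_def by (intro ucong_sum ucong_scl) auto

lemma funpow_rho_cong:
  assumes "\<And>x y. x < m \<Longrightarrow> y < m \<Longrightarrow> V x y \<approx> V' x y" "x < m" "y < m"
  shows "(rho ^^ i) V x y \<approx> (rho ^^ i) V' x y"
  using assms(2,3) by (induction i arbitrary: x y) (auto intro: assms(1) rho_cong)

lemma funpow_rho_linear:
  "(rho ^^ i) (\<lambda>x y. V x y + scl r (V' x y) - A * V'' x y)
    = (\<lambda>x y. (rho ^^ i) V x y + scl r ((rho ^^ i) V' x y) - A * (rho ^^ i) V'' x y)"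
proof (induction i)
  case (Suc i)
  show ?case unfolding funpow.simps o_apply Suc
    by (simp add: rho_def fun_eq_iff scl_add_right scl_diff_right sum.distrib sum_subtractf scl_sum_right
        sum_distrib_left mult.commute)
qed simp

lemma ladder_val_recursion: "ladder_val (Suc i) n \<approx> ladder_val i (Suc n) + scl (1 / lam) (ladder_val i n) - Cas * ladder_val i n"
proof -
  have "ladder_val (Suc i) n = (\<Sum>p<m. \<Sum>q<m. \<Sum>x<m. \<Sum>y<m. scl (g p x * g q y) (E p * (rho ^^ i) (rho (nest n)) x y * E q))"
    by (simp add: ladder_val_def funpow_swap1)
  also have "\<dots> \<approx> (\<Sum>p<m. \<Sum>q<m. \<Sum>x<m. \<Sum>y<m. scl (g p x * g q y)
      (E p * (rho ^^ i) (\<lambda>x y. nest (Suc n) x y + scl (1 / lam) (nest n x y) - Cas * nest n x y) x y * E q))"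
    by (intro ucong_sum ucong_scl ucong_mult ucong_refl funpow_rho_cong rho_nest) auto
  also have "\<dots> = ladder_val i (Suc n) + scl (1 / lam) (ladder_val i n)
      - (\<Sum>p<m. \<Sum>q<m. \<Sum>x<m. \<Sum>y<m. scl (g p x * g q y) (E p * Cas * ((rho ^^ i) (nest n) x y * E q)))"
    unfolding funpow_rho_linear
    by (simp add: ladder_val_def distrib_left distrib_right right_diff_distrib left_diff_distrib scl_add_right scl_diff_right
        sum.distrib sum_subtractf scl_sum_right mult.assoc mult.left_commute[of "1 / lam"])
  \<comment> \<open>The Casimir element still stands behind \<open>E p\<close>; centrality brings it
    to the front of the whole value.\<close>
  also have "\<dots> \<approx> ladder_val i (Suc n) + scl (1 / lam) (ladder_val i n)
      - (\<Sum>p<m. \<Sum>q<m. \<Sum>x<m. \<Sum>y<m. scl (g p x * g q y) (Cas * E p * ((rho ^^ i) (nest n) x y * E q)))"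
    by (intro ucong_diff ucong_sum ucong_scl ucong_mult ucong_refl Cas_commute_gen) auto
  also have "\<dots> = ladder_val i (Suc n) + scl (1 / lam) (ladder_val i n) - Cas * ladder_val i n"
    by (simp add: ladder_val_def sum_distrib_left mult.assoc)
  finally show ?thesis .
qed

lemma comm_Cas_ladder_val: "comm_Cas (ladder_val i n)"
proof -
  have "comm_Cas ((Phi ^^ n) Y)" if "comm_Cas Y" for Y
    by (induction n) (auto intro: that comm_Cas_Phi)
  then have "comm_Cas (nest n x y)" if "x < m" "y < m" for x y
    using that unfolding nest_def by (blast intro: comm_Cas_mult comm_Cas_gen)
  then have "comm_Cas ((rho ^^ i) (nest n) x y)" if "x < m" "y < m" for x y
    using that by (induction i arbitrary: x y) (auto simp: rho_def intro!: comm_Cas_sum comm_Cas_scl)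
  then show ?thesis
    unfolding ladder_val_def by (intro comm_Cas_sum comm_Cas_scl comm_Cas_mult comm_Cas_gen) auto
qed

section \<open>Chords alone, and a single core chord crossed by parallel chords\<close>

lemma funpow_Phi_one: "(Phi ^^ n) 1 \<approx> Cas ^ n"
proof (induction n)
  case (Suc n)
  have "(Phi ^^ Suc n) 1 = (Phi ^^ n) (Cas * 1)" by (simp add: funpow_swap1 Cas_def)
  also have "\<dots> \<approx> Cas * (Phi ^^ n) 1" by (rule funpow_Phi_Cas)
  also have "\<dots> \<approx> Cas * Cas ^ n" by (intro ucong_mult ucong_refl Suc)
  finally show ?case by simp
qed simp

text \<open>The factor by which a chord acts when it encloses a single letter, as given by
  \<open>Phi_gen\<close>.\<close>

definition Cas_shift :: fa where "Cas_shift = Cas - scl (1 / (2 * lam)) 1"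

lemma Phi_Cas_shift: "Phi (Cas_shift * Y) \<approx> Cas_shift * Phi Y"
proof -
  have "Phi (Cas_shift * Y) = Phi (Cas * Y) + Phi (scl (- (1 / (2 * lam))) Y)"
    unfolding Phi_add[symmetric] by (simp add: Cas_shift_def left_diff_distrib scl_minus_left)
  also have "\<dots> \<approx> Cas * Phi Y + Phi (scl (- (1 / (2 * lam))) Y)" by (intro ucong_add ucong_refl Phi_Cas)
  also have "\<dots> = Cas_shift * Phi Y" unfolding Phi_scl by (simp add: Cas_shift_def left_diff_distrib scl_minus_left)
  finally show ?thesis .
qed

lemma funpow_Phi_gen:
  assumes "x < m"
  shows "(Phi ^^ n) (E x) \<approx> Cas_shift ^ n * E x"
proof (induction n)
  case (Suc n)
  have pow: "Phi (Cas_shift ^ k * Y) \<approx> Cas_shift ^ k * Phi Y" for k Y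
  proof (induction k)
    case (Suc k)
    have "Phi (Cas_shift ^ Suc k * Y) = Phi (Cas_shift * (Cas_shift ^ k * Y))" by (simp add: mult.assoc)
    also have "\<dots> \<approx> Cas_shift * Phi (Cas_shift ^ k * Y)" by (rule Phi_Cas_shift)
    also have "\<dots> \<approx> Cas_shift * (Cas_shift ^ k * Phi Y)" by (intro ucong_mult ucong_refl Suc)
    finally show ?case by (simp add: mult.assoc)
  qed simp
  have "(Phi ^^ Suc n) (E x) = Phi ((Phi ^^ n) (E x))" by simp
  also have "\<dots> \<approx> Phi (Cas_shift ^ n * E x)" by (intro Phi_cong Suc)
  also have "\<dots> \<approx> Cas_shift ^ n * Phi (E x)" by (rule pow)
  also have "\<dots> \<approx> Cas_shift ^ n * (Cas * E x - scl (1 / (2 * lam)) (E x))"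
    by (intro ucong_mult ucong_refl Phi_gen assms)
  also have "\<dots> = Cas_shift ^ Suc n * E x"
    by (simp only: power_Suc2 Cas_shift_def left_diff_distrib mult.assoc scl_mult_left mult_1_left)
  finally show ?case .
qed simp

text \<open>The core chord p3p4 without its partner: one endpoint lies inside all \<open>n\<close>
  chords, the other outside, so each crossing contributes \<open>Cas_shift\<close> and the chord
  itself contributes \<open>Cas\<close>.\<close>

lemma one_sided_right: "(\<Sum>x<m. \<Sum>y<m. scl (g y x) ((Phi ^^ n) (E x) * E y)) \<approx> Cas_shift ^ n * Cas"
proof -
  have "(\<Sum>x<m. \<Sum>y<m. scl (g y x) ((Phi ^^ n) (E x) * E y)) \<approx> (\<Sum>x<m. \<Sum>y<m. scl (g y x) ((Cas_shift ^ n * E x) * E y))"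
    by (intro ucong_sum ucong_scl ucong_mult ucong_refl funpow_Phi_gen) auto
  also have "\<dots> = (\<Sum>x<m. \<Sum>y<m. scl (g x y) ((Cas_shift ^ n * E x) * E y))"
    by (intro sum.cong refl) (use g_sym in auto)
  also have "\<dots> = Cas_shift ^ n * Cas"
    by (simp add: Cas_def Phi_def sum_distrib_left mult.assoc)
  finally show ?thesis .
qed

lemma one_sided_left: "(\<Sum>x<m. \<Sum>y<m. scl (g y x) (E x * (Phi ^^ n) (E y))) \<approx> Cas_shift ^ n * Cas"
proof -
  have Cas_shift1: "E a * Cas_shift \<approx> Cas_shift * E a" if "a < m" for a
    using ucong_diff[OF Cas_commute_gen[OF that] ucong_refl[of m c "scl (1 / (2 * lam)) (E a)"]]
    by (simp add: Cas_shift_def left_diff_distrib right_diff_distrib)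
  have Cas_shiftn: "E a * Cas_shift ^ n \<approx> Cas_shift ^ n * E a" if "a < m" for a n
  proof (induction n)
    case (Suc n)
    have "E a * Cas_shift ^ Suc n = (E a * Cas_shift) * Cas_shift ^ n" by (simp add: mult.assoc)
    also have "\<dots> \<approx> (Cas_shift * E a) * Cas_shift ^ n" by (intro ucong_mult ucong_refl Cas_shift1 that)
    also have "\<dots> = Cas_shift * (E a * Cas_shift ^ n)" by (simp add: mult.assoc)
    also have "\<dots> \<approx> Cas_shift * (Cas_shift ^ n * E a)" by (intro ucong_mult ucong_refl Suc)
    finally show ?case by (simp add: mult.assoc)
  qed simp
  have "(\<Sum>x<m. \<Sum>y<m. scl (g y x) (E x * (Phi ^^ n) (E y))) \<approx> (\<Sum>x<m. \<Sum>y<m. scl (g y x) (E x * (Cas_shift ^ n * E y)))"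
    by (intro ucong_sum ucong_scl ucong_mult ucong_refl funpow_Phi_gen) auto
  also have "\<dots> = (\<Sum>x<m. \<Sum>y<m. scl (g x y) ((E x * Cas_shift ^ n) * E y))"
    by (intro sum.cong refl) (use g_sym in \<open>auto simp: mult.assoc\<close>)
  also have "\<dots> \<approx> (\<Sum>x<m. \<Sum>y<m. scl (g x y) ((Cas_shift ^ n * E x) * E y))"
    by (intro ucong_sum ucong_scl ucong_mult ucong_refl Cas_shiftn) auto
  also have "\<dots> = Cas_shift ^ n * Cas"
    by (simp add: Cas_def Phi_def sum_distrib_left mult.assoc)
  finally show ?thesis .
qed

end

section \<open>Sums over splittings\<close>

lemma partition_on_block_unique: "partition_on A P \<Longrightarrow> B \<in> P \<Longrightarrow> x \<in> B \<Longrightarrow> \<Union>{C \<in> P. x \<in> C} = B"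
  by (auto simp: partition_on_def disjoint_def)

text \<open>Admitting \<open>B = {}\<close> lets one formula cover both joining an existing part and
  forming a new singleton.\<close>

lemma partition_on_extend:
  assumes P: "partition_on A P" and x: "x \<notin> A" and B: "B \<in> insert {} P"
  shows "partition_on (insert x A) (insert (insert x B) (P - {B}))"
proof (rule partition_onI)
  have "{} \<notin> P" "\<Union>P = A" "B \<subseteq> A" using P B by (auto simp: partition_on_def)
  then show "\<Union>(insert (insert x B) (P - {B})) = insert x A" by blast
  show "{} \<notin> insert (insert x B) (P - {B})" using \<open>{} \<notin> P\<close> by auto
  fix C D assume CD: "C \<in> insert (insert x B) (P - {B})" "D \<in> insert (insert x B) (P - {B})" "C \<noteq> D"
  have dis: "C \<inter> D = {}" if "C \<in> P" "D \<in> P" "C \<noteq> D" for C D using P that by (auto simp: partition_on_def disjoint_def)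
  have "x \<notin> C" if "C \<in> P" for C using P x that by (auto simp: partition_on_def)
  moreover have "C \<inter> B = {}" if "C \<in> P - {B}" for C using that B dis by auto
  ultimately have new: "disjnt (insert x B) D" if "D \<in> P - {B}" for D
    using that unfolding disjnt_def by blast
  from CD consider "C = insert x B" "D \<in> P - {B}" | "D = insert x B" "C \<in> P - {B}" | "C \<in> P - {B}" "D \<in> P - {B}"
    by blast
  then show "disjnt C D"
  proof cases
    case 3
    then show ?thesis using dis CD(3) unfolding disjnt_def by blast
  qed (use new disjnt_sym in blast)+
qed

lemma partition_on_delete:
  assumes P: "partition_on (insert x A) P" and x: "x \<notin> A" and C: "C \<in> P" "x \<in> C"
  shows "partition_on A ((P - {C}) \<union> ({C - {x}} - {{}}))"
proof (rule partition_onI)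
  have dis: "D \<inter> D' = {}" if "D \<in> P" "D' \<in> P" "D \<noteq> D'" for D D' using P that by (auto simp: partition_on_def disjoint_def)
  have U: "\<Union>P = insert x A" using P by (auto simp: partition_on_def)
  have xD: "x \<notin> D" if "D \<in> P" "D \<noteq> C" for D using dis[OF that(1) C(1) that(2)] C by blast
  show "\<Union>((P - {C}) \<union> ({C - {x}} - {{}})) = A"
  proof (intro equalityI subsetI)
    fix y assume "y \<in> \<Union>((P - {C}) \<union> ({C - {x}} - {{}}))"
    then obtain D where "D \<in> P" "y \<in> D" "y \<noteq> x" using xD C by auto
    then show "y \<in> A" using U by blast
  next
    fix y assume y: "y \<in> A"
    then obtain D where D: "D \<in> P" "y \<in> D" using U by blast
    have "y \<noteq> x" using y x by auto
    then show "y \<in> \<Union>((P - {C}) \<union> ({C - {x}} - {{}}))" using D by (cases "D = C") auto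
  qed
  show "{} \<notin> (P - {C}) \<union> ({C - {x}} - {{}})" using P by (auto simp: partition_on_def)
  fix D D' assume DD: "D \<in> (P - {C}) \<union> ({C - {x}} - {{}})" "D' \<in> (P - {C}) \<union> ({C - {x}} - {{}})" "D \<noteq> D'"
  have new: "disjnt (C - {x}) D" if "D \<in> P - {C}" for D using dis[of D C] that C unfolding disjnt_def by blast
  from DD consider "D = C - {x}" "D' \<in> P - {C}" | "D' = C - {x}" "D \<in> P - {C}" | "D \<in> P - {C}" "D' \<in> P - {C}"
    by blast
  then show "disjnt D D'"
  proof cases
    case 3
    then show ?thesis using dis DD(3) unfolding disjnt_def by blast
  qed (use new disjnt_sym in blast)+
qed

lemma finite_partitions: "finite A \<Longrightarrow> finite {P. partition_on A P}"
  by (rule finite_subset[of _ "Pow (Pow A)"]) (auto simp: partition_on_def)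

text \<open>Deleting \<open>x\<close> maps the partitions of the larger set bijectively to pairs of
  a partition of \<open>A\<close> and a part that \<open>x\<close> joins, or the empty set if
  \<open>x\<close> stands alone.\<close>

lemma sum_partitions_insert:
  fixes F :: "'a set set \<Rightarrow> 'b::comm_monoid_add"
  assumes A: "finite A" and x: "x \<notin> A"
  shows "(\<Sum>P | partition_on (insert x A) P. F P)
    = (\<Sum>P | partition_on A P. F (insert {x} P) + (\<Sum>B\<in>P. F (insert (insert x B) (P - {B}))))"
proof -
  define bl where "bl P = \<Union>{C \<in> P. x \<in> C}" for P :: "'a set set"
  \<comment> \<open>The inverse map remembers what remains of the part of \<open>x\<close>; an empty
    remainder must not be kept as a part.\<close>
  define del where "del P = ((P - {bl P}) \<union> ({bl P - {x}} - {{}}), bl P - {x})" for P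
  have "(\<Sum>P | partition_on (insert x A) P. F P)
    = (\<Sum>(P,B)\<in>Sigma {P. partition_on A P} (insert {}). F (insert (insert x B) (P - {B})))"
  proof (rule sum.reindex_bij_witness[where i = "\<lambda>(P,B). insert (insert x B) (P - {B})" and j = del])
    fix P assume "P \<in> {P. partition_on (insert x A) P}"
    then have P: "partition_on (insert x A) P" by simp
    then obtain C where C: "C \<in> P" "x \<in> C" by (auto simp: partition_on_def)
    have bl: "bl P = C" unfolding bl_def using P C by (rule partition_on_block_unique)
    have dis: "C \<inter> D = {}" if "D \<in> P" "C \<noteq> D" for D using P C that by (auto simp: partition_on_def disjoint_def)
    \<comment> \<open>Otherwise reinserting \<open>x\<close> would also remove another part of
      \<open>P\<close>.\<close>
    have "C - {x} \<notin> P"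
    proof
      assume "C - {x} \<in> P"
      moreover have "C - {x} \<noteq> C" using C by auto
      ultimately have "C \<inter> (C - {x}) = {}" using dis by blast
      then have "C - {x} = {}" by blast
      with \<open>C - {x} \<in> P\<close> have "{} \<in> P" by (simp only:)
      then show False using P by (simp add: partition_on_def)
    qed
    moreover have "insert x (C - {x}) = C" using C by auto
    moreover have "{} \<notin> P" using P by (auto simp: partition_on_def)
    ultimately have eq: "insert (insert x (C - {x})) ((P - {C}) \<union> ({C - {x}} - {{}}) - {C - {x}}) = P"
      using C by auto
    then show "(case del P of (P,B) \<Rightarrow> insert (insert x B) (P - {B})) = P"
      by (simp only: del_def bl prod.case)
    show "del P \<in> Sigma {P. partition_on A P} (insert {})"
      using partition_on_delete[OF P x C] by (auto simp: del_def bl)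
    show "(case del P of (P,B) \<Rightarrow> F (insert (insert x B) (P - {B}))) = F P"
      using eq by (simp only: del_def bl prod.case)
  next
    fix p assume "p \<in> Sigma {P. partition_on A P} (insert {})"
    then obtain P B where p: "p = (P,B)" and P: "partition_on A P" and B: "B \<in> insert {} P" by auto
    have ext: "partition_on (insert x A) (insert (insert x B) (P - {B}))" by (rule partition_on_extend[OF P x B])
    then show "(case p of (P,B) \<Rightarrow> insert (insert x B) (P - {B})) \<in> {P. partition_on (insert x A) P}" by (simp add: p)
    have bl: "bl (insert (insert x B) (P - {B})) = insert x B"
      unfolding bl_def by (rule partition_on_block_unique[OF ext]) auto
    have xP: "x \<notin> C" if "C \<in> P" for C using P x that by (auto simp: partition_on_def)
    then have "x \<notin> B" using B by auto
    then have "insert x B - {x} = B" by auto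
    moreover have "(insert (insert x B) (P - {B}) - {insert x B}) \<union> ({B} - {{}}) = P"
    proof -
      have "insert x B \<notin> P" using xP by blast
      moreover have "{} \<notin> P" using P by (auto simp: partition_on_def)
      ultimately show ?thesis using B by auto
    qed
    ultimately show "del (case p of (P,B) \<Rightarrow> insert (insert x B) (P - {B})) = p"
      by (simp only: p prod.case del_def bl)
  qed
  also have "\<dots> = (\<Sum>P | partition_on A P. \<Sum>B\<in>insert {} P. F (insert (insert x B) (P - {B})))"
  proof (rule sum.Sigma[symmetric])
    show "finite {P. partition_on A P}" using A by (rule finite_partitions)
    show "\<forall>P\<in>{P. partition_on A P}. finite (insert {} P)" using A by (auto intro: finite_elements)
  qed
  also have "\<dots> = (\<Sum>P | partition_on A P. F (insert {x} P) + (\<Sum>B\<in>P. F (insert (insert x B) (P - {B}))))"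
  proof (intro sum.cong refl)
    fix P assume "P \<in> {P. partition_on A P}"
    then have "finite P" "{} \<notin> P" using A by (auto intro: finite_elements simp: partition_on_def)
    then show "(\<Sum>B\<in>insert {} P. F (insert (insert x B) (P - {B})))
        = F (insert {x} P) + (\<Sum>B\<in>P. F (insert (insert x B) (P - {B})))"
      by simp
  qed
  finally show ?thesis .
qed

section \<open>Coefficients of the projection and the effect of one more chord\<close>

text \<open>The coefficient of a splitting into \<open>n\<close> parts in the projection to primitive elements.\<close>
definition pi_coeff :: "nat \<Rightarrow> complex" where
  "pi_coeff n = - ((-1) ^ n * of_nat (fact (n - 1)))"

lemma pi_coeff_Suc: "n \<ge> 1 \<Longrightarrow> pi_coeff (Suc n) = - of_nat n * pi_coeff n"
  by (cases n) (simp_all add: pi_coeff_def algebra_simps)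

definition block :: "'a \<Rightarrow> 'a set set \<Rightarrow> 'a set" where
  "block l P = \<Union>{C \<in> P. l \<in> C}"

lemma block_eq: "partition_on A P \<Longrightarrow> B \<in> P \<Longrightarrow> l \<in> B \<Longrightarrow> block l P = B"
  unfolding block_def by (rule partition_on_block_unique)

lemma block_in:
  assumes "partition_on A P" "l \<in> A"
  shows "block l P \<in> P" "l \<in> block l P"
proof -
  obtain B where "B \<in> P" "l \<in> B" using assms by (auto simp: partition_on_def)
  then show "block l P \<in> P" "l \<in> block l P" using block_eq[OF assms(1)] by auto
qed

lemma block_extend:
  assumes P: "partition_on A P" and x: "x \<notin> A" and l: "l \<in> A" and B: "B \<in> insert {} P"
  shows "block l (insert (insert x B) (P - {B})) = (if l \<in> B then insert x B else block l P)"
proof (cases "l \<in> B")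
  case True
  then show ?thesis by (subst block_eq[OF partition_on_extend[OF P x B], of "insert x B"]) auto
next
  case False
  then have "block l P \<noteq> B" using block_in[OF P l] by auto
  then have "block l P \<in> insert (insert x B) (P - {B})" using block_in[OF P l] by auto
  then show ?thesis using block_eq[OF partition_on_extend[OF P x B]] block_in[OF P l] False by auto
qed

lemma card_extend:
  assumes P: "partition_on A P" and A: "finite A" and x: "x \<notin> A"
  shows "card (insert {x} P) = Suc (card P)" "B \<in> P \<Longrightarrow> card (insert (insert x B) (P - {B})) = card P"
proof -
  have fin: "finite P" using P A by (rule finite_elements[rotated])
  have "x \<notin> C" if "C \<in> P" for C using P x that by (auto simp: partition_on_def)
  then have *: "insert x C \<notin> P" for C by blast
  then show "card (insert {x} P) = Suc (card P)" using fin by simp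
  show "card (insert (insert x B) (P - {B})) = card P" if "B \<in> P"
  proof -
    have "insert x B \<notin> P - {B}" using * by blast
    then have "card (insert (insert x B) (P - {B})) = Suc (card (P - {B}))" using fin by simp
    then show ?thesis using card_Suc_Diff1[OF fin that] by simp
  qed
qed

context simple_lie_form
begin

text \<open>Iterates the operator "shift minus multiplication by \<open>Cas\<close>" and evaluates
  at 0; unfolded, it is the binomial sum of \<open>(- Cas) ^ (j - k) * Y k\<close> with coefficients
  \<open>j\<close> choose \<open>k\<close>.\<close>

primrec chord_transform :: "nat \<Rightarrow> (nat \<Rightarrow> fa) \<Rightarrow> fa" where
  "chord_transform 0 Y = Y 0"
| "chord_transform (Suc j) Y = chord_transform j (\<lambda>n. Y (Suc n)) - Cas * chord_transform j Y"

lemma scl_sum_const: "(\<Sum>b\<in>S. scl r v) = scl (of_nat (card S) * r) v"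
  unfolding scl_sum_left[symmetric] sum_constant ..

text \<open>A new chord is a part of its own, or joins one of the \<open>n - 1\<close> parts without core, or joins the core. As
  \<open>pi_coeff (n + 1) = - n pi_coeff n\<close>, the first two cases leave \<open>- Cas\<close> times the old sum.\<close>
lemma partition_sum_core_together:
  assumes "finite Q" "l \<in> Q" "finite Ch" "Q \<inter> Ch = {}"
  shows "(\<Sum>P | partition_on (Q \<union> Ch) P. if Q \<subseteq> block l P
      then scl (pi_coeff (card P)) (Cas ^ card (Ch - block l P) * Y (card (Ch \<inter> block l P))) else 0)
    = chord_transform (card Ch) Y"
  using assms(3,4)
proof (induction Ch arbitrary: Y rule: finite_induct)
  case empty
  have part: "partition_on Q P \<and> Q \<subseteq> block l P \<longleftrightarrow> P = {Q}" for P
  proof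
    assume P: "partition_on Q P \<and> Q \<subseteq> block l P"
    then have bl: "block l P \<in> P" using block_in(1)[of Q P l] assms(2) by simp
    then have "block l P \<subseteq> Q" using P unfolding partition_on_def by blast
    then have "block l P = Q" using P by blast
    then have QP: "Q \<in> P" using bl by simp
    have "C = Q" if "C \<in> P" for C
    proof (rule ccontr)
      assume "C \<noteq> Q"
      then have "C \<inter> Q = {}" using P QP that by (auto simp: partition_on_def disjoint_def)
      moreover have "C \<subseteq> Q" "C \<noteq> {}" using P that unfolding partition_on_def by blast+
      ultimately show False by blast
    qed
    then show "P = {Q}" using QP by blast
  next
    assume "P = {Q}"
    then show "partition_on Q P \<and> Q \<subseteq> block l P"
      using assms(2) by (auto simp: partition_on_def block_def)
  qed
  have "(\<Sum>P | partition_on Q P. if Q \<subseteq> block l P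
      then scl (pi_coeff (card P)) (Cas ^ card ({} - block l P) * Y (card ({} \<inter> block l P))) else 0)
    = (\<Sum>P | partition_on Q P \<and> Q \<subseteq> block l P. scl (pi_coeff (card P)) (Y 0))"
    using sum.inter_filter[OF finite_partitions[OF assms(1)], of "\<lambda>P. scl (pi_coeff (card P)) (Y 0)" "\<lambda>P. Q \<subseteq> block l P"]
    by (simp cong: if_cong)
  then show ?case by (simp add: part pi_coeff_def)
next
  case (insert x Ch)
  let ?A = "Q \<union> Ch"
  let ?G = "\<lambda>Ch Y P. if Q \<subseteq> block l P
      then scl (pi_coeff (card P)) (Cas ^ card (Ch - block l P) * Y (card (Ch \<inter> block l P))) else 0"
  have x: "x \<notin> ?A" and fin: "finite ?A" and l: "l \<in> ?A" using insert assms by auto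
  have U: "Q \<union> insert x Ch = insert x ?A" by auto
  have step: "?G (insert x Ch) Y (insert {x} P) + (\<Sum>B\<in>P. ?G (insert x Ch) Y (insert (insert x B) (P - {B})))
      = ?G Ch (\<lambda>n. Y (Suc n)) P - Cas * ?G Ch Y P" if P: "partition_on ?A P" for P
  proof -
    define L where "L = block l P"
    have L: "L \<in> P" "l \<in> L" using block_in[OF P l] by (simp_all add: L_def)
    have finP: "finite P" using P fin by (rule finite_elements[rotated])
    have n1: "card P \<ge> 1" using finP L by (metis One_nat_def Suc_leI card_gt_0_iff empty_iff)
    have xL: "x \<notin> L" using L P x by (auto simp: partition_on_def)
    have nl: "l \<notin> B" if "B \<in> P - {L}" for B using that block_eq[OF P, of B l] by (auto simp: L_def)
    have 1: "block l (insert {x} P) = L"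
      using block_extend[OF P x l, of "{}"] P by (auto simp: partition_on_def L_def)
    have 2: "block l (insert (insert x L) (P - {L})) = insert x L"
      using block_extend[OF P x l, of L] L by simp
    have 3: "block l (insert (insert x B) (P - {B})) = L" if "B \<in> P - {L}" for B
      using block_extend[OF P x l, of B] that nl[OF that] by (simp add: L_def)
    have xQ: "x \<notin> Q" using x by simp
    have e1: "card (insert x Ch - L) = Suc (card (Ch - L))" "insert x Ch \<inter> L = Ch \<inter> L"
      using xL insert.hyps by (auto simp: insert_Diff_if)
    have e2: "insert x Ch - insert x L = Ch - L" "card (insert x Ch \<inter> insert x L) = Suc (card (Ch \<inter> L))"
    proof -
      show "insert x Ch - insert x L = Ch - L" using insert.hyps by auto
      have "insert x Ch \<inter> insert x L = insert x (Ch \<inter> L)" by auto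
      then show "card (insert x Ch \<inter> insert x L) = Suc (card (Ch \<inter> L))" using insert.hyps by simp
    qed
    have e3: "Q \<subseteq> insert x L \<longleftrightarrow> Q \<subseteq> L" using xQ by blast
    show ?thesis
    proof (cases "Q \<subseteq> L")
      \<comment> \<open>The new chord does not belong to \<open>Q\<close>, so a splitting that
        separates the core still does so after the insertion, and every term is zero.\<close>
      case False
      have "?G (insert x Ch) Y (insert (insert x B) (P - {B})) = 0" if "B \<in> P" for B
      proof (cases "B = L")
        case True
        then show ?thesis unfolding True 2 e3 using False by (simp only: if_False)
      next
        case F: False
        then show ?thesis using 3[of B] that False by simp
      qed
      then have "(\<Sum>B\<in>P. ?G (insert x Ch) Y (insert (insert x B) (P - {B}))) = 0" by (intro sum.neutral ballI)
      then show ?thesis using 1 False by (simp add: L_def[symmetric])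
    next
      case True
      let ?v = "Cas ^ card (Ch - L) * Y (card (Ch \<inter> L))"
      have t1: "?G (insert x Ch) Y (insert {x} P) = scl (pi_coeff (Suc (card P))) (Cas * ?v)"
        unfolding 1 e1 card_extend(1)[OF P fin x] using True by (simp add: mult.assoc)
      have t2: "?G (insert x Ch) Y (insert (insert x L) (P - {L}))
          = scl (pi_coeff (card P)) (Cas ^ card (Ch - L) * Y (Suc (card (Ch \<inter> L))))"
        unfolding 2 e2 e3 card_extend(2)[OF P fin x L(1)] using True by simp
      have t3: "?G (insert x Ch) Y (insert (insert x B) (P - {B})) = scl (pi_coeff (card P)) (Cas * ?v)"
        if "B \<in> P - {L}" for B
        unfolding 3[OF that] e1 using that card_extend(2)[OF P fin x, of B] True by (simp add: mult.assoc)
      have "(\<Sum>B\<in>P. ?G (insert x Ch) Y (insert (insert x B) (P - {B})))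
        = ?G (insert x Ch) Y (insert (insert x L) (P - {L}))
          + (\<Sum>B\<in>P - {L}. ?G (insert x Ch) Y (insert (insert x B) (P - {B})))"
        by (rule sum.remove[OF finP L(1)])
      also have "(\<Sum>B\<in>P - {L}. ?G (insert x Ch) Y (insert (insert x B) (P - {B})))
          = (\<Sum>B\<in>P - {L}. scl (pi_coeff (card P)) (Cas * ?v))"
        by (rule sum.cong[OF refl t3])
      also have "\<dots> = scl ((of_nat (card P) - 1) * pi_coeff (card P)) (Cas * ?v)"
        unfolding scl_sum_const using n1 L finP by (simp only: card_Diff_singleton of_nat_diff of_nat_1)
      finally have "?G (insert x Ch) Y (insert {x} P) + (\<Sum>B\<in>P. ?G (insert x Ch) Y (insert (insert x B) (P - {B})))
        = scl (pi_coeff (card P)) (Cas ^ card (Ch - L) * Y (Suc (card (Ch \<inter> L))))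
          + scl (pi_coeff (Suc (card P)) + (of_nat (card P) - 1) * pi_coeff (card P)) (Cas * ?v)"
        unfolding t1 t2 by (simp only: scl_add_left add_ac)
      also have "pi_coeff (Suc (card P)) + (of_nat (card P) - 1) * pi_coeff (card P) = - pi_coeff (card P)"
        unfolding pi_coeff_Suc[OF n1] by (simp add: algebra_simps)
      finally show ?thesis using True by (simp add: L_def[symmetric] scl_minus_left)
    qed
  qed
  have "(\<Sum>P | partition_on (Q \<union> insert x Ch) P. ?G (insert x Ch) Y P)
    = (\<Sum>P | partition_on ?A P. ?G Ch (\<lambda>n. Y (Suc n)) P - Cas * ?G Ch Y P)"
    unfolding U sum_partitions_insert[OF fin x] by (intro sum.cong refl step) simp
  also have "\<dots> = chord_transform (card Ch) (\<lambda>n. Y (Suc n)) - Cas * chord_transform (card Ch) Y"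
    unfolding sum_subtractf sum_distrib_left[symmetric] using insert by simp
  finally show ?case using insert.hyps by simp
qed

lemma Cas_shift_Cas_commute: "Cas_shift * Cas = Cas * Cas_shift"
  by (simp add: Cas_shift_def left_diff_distrib right_diff_distrib)

lemma scl_cancel:
  assumes "r + 2 * p + (n - 2) * p = 0"
  shows "scl r w + (scl ((n - 2) * p) w + (scl (2 * p) w - u)) = - u"
proof -
  have "scl r w + (scl ((n - 2) * p) w + (scl (2 * p) w - u)) = scl (r + 2 * p + (n - 2) * p) w - u"
    by (simp only: scl_add_left diff_conv_add_uminus add_ac)
  then show ?thesis using assms by simp
qed

lemma Cas_Cas_shift_power: "Cas * (Cas_shift ^ k * Cas ^ n) = Cas_shift ^ k * Cas ^ Suc n"
  using power_commuting_commutes[OF Cas_shift_Cas_commute, of k] by (metis mult.assoc power_Suc)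

text \<open>The exponent \<open>+ 2\<close> counts the two core chords themselves. Of
  \<open>n\<close> parts, two act on the new chord by \<open>Cas_shift\<close>, the other
  \<open>n - 2\<close> and the new singleton by \<open>Cas\<close>. The weights of
  \<open>Cas\<close> add up to \<open>- n + 2 + (n - 2) = 0\<close> times the old coefficient, which
  leaves the two shifts.\<close>

lemma partition_sum_core_apart:
  assumes "q1 \<noteq> q2" "finite Ch" "x \<notin> Ch" "x \<notin> {q1,q2}"
  defines "V \<equiv> \<lambda>Ch P. if q2 \<in> block q1 P then 0 else
     scl (pi_coeff (card P)) (Cas_shift ^ card (Ch \<inter> (block q1 P \<union> block q2 P)) * Cas ^ (card (Ch - (block q1 P \<union> block q2 P)) + 2))"
  shows "(\<Sum>P | partition_on ({q1,q2} \<union> insert x Ch) P. V (insert x Ch) P)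
    = - scl (1 / lam) (\<Sum>P | partition_on ({q1,q2} \<union> Ch) P. V Ch P)"
proof -
  let ?A = "{q1,q2} \<union> Ch"
  have x: "x \<notin> ?A" and fin: "finite ?A" and q: "q1 \<in> ?A" "q2 \<in> ?A" using assms by auto
  have U: "{q1,q2} \<union> insert x Ch = insert x ?A" by auto
  have step: "V (insert x Ch) (insert {x} P) + (\<Sum>B\<in>P. V (insert x Ch) (insert (insert x B) (P - {B})))
      = scl (- (1 / lam)) (V Ch P)" if P: "partition_on ?A P" for P
  proof -
    define L M where "L = block q1 P" and "M = block q2 P"
    have LM: "L \<in> P" "q1 \<in> L" "M \<in> P" "q2 \<in> M"
      using block_in[OF P q(1)] block_in[OF P q(2)] by (simp_all add: L_def M_def)
    have finP: "finite P" using P fin by (rule finite_elements[rotated])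
    have n1: "card P \<ge> 1" using finP LM by (metis One_nat_def Suc_leI card_gt_0_iff empty_iff)
    have xB: "x \<notin> B" if "B \<in> P" for B using that P x by (auto simp: partition_on_def)
    have q1B: "q1 \<in> B \<longleftrightarrow> B = L" if "B \<in> P" for B
    proof
      assume "q1 \<in> B"
      from block_eq[OF P that this] show "B = L" unfolding L_def by (rule sym)
    qed (use LM(2) in simp)
    have q2B: "q2 \<in> B \<longleftrightarrow> B = M" if "B \<in> P" for B
    proof
      assume "q2 \<in> B"
      from block_eq[OF P that this] show "B = M" unfolding M_def by (rule sym)
    qed (use LM(4) in simp)
    have bl: "block q1 (insert (insert x B) (P - {B})) = (if B = L then insert x B else L)"
      "block q2 (insert (insert x B) (P - {B})) = (if B = M then insert x B else M)" if "B \<in> P" for B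
      using block_extend[OF P x q(1) insertI2[OF that]] block_extend[OF P x q(2) insertI2[OF that]]
      unfolding q1B[OF that] q2B[OF that] L_def[symmetric] M_def[symmetric] .
    have bl0: "block q1 (insert {x} P) = L" "block q2 (insert {x} P) = M"
      using block_extend[OF P x q(1), of "{}"] block_extend[OF P x q(2), of "{}"] P
      by (auto simp: partition_on_def L_def M_def)
    have xq: "q2 \<noteq> x" using assms by auto
    show ?thesis
    proof (cases "q2 \<in> L")
      case True
      have "V (insert x Ch) (insert (insert x B) (P - {B})) = 0" if "B \<in> P" for B
        using True bl(1)[OF that] by (simp add: V_def)
      moreover have "V (insert x Ch) (insert {x} P) = 0" "V Ch P = 0"
        using True bl0 by (simp_all add: V_def L_def)
      ultimately show ?thesis by simp
    next
      case False
      then have "L \<noteq> M" using LM by auto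
      let ?S = "L \<union> M"
      let ?v = "Cas_shift ^ card (Ch \<inter> ?S) * Cas ^ (card (Ch - ?S) + 2)"
      have vC: "Cas * ?v = Cas_shift ^ card (Ch \<inter> ?S) * Cas ^ (Suc (card (Ch - ?S)) + 2)"
        unfolding Cas_Cas_shift_power add_Suc ..
      have e1: "insert x Ch \<inter> ?S = Ch \<inter> ?S" "card (insert x Ch - ?S) = Suc (card (Ch - ?S))"
        using xB LM assms(2,3) by (auto simp: insert_Diff_if)
      have ex: "insert x L \<union> M = insert x ?S" "L \<union> insert x M = insert x ?S" by auto
      have e2: "insert x Ch - insert x ?S = Ch - ?S" "card (insert x Ch \<inter> insert x ?S) = Suc (card (Ch \<inter> ?S))"
      proof -
        show "insert x Ch - insert x ?S = Ch - ?S" using assms(3) by auto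
        have "insert x Ch \<inter> insert x ?S = insert x (Ch \<inter> ?S)" by auto
        then show "card (insert x Ch \<inter> insert x ?S) = Suc (card (Ch \<inter> ?S))" using assms(2,3) by simp
      qed
      have t0: "V (insert x Ch) (insert {x} P) = scl (pi_coeff (Suc (card P))) (Cas * ?v)"
        unfolding V_def bl0 e1 card_extend(1)[OF P fin x] vC using False by simp
      have t1: "V (insert x Ch) (insert (insert x B) (P - {B})) = scl (pi_coeff (card P)) (Cas_shift * ?v)" if "B \<in> {L,M}" for B
      proof -
        have B: "B \<in> P" using that LM by auto
        have 1: "block q1 (insert (insert x B) (P - {B})) \<union> block q2 (insert (insert x B) (P - {B})) = insert x ?S"
          unfolding bl[OF B] using that \<open>L \<noteq> M\<close> ex by auto
        have 2: "q2 \<notin> block q1 (insert (insert x B) (P - {B}))"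
          unfolding bl[OF B] using False xq by auto
        show ?thesis
          by (simp only: V_def 1 2 if_False e2 card_extend(2)[OF P fin x B] power_Suc mult.assoc)
      qed
      have t2: "V (insert x Ch) (insert (insert x B) (P - {B})) = scl (pi_coeff (card P)) (Cas * ?v)" if "B \<in> P - {L,M}" for B
        unfolding V_def vC using that False bl[of B] e1 card_extend(2)[OF P fin x, of B] by simp
      have c2: "card (P - {L,M}) = card P - 2" "card P \<ge> 2"
        using LM \<open>L \<noteq> M\<close> finP card_mono[of P "{L,M}"] by (auto simp: card_Diff_subset)
      let ?V = "\<lambda>B. V (insert x Ch) (insert (insert x B) (P - {B}))"
      have split: "(\<Sum>B\<in>P. ?V B) = (\<Sum>B\<in>P - {L,M}. ?V B) + (\<Sum>B\<in>{L,M}. ?V B)"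
        by (rule sum.subset_diff[OF _ finP]) (use LM in blast)
      have "(\<Sum>B\<in>{L,M}. ?V B) = (\<Sum>B\<in>{L,M}. scl (pi_coeff (card P)) (Cas_shift * ?v))"
        by (rule sum.cong[OF refl t1])
      moreover have "card {L,M} = 2" using \<open>L \<noteq> M\<close> by simp
      moreover have "scl (2 * pi_coeff (card P)) (Cas_shift * ?v)
          = scl (2 * pi_coeff (card P)) (Cas * ?v) - scl (pi_coeff (card P) * (1 / lam)) ?v"
        using lam by (simp add: Cas_shift_def left_diff_distrib scl_diff_right)
      ultimately have s1: "(\<Sum>B\<in>{L,M}. ?V B)
          = scl (2 * pi_coeff (card P)) (Cas * ?v) - scl (pi_coeff (card P) * (1 / lam)) ?v"
        by (simp only: scl_sum_const of_nat_numeral)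
      have "(\<Sum>B\<in>P - {L,M}. ?V B) = (\<Sum>B\<in>P - {L,M}. scl (pi_coeff (card P)) (Cas * ?v))"
        by (rule sum.cong[OF refl t2])
      then have s2: "(\<Sum>B\<in>P - {L,M}. ?V B) = scl ((of_nat (card P) - 2) * pi_coeff (card P)) (Cas * ?v)"
        using c2 by (simp only: scl_sum_const of_nat_diff of_nat_numeral)
      have z: "pi_coeff (Suc (card P)) + 2 * pi_coeff (card P) + (of_nat (card P) - 2) * pi_coeff (card P) = 0"
        unfolding pi_coeff_Suc[OF n1] by (simp add: algebra_simps)
      have "V (insert x Ch) (insert {x} P) + (\<Sum>B\<in>P. ?V B) = - scl (pi_coeff (card P) * (1 / lam)) ?v"
        by (subst t0, subst split, subst s1, subst s2, rule scl_cancel[OF z])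
      moreover have "V Ch P = scl (pi_coeff (card P)) ?v"
        using False by (simp add: V_def L_def[symmetric] M_def[symmetric])
      ultimately show ?thesis by (simp only: scl_scl scl_minus_left mult_minus_left mult_minus_right mult.commute)
    qed
  qed
  have "(\<Sum>P | partition_on ({q1,q2} \<union> insert x Ch) P. V (insert x Ch) P)
    = (\<Sum>P | partition_on ?A P. scl (- (1 / lam)) (V Ch P))"
    unfolding U sum_partitions_insert[OF fin x] by (intro sum.cong refl step) simp
  then show ?thesis unfolding scl_sum_right[symmetric] unfolding scl_minus_left .
qed

lemma chord_transform_cong: "(\<And>n. Y n \<approx> Y' n) \<Longrightarrow> chord_transform j Y \<approx> chord_transform j Y'"
  by (induction j arbitrary: Y Y') (auto intro!: ucong_diff ucong_mult)

lemma chord_transform_linear: "chord_transform j (\<lambda>n. Y n + scl r (Y' n) - Cas * Y'' n) = chord_transform j Y + scl r (chord_transform j Y') - Cas * chord_transform j Y''"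
proof (induction j arbitrary: Y Y' Y'')
  case (Suc j)
  show ?case
    unfolding chord_transform.simps Suc.IH[of Y Y' Y''] Suc.IH[of "\<lambda>n. Y (Suc n)" "\<lambda>n. Y' (Suc n)" "\<lambda>n. Y'' (Suc n)"]
      scl_diff_right right_diff_distrib distrib_left scl_mult_right
    by (simp only: diff_conv_add_uminus minus_add_distrib minus_minus add_ac)
qed simp

text \<open>Shift and multiplication by \<open>- Cas\<close> are the two operations in the recursion
  of \<open>chord_transform\<close>, so the corresponding terms of the rung recursion merge into one
  more chord.\<close>

lemma chord_transform_ladder_val: "chord_transform j (ladder_val (Suc i)) \<approx> chord_transform (Suc j) (ladder_val i) + scl (1 / lam) (chord_transform j (ladder_val i))"
proof -
  have alg: "a + b - d = a - d + b" for a b d :: fa by simp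
  have "chord_transform j (ladder_val (Suc i)) \<approx> chord_transform j (\<lambda>n. ladder_val i (Suc n) + scl (1 / lam) (ladder_val i n) - Cas * ladder_val i n)"
    by (rule chord_transform_cong) (rule ladder_val_recursion)
  moreover have "chord_transform j (\<lambda>n. ladder_val i (Suc n) + scl (1 / lam) (ladder_val i n) - Cas * ladder_val i n)
      = chord_transform (Suc j) (ladder_val i) + scl (1 / lam) (chord_transform j (ladder_val i))"
    unfolding chord_transform.simps by (rule trans[OF chord_transform_linear alg])
  ultimately show ?thesis by (rule ucong_eq_trans)
qed

end

section \<open>Components and subdiagrams of the ladder diagrams\<close>

text \<open>Reachability is symmetric, so it suffices that each set is closed under adjacency and
  reachable from one root.\<close>

lemma comps_eqI:
  assumes U: "\<Union>\<Q> = halfedges D"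
    and closed: "\<And>Q x y. Q \<in> \<Q> \<Longrightarrow> (x,y) \<in> adj D \<Longrightarrow> x \<in> Q \<longleftrightarrow> y \<in> Q"
    and conn: "\<And>Q. Q \<in> \<Q> \<Longrightarrow> \<exists>r\<in>Q. \<forall>x\<in>Q. (r,x) \<in> (adj D \<union> (adj D)\<inverse>)\<^sup>*"
  shows "comps D = \<Q>"
proof -
  let ?R = "(adj D \<union> (adj D)\<inverse>)\<^sup>*"
  have sym: "(y,x) \<in> ?R" if "(x,y) \<in> ?R" for x y
  proof -
    have "sym ?R" by (intro sym_rtrancl) (auto simp: sym_def)
    then show ?thesis using that by (rule symD)
  qed
  have cl: "?R `` {x} = Q" if Q: "Q \<in> \<Q>" and x: "x \<in> Q" for Q x
  proof
    have "y \<in> Q" if "(x,y) \<in> ?R" for y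
      using that
    proof (induction rule: rtrancl_induct)
      case (step y z)
      then show ?case using closed[OF Q] by auto
    qed (rule x)
    then show "?R `` {x} \<subseteq> Q" by auto
    obtain r where "r \<in> Q" and r: "\<And>y. y \<in> Q \<Longrightarrow> (r,y) \<in> ?R" using conn[OF Q] by blast
    have "(x,y) \<in> ?R" if "y \<in> Q" for y
      using rtrancl_trans[OF sym[OF r[OF x]] r[OF that]] .
    then show "Q \<subseteq> ?R `` {x}" by auto
  qed
  have "comps D = (\<Union>x\<in>\<Union>\<Q>. {?R `` {x}})" by (simp add: comps_def quotient_def U)
  also have "\<dots> = \<Q>"
  proof (intro equalityI subsetI)
    fix C assume "C \<in> (\<Union>x\<in>\<Union>\<Q>. {?R `` {x}})"
    then obtain Q x where "Q \<in> \<Q>" "x \<in> Q" "C = ?R `` {x}" by blast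
    then show "C \<in> \<Q>" using cl by simp
  next
    fix Q assume Q: "Q \<in> \<Q>"
    then obtain x where "x \<in> Q" using conn by blast
    then show "Q \<in> (\<Union>x\<in>\<Union>\<Q>. {?R `` {x}})" using cl[OF Q] Q by blast
  qed
  finally show ?thesis .
qed

section \<open>The components of the ladder diagrams\<close>

definition chord :: "nat \<Rightarrow> nat set" where
  "chord k = {2*k+2, 2*k+3}"

definition J_chords :: "nat \<Rightarrow> nat set set" where
  "J_chords j = chord ` {1..j}"

definition J_core :: "nat \<Rightarrow> nat \<Rightarrow> nat set set" where
  "J_core i j = (if i = 0 then {{0,1},{2,3}} else {{0,1,2,3} \<union> {2*j+4..<2*j+4+6*i}})"

definition J_verts :: "nat \<Rightarrow> nat \<Rightarrow> (nat \<times> nat \<times> nat) list" where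
  "J_verts s i = concat (map (\<lambda>k. [(s + 6*k, s + 6*k + 1, s + 6*k + 2), (s + 6*k + 3, s + 6*k + 4, s + 6*k + 5)]) [0..<i])"

definition J_edges :: "nat \<Rightarrow> nat \<Rightarrow> (nat \<times> nat) list" where
  "J_edges s i = (if i = 0 then [(0,1),(2,3)] else
     map (\<lambda>k. (s + 6*k + 2, s + 6*k + 4)) [0..<i] @
     map (\<lambda>k. (s + 6*k, s + 6*(k+1) + 1)) [0..<i-1] @
     map (\<lambda>k. (s + 6*k + 3, s + 6*(k+1) + 5)) [0..<i-1] @
     [(s + 1, 1), (s + 5, 2), (s + 6*(i-1), 0), (s + 6*(i-1) + 3, 3)])"

text \<open>Renumbers the rungs from 0, which removes the truncated subtraction from the half-edge
  numbers.\<close>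

lemma Jdiag_fields:
  "dloop (Jdiag i j) = [0] @ map (\<lambda>k. 2*k+2) [1..<j+1] @ [1,2] @ rev (map (\<lambda>k. 2*k+3) [1..<j+1]) @ [3]"
  "dverts (Jdiag i j) = J_verts (2*j+4) i"
  "dedges (Jdiag i j) = J_edges (2*j+4) i @ map (\<lambda>k. (2*k+2, 2*k+3)) [1..<j+1]"
proof -
  show "dloop (Jdiag i j) = [0] @ map (\<lambda>k. 2*k+2) [1..<j+1] @ [1,2] @ rev (map (\<lambda>k. 2*k+3) [1..<j+1]) @ [3]"
    by (simp add: Jdiag_def Let_def)
  have u: "[1..<i+1] = map Suc [0..<i]" by (simp add: map_Suc_upt)
  have u': "[1..<i] = map Suc [0..<i-1]" if "i \<noteq> 0" using that by (cases i) (simp_all add: map_Suc_upt)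
  show "dverts (Jdiag i j) = J_verts (2*j+4) i"
    unfolding Jdiag_def J_verts_def Let_def u by (simp add: o_def)
  show "dedges (Jdiag i j) = J_edges (2*j+4) i @ map (\<lambda>k. (2*k+2, 2*k+3)) [1..<j+1]"
  proof (cases "i = 0")
    case False
    then show ?thesis unfolding Jdiag_def J_edges_def Let_def u u'[OF False] by (simp add: o_def)
  qed (simp add: Jdiag_def J_edges_def Let_def)
qed

lemma set_J_verts: "(\<Union>(a,b,d)\<in>set (J_verts s i). {a,b,d}) = {s..<s+6*i}"
proof (intro equalityI subsetI)
  fix x assume "x \<in> {s..<s+6*i}"
  then have x: "s \<le> x" "x < s + 6*i" by auto
  define k r where "k = (x - s) div 6" and "r = (x - s) mod 6"
  have xk: "x = s + 6*k + r" "r < 6" using x by (auto simp: k_def r_def)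
  then have "k < i" using x by auto
  have "r = 0 \<or> r = 1 \<or> r = 2 \<or> r = 3 \<or> r = 4 \<or> r = 5" using xk(2) by auto
  then show "x \<in> (\<Union>(a,b,d)\<in>set (J_verts s i). {a,b,d})"
    using \<open>k < i\<close> xk(1) by (force simp: J_verts_def)
qed (auto simp: J_verts_def)

lemma halfedges_J: "halfedges (Jdiag i j) = {0,1,2,3} \<union> {2*j+4..<2*j+4+6*i} \<union> \<Union>(J_chords j)"
proof -
  have "set [1..<j+1] = {1..j}" by auto
  then show ?thesis
    unfolding halfedges_def Jdiag_fields set_J_verts set_append set_map set_rev by (auto simp: J_chords_def chord_def)
qed

lemma J_verts_cases:
  assumes "(a,b,d) \<in> set (J_verts s i)"
  obtains k where "k < i" "(a,b,d) = (s + 6*k, s + 6*k + 1, s + 6*k + 2)"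
  | k where "k < i" "(a,b,d) = (s + 6*k + 3, s + 6*k + 4, s + 6*k + 5)"
  using assms unfolding J_verts_def by auto

lemma J_verts_core:
  assumes "(a,b,d) \<in> set (J_verts s i)"
  shows "{a,b,d} \<subseteq> {s..<s+6*i}"
  using assms by (cases rule: J_verts_cases) auto

lemma J_edges_core:
  assumes "(x,y) \<in> set (J_edges s i)"
  shows "{x,y} \<subseteq> {0,1,2,3} \<union> {s..<s+6*i}"
proof (cases "i = 0")
  case True
  then show ?thesis using assms by (auto simp: J_edges_def)
next
  case False
  then consider k where "k < i" "x = s + 6*k + 2" "y = s + 6*k + 4"
    | k where "k < i - 1" "x = s + 6*k" "y = s + 6*(k+1) + 1"
    | k where "k < i - 1" "x = s + 6*k + 3" "y = s + 6*(k+1) + 5"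
    | "x \<in> {s + 1, s + 5, s + 6*(i-1), s + 6*(i-1) + 3}" "y \<in> {0,1,2,3}"
    using assms unfolding J_edges_def by auto
  then show ?thesis using False by cases auto
qed

lemma comps_J: "comps (Jdiag i j) = J_core i j \<union> J_chords j"
proof (rule comps_eqI)
  let ?D = "Jdiag i j" and ?s = "2*j+4"
  let ?R = "(adj ?D \<union> (adj ?D)\<inverse>)\<^sup>*"
  show "\<Union>(J_core i j \<union> J_chords j) = halfedges (Jdiag i j)"
    unfolding halfedges_J by (auto simp: J_core_def)
  show "x \<in> Q \<longleftrightarrow> y \<in> Q" if Q: "Q \<in> J_core i j \<union> J_chords j" and xy: "(x,y) \<in> adj ?D" for Q x y
  proof -
    have "(x,y) \<in> set (J_edges ?s i) \<or> (x,y) \<in> (\<Union>(a,b,d)\<in>set (J_verts ?s i). {(a,b),(b,d)}) \<or>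
      (\<exists>k\<in>{1..j}. x = 2*k+2 \<and> y = 2*k+3)"
      using xy unfolding adj_def Jdiag_fields by auto
    then consider (core) "x \<in> {0,1,2,3} \<union> {?s..<?s+6*i}" "y \<in> {0,1,2,3} \<union> {?s..<?s+6*i}"
        "i = 0 \<longrightarrow> (x,y) = (0,1) \<or> (x,y) = (2,3)"
      | (chord) k where "k \<in> {1..j}" "x = 2*k+2" "y = 2*k+3"
    proof (elim disjE)
      assume e: "(x,y) \<in> set (J_edges ?s i)"
      have "(x,y) = (0,1) \<or> (x,y) = (2,3)" if "i = 0" using e that by (simp add: J_edges_def)
      then show thesis using core J_edges_core[OF e] by blast
    next
      assume "(x,y) \<in> (\<Union>(a,b,d)\<in>set (J_verts ?s i). {(a,b),(b,d)})"
      then obtain a b d where e: "(a,b,d) \<in> set (J_verts ?s i)" "x \<in> {a,b,d}" "y \<in> {a,b,d}" by blast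
      have "i \<noteq> 0" using e by (auto simp: J_verts_def)
      then show thesis using core J_verts_core[OF e(1)] e by blast
    next
      assume "\<exists>k\<in>{1..j}. x = 2*k+2 \<and> y = 2*k+3"
      then show thesis using chord by blast
    qed
    then show ?thesis
    proof cases
      case core
      from Q show ?thesis
      proof
        assume Qc: "Q \<in> J_core i j"
        show ?thesis
        proof (cases "i = 0")
          case True
          then have "Q = {0,1} \<or> Q = {2,3}" "(x,y) = (0,1) \<or> (x,y) = (2,3)"
            using Qc core by (simp_all add: J_core_def)
          then show ?thesis by auto
        next
          case False
          then have "Q = {0,1,2,3} \<union> {?s..<?s+6*i}" using Qc by (simp add: J_core_def)
          then show ?thesis using core by blast
        qed
      next
        assume "Q \<in> J_chords j"
        then obtain l where "l \<in> {1..j}" "Q = {2*l+2, 2*l+3}" by (auto simp: J_chords_def chord_def)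
        then have "q \<notin> Q" if "q \<in> {0,1,2,3} \<union> {?s..<?s+6*i}" for q using that by auto
        then show ?thesis using core by blast
      qed
    next
      case (chord k)
      from Q show ?thesis
      proof
        assume "Q \<in> J_core i j"
        then have "Q \<subseteq> {0,1,2,3} \<union> {?s..<?s+6*i}" by (cases "i = 0") (auto simp: J_core_def)
        moreover have "x \<notin> {0,1,2,3} \<union> {?s..<?s+6*i}" "y \<notin> {0,1,2,3} \<union> {?s..<?s+6*i}" using chord by auto
        ultimately show ?thesis by blast
      next
        assume "Q \<in> J_chords j"
        then obtain l where "l \<in> {1..j}" "Q = {2*l+2, 2*l+3}" by (auto simp: J_chords_def chord_def)
        then show ?thesis using chord by (simp, presburger)
      qed
    qed
  qed
  have step: "(x,y) \<in> ?R" "(y,x) \<in> ?R" if "(x,y) \<in> adj ?D" for x y using that by auto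
  show "\<exists>r\<in>Q. \<forall>x\<in>Q. (r,x) \<in> ?R" if Q: "Q \<in> J_core i j \<union> J_chords j" for Q
    using Q
  proof
    assume "Q \<in> J_chords j"
    then obtain k where k: "k \<in> {1..j}" "Q = {2*k+2, 2*k+3}" by (auto simp: J_chords_def chord_def)
    then have "(2*k+2, 2*k+3) \<in> adj ?D" unfolding adj_def Jdiag_fields by auto
    then show ?thesis using step k by auto
  next
    assume Qc: "Q \<in> J_core i j"
    show ?thesis
    proof (cases "i = 0")
      case True
      then have "(0,1) \<in> adj ?D" "(2,3) \<in> adj ?D" unfolding adj_def Jdiag_fields J_edges_def by auto
      moreover have "Q = {0,1} \<or> Q = {2,3}" using Qc True by (simp add: J_core_def)
      ultimately show ?thesis using step by auto
    next
      case False
      then have Qeq: "Q = {0,1,2,3} \<union> {?s..<?s+6*i}" using Qc by (simp add: J_core_def)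
      have edge: "(x,y) \<in> ?R" "(y,x) \<in> ?R" if "(x,y) \<in> set (J_edges ?s i)" for x y
        using step[of x y] that unfolding adj_def Jdiag_fields by auto
      have vert: "(a,b) \<in> ?R" "(b,a) \<in> ?R" "(b,d) \<in> ?R" "(d,b) \<in> ?R" if "(a,b,d) \<in> set (J_verts ?s i)" for a b d
      proof -
        have "(a,b) \<in> adj ?D" "(b,d) \<in> adj ?D" using that unfolding adj_def Jdiag_fields by force+
        then show "(a,b) \<in> ?R" "(b,a) \<in> ?R" "(b,d) \<in> ?R" "(d,b) \<in> ?R" using step by auto
      qed
      have v1: "(?s+6*k, ?s+6*k+1, ?s+6*k+2) \<in> set (J_verts ?s i)"
        and v2: "(?s+6*k+3, ?s+6*k+4, ?s+6*k+5) \<in> set (J_verts ?s i)" if "k < i" for k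
        using that by (auto simp: J_verts_def)
      have er: "(?s+6*k+2, ?s+6*k+4) \<in> set (J_edges ?s i)" if "k < i" for k
        using that by (auto simp: J_edges_def)
      have el: "(?s+6*k, ?s+6*(k+1)+1) \<in> set (J_edges ?s i)" if "Suc k < i" for k
        using that by (auto simp: J_edges_def)
      have e4: "(?s+1,1) \<in> set (J_edges ?s i)" "(?s+5,2) \<in> set (J_edges ?s i)"
        "(?s+6*(i-1),0) \<in> set (J_edges ?s i)" "(?s+6*(i-1)+3,3) \<in> set (J_edges ?s i)"
        using False by (auto simp: J_edges_def)
      have tr: "(x,z) \<in> ?R" if "(x,y) \<in> ?R" "(y,z) \<in> ?R" for x y z using that by (rule rtrancl_trans)
      \<comment> \<open>From the left half-edge of the upper vertex the whole rung is reached
        through that vertex, the rung edge and the lower vertex. The upper rail alone then leads to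
        the next rung.\<close>
      have from1: "(?s, ?s+6*k) \<in> ?R" "(?s, ?s+6*k+2) \<in> ?R" "(?s, ?s+6*k+3) \<in> ?R"
        "(?s, ?s+6*k+4) \<in> ?R" "(?s, ?s+6*k+5) \<in> ?R" if k: "k < i" and 1: "(?s, ?s+6*k+1) \<in> ?R" for k
      proof -
        show "(?s, ?s+6*k) \<in> ?R" using tr[OF 1 vert(2)[OF v1[OF k]]] .
        show 2: "(?s, ?s+6*k+2) \<in> ?R" using tr[OF 1 vert(3)[OF v1[OF k]]] .
        show 4: "(?s, ?s+6*k+4) \<in> ?R" using tr[OF 2 edge(1)[OF er[OF k]]] .
        show "(?s, ?s+6*k+3) \<in> ?R" using tr[OF 4 vert(2)[OF v2[OF k]]] .
        show "(?s, ?s+6*k+5) \<in> ?R" using tr[OF 4 vert(3)[OF v2[OF k]]] .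
      qed
      have one: "(?s, ?s+6*k+1) \<in> ?R" if "k < i" for k
        using that
      proof (induction k)
        case 0
        then show ?case using vert(1)[OF v1[of 0]] by simp
      next
        case (Suc k)
        then have "(?s, ?s+6*k) \<in> ?R" using from1(1)[of k] by simp
        from tr[OF this edge(1)[OF el[OF Suc.prems]]] show ?case by simp
      qed
      have "(?s, x) \<in> ?R" if "x \<in> {?s..<?s+6*i}" for x
      proof -
        define k r where "k = (x - ?s) div 6" and "r = (x - ?s) mod 6"
        have x: "x = ?s + 6*k + r" "r < 6" using that by (auto simp: k_def r_def)
        then have "k < i" using that by auto
        have "r = 0 \<or> r = 1 \<or> r = 2 \<or> r = 3 \<or> r = 4 \<or> r = 5" using x(2) by auto
        then show ?thesis unfolding x(1) using one[OF \<open>k < i\<close>] from1[OF \<open>k < i\<close> one[OF \<open>k < i\<close>]] by (elim disjE) simp_all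
      qed
      moreover have "(?s, 1) \<in> ?R" "(?s, 2) \<in> ?R"
        using tr[OF _ edge(1)[OF e4(1)]] tr[OF _ edge(1)[OF e4(2)]] one[of 0] from1(5)[OF _ one, of 0] False by auto
      moreover have "(?s, 0) \<in> ?R" "(?s, 3) \<in> ?R"
        using tr[OF _ edge(1)[OF e4(3)]] tr[OF _ edge(1)[OF e4(4)]] from1(1)[OF _ one, of "i-1"] from1(3)[OF _ one, of "i-1"] False by auto
      moreover have "?s \<in> Q" unfolding Qeq using False by simp
      ultimately show ?thesis unfolding Qeq by (intro bexI[of _ ?s]) auto
    qed
  qed
qed

lemma comps_partition:
  assumes "B \<in> comps D" "B' \<in> comps D" "B \<noteq> B'"
  shows "B \<inter> B' = {}"
proof -
  have "equiv UNIV ((adj D \<union> (adj D)\<inverse>)\<^sup>*)"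
    by (intro equivI refl_rtrancl sym_rtrancl trans_rtrancl) (auto simp: sym_def)
  moreover have "B \<in> UNIV // ((adj D \<union> (adj D)\<inverse>)\<^sup>*)" "B' \<in> UNIV // ((adj D \<union> (adj D)\<inverse>)\<^sup>*)"
    using assms by (auto simp: comps_def quotient_def)
  ultimately show ?thesis using quotient_disj assms(3) by metis
qed

lemma comps_closed: "B \<in> comps D \<Longrightarrow> (x,y) \<in> adj D \<Longrightarrow> x \<in> B \<Longrightarrow> y \<in> B"
  by (auto simp: comps_def quotient_def intro: rtrancl_into_rtrancl)

text \<open>\<open>subdiag\<close> tests only the first half-edge of a vertex. Components are closed
  under adjacency, so the other two follow.\<close>

lemma halfedges_subdiag:
  assumes "\<B> \<subseteq> comps D"
  shows "halfedges (subdiag D (\<Union>\<B>)) = halfedges D \<inter> \<Union>\<B>"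
proof -
  have *: "a \<in> \<Union>\<B> \<longleftrightarrow> b \<in> \<Union>\<B>" "b \<in> \<Union>\<B> \<longleftrightarrow> d \<in> \<Union>\<B>" if "(a,b,d) \<in> set (dverts D)" for a b d
  proof -
    have "(x,y) \<in> adj D \<Longrightarrow> x \<in> \<Union>\<B> \<longleftrightarrow> y \<in> \<Union>\<B>" for x y
    proof -
      assume xy: "(x,y) \<in> adj D"
      have "y \<in> B \<Longrightarrow> x \<in> B" if "B \<in> comps D" for B
        using that xy by (auto simp: comps_def quotient_def intro: rtrancl_into_rtrancl)
      then show ?thesis using comps_closed[OF _ xy] assms by blast
    qed
    moreover have "(a,b) \<in> adj D" "(b,d) \<in> adj D" using that by (force simp: adj_def)+
    ultimately show "a \<in> \<Union>\<B> \<longleftrightarrow> b \<in> \<Union>\<B>" "b \<in> \<Union>\<B> \<longleftrightarrow> d \<in> \<Union>\<B>" by blast+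
  qed
  show ?thesis
  proof (intro equalityI subsetI)
    fix x assume "x \<in> halfedges (subdiag D (\<Union>\<B>))"
    then show "x \<in> halfedges D \<inter> \<Union>\<B>"
      using * unfolding halfedges_def subdiag_def by fastforce
  next
    fix x assume "x \<in> halfedges D \<inter> \<Union>\<B>"
    then show "x \<in> halfedges (subdiag D (\<Union>\<B>))"
      using * unfolding halfedges_def subdiag_def by fastforce
  qed
qed

lemma prod_list_upt: "prod_list (map h [0..<n]) = (\<Prod>k<n. h k)" for h :: "nat \<Rightarrow> 'a::comm_monoid_mult"
  by (induction n) (simp_all add: mult.commute)

lemma sorted_wrt_distinctI:
  assumes "distinct xs" "\<And>x y. x \<in> set xs \<Longrightarrow> y \<in> set xs \<Longrightarrow> x \<noteq> y \<Longrightarrow> R x y"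
  shows "sorted_wrt R xs"
  using assms by (induction xs) auto

lemma subdiag_comps_id:
  assumes "\<forall>(x,y)\<in>set (dedges D). x \<in> halfedges D"
  shows "subdiag D (\<Union>(comps D)) = D"
proof -
  have sub: "halfedges D \<subseteq> \<Union>(comps D)" by (auto simp: comps_def quotient_def)
  have "filter (\<lambda>h. h \<in> \<Union>(comps D)) (dloop D) = dloop D"
    using sub by (intro filter_True) (auto simp: halfedges_def)
  moreover have "filter (\<lambda>(a,_,_). a \<in> \<Union>(comps D)) (dverts D) = dverts D"
  proof (rule filter_True, clarify)
    fix a b d assume "(a,b,d) \<in> set (dverts D)"
    then have "a \<in> halfedges D" unfolding halfedges_def by blast
    then show "a \<in> \<Union>(comps D)" using sub by blast
  qed
  moreover have "filter (\<lambda>(a,_). a \<in> \<Union>(comps D)) (dedges D) = dedges D"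
  proof (rule filter_True, clarify)
    fix x y assume "(x,y) \<in> set (dedges D)"
    then have "x \<in> halfedges D" using assms by blast
    then show "x \<in> \<Union>(comps D)" using sub by blast
  qed
  ultimately show ?thesis by (simp add: subdiag_def)
qed

lemma partition_on_card_cases:
  assumes "finite A" "A \<noteq> {}" "partition_on A P"
  shows "P = {A} \<or> card P \<ge> 2"
proof -
  have fin: "finite P" by (rule finite_elements[OF assms(1,3)])
  have "P \<noteq> {}" using assms by (auto simp: partition_on_def)
  then have "card P \<noteq> 0" using fin by simp
  moreover have "P = {A}" if c1: "card P = 1"
  proof -
    obtain B where "P = {B}" by (rule card_1_singletonE[OF c1])
    then show ?thesis using assms(3) by (auto simp: partition_on_def)
  qed
  ultimately show ?thesis by linarith
qed

lemma chord_inj: "inj chord"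
proof (rule injI)
  fix k l assume "chord k = chord l"
  then have "2*k+2 \<in> {2*l+2, 2*l+3}" by (auto simp: chord_def)
  then have "2*k+2 = 2*l+2 \<or> 2*k+2 = 2*l+3" by simp
  then show "k = l" by presburger
qed

lemma finite_J_chords: "finite (J_chords j)"
  by (simp add: J_chords_def)

lemma card_J_chords: "card (J_chords j) = j"
  unfolding J_chords_def using card_image[OF inj_on_subset[OF chord_inj]] by simp

lemma J_chords_Suc: "J_chords (Suc j) = insert (chord (Suc j)) (J_chords j)"
  by (auto simp: J_chords_def atLeastAtMostSuc_conv)

lemma chord_notin_J_chords: "chord (Suc j) \<notin> J_chords j"
  by (auto simp: J_chords_def dest: injD[OF chord_inj])

lemma J_core_chords_disjoint: "J_core i j \<inter> J_chords j' = {}"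
proof -
  have "0 \<in> Q \<or> 2 \<in> Q" if "Q \<in> J_core i j" for Q using that by (auto simp: J_core_def split: if_splits)
  moreover have "0 \<notin> C \<and> 2 \<notin> C" if "C \<in> J_chords j'" for C using that by (auto simp: J_chords_def chord_def)
  ultimately show ?thesis by blast
qed

lemma finite_J_core: "finite (J_core i j)"
  by (simp add: J_core_def)

section \<open>State sums of the parts of a splitting\<close>

definition J_base :: "nat \<Rightarrow> nat \<Rightarrow> nat set" where
  "J_base i j = {0,1,2,3} \<union> {2*j+4..<2*j+4+6*i}"

lemma Union_J_core: "\<Union>(J_core i j) = J_base i j"
  by (auto simp: J_core_def J_base_def)

lemma J_base_chords: "k \<le> j \<Longrightarrow> k \<ge> 1 \<Longrightarrow> 2*k+2 \<notin> J_base i j \<and> 2*k+3 \<notin> J_base i j"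
  by (auto simp: J_base_def)

lemma mem_Union_block:
  assumes "\<B> \<subseteq> comps D" "C \<in> comps D" "x \<in> C"
  shows "x \<in> \<Union>\<B> \<longleftrightarrow> C \<in> \<B>"
  using comps_partition[of C D] assms by blast

context simple_lie_form
begin

lemma wval_foldr_dmult:
  assumes "\<And>D. D \<in> set Ds \<Longrightarrow> wf_diag D" "sorted_wrt (\<lambda>D D'. halfedges D \<inter> halfedges D' = {}) Ds"
  shows "wval (foldr dmult Ds dunit) = prod_list (map wval Ds) \<and> wf_diag (foldr dmult Ds dunit)
    \<and> halfedges (foldr dmult Ds dunit) = (\<Union>D\<in>set Ds. halfedges D)"
  using assms
proof (induction Ds)
  case Nil
  then show ?case by (simp add: wval_dunit wf_diag_def) (simp add: dunit_def halfedges_def)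
next
  case (Cons D Ds)
  then have IH: "wval (foldr dmult Ds dunit) = prod_list (map wval Ds)" "wf_diag (foldr dmult Ds dunit)"
    "halfedges (foldr dmult Ds dunit) = (\<Union>D\<in>set Ds. halfedges D)"
    by auto
  have "halfedges D \<inter> halfedges (foldr dmult Ds dunit) = {}"
    unfolding IH(3) using Cons.prems by auto
  moreover have "wf_diag D" using Cons.prems by simp
  ultimately have "wval (dmult D (foldr dmult Ds dunit)) = wval D * prod_list (map wval Ds)"
    using wval_dmult IH by simp
  moreover have "wf_diag (dmult D (foldr dmult Ds dunit))"
    using \<open>wf_diag D\<close> IH(2) unfolding wf_diag_def halfedges_dmult by (auto simp: dmult_def)
  ultimately show ?case by (simp add: halfedges_dmult IH)
qed

lemma wf_subdiag:
  assumes "wf_diag D" "\<B> \<subseteq> comps D"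
  shows "wf_diag (subdiag D (\<Union>\<B>))"
  unfolding wf_diag_def halfedges_subdiag[OF assms(2)]
proof clarify
  fix x y assume "(x,y) \<in> set (dedges (subdiag D (\<Union>\<B>)))"
  then have xy: "(x,y) \<in> set (dedges D)" "x \<in> \<Union>\<B>" by (auto simp: subdiag_def)
  then have "(x,y) \<in> adj D" by (simp add: adj_def)
  then have "y \<in> \<Union>\<B>" using comps_closed xy(2) assms(2) by blast
  then show "x \<in> halfedges D \<inter> \<Union>\<B> \<and> y \<in> halfedges D \<inter> \<Union>\<B>" using xy assms(1) by (auto simp: wf_diag_def)
qed

text \<open>The order of the factors in \<open>split_prod\<close> is an unspecified choice, so only
  some enumeration of the parts is available and later evaluations must hold for any of
  them.\<close>

lemma wval_split_prod:
  assumes wf: "wf_diag D" and fin: "finite (comps D)" and P: "partition_on (comps D) P"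
  obtains ps where "distinct ps" "set ps = P" "wval (split_prod D P) = prod_list (map (\<lambda>B. wval (subdiag D (\<Union>B))) ps)"
proof -
  define ps where "ps = (SOME ps. distinct ps \<and> set ps = P)"
  have "finite P" by (rule finite_elements[OF fin P])
  then have "\<exists>ps. distinct ps \<and> set ps = P" using finite_distinct_list by blast
  then have ps: "distinct ps" "set ps = P" unfolding ps_def by (metis (mono_tags, lifting) someI_ex)+
  have sub: "B \<subseteq> comps D" if "B \<in> P" for B using P that by (auto simp: partition_on_def)
  let ?Ds = "map (\<lambda>B. subdiag D (\<Union>B)) ps"
  have "sorted_wrt (\<lambda>B B'. halfedges (subdiag D (\<Union>B)) \<inter> halfedges (subdiag D (\<Union>B')) = {}) ps"
  proof (rule sorted_wrt_distinctI[OF ps(1)])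
    fix B B' assume B: "B \<in> set ps" "B' \<in> set ps" "B \<noteq> B'"
    then have BP: "B \<in> P" "B' \<in> P" using ps by auto
    have "B \<inter> B' = {}" using P BP B(3) by (auto simp: partition_on_def disjoint_def)
    then have "\<Union>B \<inter> \<Union>B' = {}" using comps_partition[of _ D] sub[OF BP(1)] sub[OF BP(2)] by blast
    then show "halfedges (subdiag D (\<Union>B)) \<inter> halfedges (subdiag D (\<Union>B')) = {}"
      unfolding halfedges_subdiag[OF sub[OF BP(1)]] halfedges_subdiag[OF sub[OF BP(2)]] by blast
  qed
  then have "sorted_wrt (\<lambda>D D'. halfedges D \<inter> halfedges D' = {}) ?Ds" by (simp add: sorted_wrt_map)
  moreover have "wf_diag D'" if "D' \<in> set ?Ds" for D'
    using that wf_subdiag[OF wf] sub ps(2) by auto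
  ultimately have "wval (foldr dmult ?Ds dunit) = prod_list (map wval ?Ds)"
    using wval_foldr_dmult by blast
  then have "wval (split_prod D P) = prod_list (map (\<lambda>B. wval (subdiag D (\<Union>B))) ps)"
    by (simp add: split_prod_def ps_def[symmetric] o_def)
  then show thesis using that ps by blast
qed

text \<open>One sum over all splittings: the splitting into a single part has coefficient 1 and
  contributes the diagram itself.\<close>

definition wval_prim :: "diagram \<Rightarrow> fa" where
  "wval_prim D = (\<Sum>P | partition_on (comps D) P. scl (pi_coeff (card P)) (wval (split_prod D P)))"

lemma coef_wval_prim:
  assumes wf: "wf_diag D" and fin: "finite (comps D)" and ne: "comps D \<noteq> {}"
  shows "coef (wval_prim D) = wbar m c lam D"
proof
  fix w
  let ?A = "comps D"
  let ?S = "{P. partition_on ?A P \<and> card P \<ge> 2}"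
  have one: "partition_on ?A {?A}" using ne by (auto simp: partition_on_def)
  then have "{P. partition_on ?A P} = insert {?A} ?S"
    using partition_on_card_cases[OF fin ne] by auto
  moreover have "finite ?S" using finite_partitions[OF fin] by (rule finite_subset[rotated]) auto
  moreover have "{?A} \<notin> ?S" by simp
  ultimately have "coef (wval_prim D) w = pi_coeff 1 * wsys m c lam (split_prod D {?A}) w
      + (\<Sum>P\<in>?S. pi_coeff (card P) * wsys m c lam (split_prod D P) w)"
    by (simp add: wval_prim_def plus_fa.rep_eq coef_sum_apply scl.rep_eq coef_wval)
  also have "(\<Sum>P\<in>?S. pi_coeff (card P) * wsys m c lam (split_prod D P) w)
      = - (\<Sum>P\<in>?S. (-1) ^ card P * of_nat (fact (card P - 1)) * wsys m c lam (split_prod D P) w)"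
    unfolding sum_negf[symmetric] by (simp add: pi_coeff_def)
  also have "wsys m c lam (split_prod D {?A}) = wsys m c lam D"
  proof -
    obtain ps where ps: "distinct ps" "set ps = {?A}"
      "wval (split_prod D {?A}) = prod_list (map (\<lambda>B. wval (subdiag D (\<Union>B))) ps)"
      by (rule wval_split_prod[OF wf fin one])
    have "length ps = 1" using distinct_card[OF ps(1)] ps(2) by simp
    then obtain B where "ps = [B]" by (auto simp: length_Suc_conv)
    then have "ps = [?A]" using ps(2) by simp
    moreover have "subdiag D (\<Union>?A) = D" using wf by (intro subdiag_comps_id) (auto simp: wf_diag_def)
    ultimately have "wval (split_prod D {?A}) = wval D" using ps(3) by simp
    then show ?thesis by (metis coef_wval)
  qed
  finally show "coef (wval_prim D) w = wbar m c lam D w" by (simp add: wbar_def pi_coeff_def)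
qed

lemma wf_J: "wf_diag (Jdiag i j)"
  unfolding wf_diag_def
proof clarify
  fix x y assume "(x,y) \<in> set (dedges (Jdiag i j))"
  then consider "(x,y) \<in> set (J_edges (2*j+4) i)" | k where "k \<in> {1..j}" "x = 2*k+2" "y = 2*k+3"
    unfolding Jdiag_fields by auto
  then show "x \<in> halfedges (Jdiag i j) \<and> y \<in> halfedges (Jdiag i j)"
  proof cases
    case 1
    from J_edges_core[OF this] show ?thesis unfolding halfedges_J by blast
  next
    case 2
    then show ?thesis unfolding halfedges_J by (auto simp: J_chords_def chord_def)
  qed
qed

lemma ew_append: "ew (xs @ ys) f = ew xs f * ew ys f"
  by (simp add: ew_def)

text \<open>Filtering the loop keeps the surviving chords nested around whatever remains of p2 and
  p3, so \<open>chord_sum\<close> applies to every union of components, with or without the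
  core.\<close>

lemma wval_block:
  assumes B: "\<B> \<subseteq> comps (Jdiag i j)"
  defines "U \<equiv> \<Union>\<B>" and "s \<equiv> 2*j+4"
  defines "es \<equiv> filter (\<lambda>(a,_). a \<in> U) (J_edges s i)" and "vs \<equiv> filter (\<lambda>(a,_,_). a \<in> U) (J_verts s i)"
  shows "wval (subdiag (Jdiag i j) U) = (\<Sum>f\<in>(J_base i j \<inter> U) \<rightarrow>\<^sub>E {..<m}. scl (ew es f * vw vs f)
      (word (map f (filter (\<lambda>h. h \<in> U) [0])) *
       (Phi ^^ card (J_chords j \<inter> \<B>)) (word (map f (filter (\<lambda>h. h \<in> U) [1,2]))) *
       word (map f (filter (\<lambda>h. h \<in> U) [3]))))"
proof -
  let ?D = "Jdiag i j" and ?a = "\<lambda>k::nat. 2*k+2" and ?b = "\<lambda>k::nat. 2*k+3"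
  let ?l1 = "filter (\<lambda>h. h \<in> U) [0]" and ?l2 = "filter (\<lambda>h. h \<in> U) [1,2]" and ?l3 = "filter (\<lambda>h. h \<in> U) [3]"
  define T where "T = filter (\<lambda>k. 2*k+2 \<in> U) [1..<j+1]"
  let ?H = "J_base i j \<inter> U"
  have adjU: "x \<in> U \<longleftrightarrow> y \<in> U" if "(x,y) \<in> adj ?D" for x y
  proof -
    have "y \<in> C \<Longrightarrow> x \<in> C" if "C \<in> comps ?D" for C
      using that \<open>(x,y) \<in> adj ?D\<close> by (auto simp: comps_def quotient_def intro: rtrancl_into_rtrancl)
    then show ?thesis using comps_closed[OF _ that] B unfolding U_def by blast
  qed
  have chU: "2*k+2 \<in> U \<longleftrightarrow> chord k \<in> \<B>" "2*k+3 \<in> U \<longleftrightarrow> chord k \<in> \<B>" if "k \<in> {1..j}" for k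
  proof -
    have "chord k \<in> comps ?D" using that by (auto simp: comps_J J_chords_def)
    then show "2*k+2 \<in> U \<longleftrightarrow> chord k \<in> \<B>" "2*k+3 \<in> U \<longleftrightarrow> chord k \<in> \<B>"
      unfolding U_def by (rule mem_Union_block[OF B], simp add: chord_def)+
  qed
  have setT: "set T = {k \<in> {1..j}. chord k \<in> \<B>}" unfolding T_def using chU by auto
  have lenT: "length T = card (J_chords j \<inter> \<B>)"
  proof -
    have "distinct T" by (simp add: T_def)
    then have "length T = card (set T)" by (simp add: distinct_card)
    also have "\<dots> = card (chord ` set T)" by (rule card_image[OF inj_on_subset[OF chord_inj subset_UNIV], symmetric])
    also have "chord ` set T = J_chords j \<inter> \<B>" unfolding setT J_chords_def by auto
    finally show ?thesis .
  qed
  have f1: "filter (\<lambda>h. h \<in> U) (map ?a [1..<j+1]) = map ?a T"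
    by (simp add: T_def filter_map o_def)
  have f2: "filter (\<lambda>h. h \<in> U) (rev (map ?b [1..<j+1])) = rev (map ?b T)"
  proof -
    have "filter (\<lambda>k. 2*k+3 \<in> U) [1..<j+1] = T"
      unfolding T_def using chU by (intro filter_cong) auto
    then show ?thesis by (simp only: rev_filter[symmetric] filter_map o_def)
  qed
  have f3: "filter (\<lambda>(a,_). a \<in> U) (map (\<lambda>k. (?a k, ?b k)) [1..<j+1]) = map (\<lambda>k. (?a k, ?b k)) T"
    by (simp add: T_def filter_map o_def)
  have loop: "dloop (subdiag ?D U) = ?l1 @ map ?a T @ ?l2 @ rev (map ?b T) @ ?l3"
    unfolding subdiag_def Jdiag_fields diagram.select_convs filter_append f1 f2 ..
  have verts: "dverts (subdiag ?D U) = vs"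
    unfolding subdiag_def Jdiag_fields diagram.select_convs vs_def s_def ..
  have edges: "dedges (subdiag ?D U) = es @ map (\<lambda>k. (?a k, ?b k)) T"
    unfolding subdiag_def Jdiag_fields diagram.select_convs filter_append f3 es_def s_def ..
  have half: "halfedges (subdiag ?D U) = ?H \<union> (?a ` set T \<union> ?b ` set T)"
  proof -
    have "\<Union>(J_chords j) \<inter> U = ?a ` set T \<union> ?b ` set T"
      unfolding setT J_chords_def using chU by (auto simp: chord_def)
    then show ?thesis
      unfolding U_def halfedges_subdiag[OF B] unfolding U_def[symmetric] halfedges_J J_base_def by blast
  qed
  have dep: "depends_on ?H (\<lambda>f. ew es f * vw vs f)"
    unfolding depends_on_def
  proof (intro allI impI)
    fix f h :: "nat \<Rightarrow> nat" assume eq: "\<forall>x\<in>?H. f x = h x"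
    have "\<forall>(x,y)\<in>set es. x \<in> ?H \<and> y \<in> ?H"
    proof clarify
      fix x y assume "(x,y) \<in> set es"
      then have xy: "(x,y) \<in> set (J_edges s i)" "x \<in> U" by (auto simp: es_def)
      have "(x,y) \<in> adj ?D" using xy(1) unfolding adj_def Jdiag_fields s_def by simp
      then show "x \<in> ?H \<and> y \<in> ?H" using xy adjU J_edges_core[OF xy(1)] by (auto simp: J_base_def s_def)
    qed
    then have 1: "ew es f = ew es h" using eq by (intro ew_cong[of ?H]) auto
    have "\<forall>(a,b,d)\<in>set vs. a \<in> ?H \<and> b \<in> ?H \<and> d \<in> ?H"
    proof clarify
      fix a b d assume "(a,b,d) \<in> set vs"
      then have abd: "(a,b,d) \<in> set (J_verts s i)" "a \<in> U" by (auto simp: vs_def)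
      have "(a,b) \<in> adj ?D" "(b,d) \<in> adj ?D"
        using abd(1) unfolding adj_def Jdiag_fields s_def by force+
      then have "b \<in> U" "d \<in> U" using abd(2) adjU by blast+
      moreover have "{a,b,d} \<subseteq> J_base i j" using J_verts_core[OF abd(1)] by (auto simp: J_base_def s_def)
      ultimately show "a \<in> ?H \<and> b \<in> ?H \<and> d \<in> ?H" using abd(2) by simp
    qed
    then have 2: "vw vs f = vw vs h" using eq by (intro vw_cong[of ?H]) auto
    show "ew es f * vw vs f = ew es h * vw vs h" by (simp only: 1 2)
  qed
  have "wval (subdiag ?D U) = (\<Sum>f\<in>(?H \<union> (?a ` set T \<union> ?b ` set T)) \<rightarrow>\<^sub>E {..<m}.
      scl ((ew es f * vw vs f) * (\<Prod>k\<leftarrow>T. g (f (?b k)) (f (?a k)))) (word (map f (?l1 @ map ?a T @ ?l2 @ rev (map ?b T) @ ?l3))))"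
    unfolding wval_def half loop verts edges ew_append
    by (intro sum.cong refl) (simp add: ew_def[of "map _ _"] o_def mult_ac)
  also have "\<dots> = (\<Sum>f\<in>?H \<rightarrow>\<^sub>E {..<m}. scl (ew es f * vw vs f)
      (word (map f ?l1) * (Phi ^^ length T) (word (map f ?l2)) * word (map f ?l3)))"
  proof (rule chord_sum[OF dep])
    show "set ?l1 \<subseteq> ?H" "set ?l2 \<subseteq> ?H" "set ?l3 \<subseteq> ?H" by (auto simp: J_base_def)
    show "distinct T" by (simp add: T_def)
    show "inj_on ?a (set T)" "inj_on ?b (set T)" by (auto simp: inj_on_def)
    show "?a ` set T \<inter> ?b ` set T = {}" by (auto, presburger)
    show "?H \<inter> (?a ` set T \<union> ?b ` set T) = {}" using J_base_chords[of _ j i] by (auto simp: setT)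
  qed
  finally show ?thesis unfolding lenT .
qed

lemma J_core_comps: "J_core i j \<subseteq> comps (Jdiag i j)"
  by (simp add: comps_J)

lemma wval_block_chords:
  assumes B: "\<B> \<subseteq> comps (Jdiag i j)" and disj: "\<B> \<inter> J_core i j = {}"
  shows "wval (subdiag (Jdiag i j) (\<Union>\<B>)) \<approx> Cas ^ card (J_chords j \<inter> \<B>)"
proof -
  have notin: "x \<notin> \<Union>\<B>" if "x \<in> J_base i j" for x
  proof -
    have "x \<in> \<Union>(J_core i j)" using that by (simp only: Union_J_core)
    then obtain Q where Q: "Q \<in> J_core i j" "x \<in> Q" by blast
    then have "Q \<in> comps (Jdiag i j)" "Q \<notin> \<B>" using J_core_comps disj by blast+
    then show ?thesis using mem_Union_block[OF B _ Q(2)] by blast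
  qed
  then have "J_base i j \<inter> \<Union>\<B> = {}" "0 \<notin> \<Union>\<B>" "1 \<notin> \<Union>\<B>" "2 \<notin> \<Union>\<B>" "3 \<notin> \<Union>\<B>"
    by (auto simp: J_base_def)
  moreover have "filter (\<lambda>(a,_). a \<in> \<Union>\<B>) (J_edges (2*j+4) i) = []"
  proof (intro filter_False ballI)
    fix e assume e: "e \<in> set (J_edges (2*j+4) i)"
    obtain x y where xy: "e = (x,y)" by (cases e)
    have "x \<in> J_base i j" using J_edges_core[OF e[unfolded xy]] unfolding J_base_def by blast
    from notin[OF this] show "\<not> (case e of (a,_) \<Rightarrow> a \<in> \<Union>\<B>)" unfolding xy prod.case .
  qed
  moreover have "filter (\<lambda>(a,_,_). a \<in> \<Union>\<B>) (J_verts (2*j+4) i) = []"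
  proof (intro filter_False ballI)
    fix v assume v: "v \<in> set (J_verts (2*j+4) i)"
    obtain a b d where abd: "v = (a,b,d)" by (cases v)
    have "a \<in> J_base i j" using J_verts_core[OF v[unfolded abd]] unfolding J_base_def by blast
    from notin[OF this] show "\<not> (case v of (a,_,_) \<Rightarrow> a \<in> \<Union>\<B>)" unfolding abd prod.case .
  qed
  ultimately have "wval (subdiag (Jdiag i j) (\<Union>\<B>)) = (Phi ^^ card (J_chords j \<inter> \<B>)) 1"
    unfolding wval_block[OF B] by (simp only: filter.simps if_False list.map) (simp add: ew_def vw_def word_Nil)
  then show ?thesis using funpow_Phi_one by simp
qed

lemma vw_J_verts: "vw (J_verts s i) f = (\<Prod>k<i. t (f (s + 6*k)) (f (s + 6*k + 1)) (f (s + 6*k + 2)) *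
     t (f (s + 6*k + 3)) (f (s + 6*k + 4)) (f (s + 6*k + 5)))"
  by (induction i) (simp_all add: J_verts_def vw_def mult_ac)

text \<open>Regroups the edge factors rung by rung. Some edges are listed in the opposite direction;
  the labelling takes values below \<open>m\<close>, where \<open>g\<close> is known to be
  symmetric.\<close>

lemma J_weight:
  assumes f: "f \<in> ({0,1,2,3} \<union> {s..<s+6*i}) \<rightarrow>\<^sub>E {..<m}"
  shows "ew (J_edges s i) f * vw (J_verts s i) f = ladder_weight s i f"
proof (cases i)
  case 0
  have "f 0 < m" "f 1 < m" using PiE_mem[OF f, of 0] PiE_mem[OF f, of 1] by simp_all
  then show ?thesis
    using g_sym[of "f 1" "f 0"] by (simp add: 0 ew_def vw_def J_edges_def J_verts_def ladder_weight_def port1_def port2_def)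
next
  case (Suc n)
  let ?t = "\<lambda>k. t (f (s + 6*k)) (f (s + 6*k + 1)) (f (s + 6*k + 2)) * t (f (s + 6*k + 3)) (f (s + 6*k + 4)) (f (s + 6*k + 5))"
  let ?r = "\<lambda>k. g (f (s + 6*k + 4)) (f (s + 6*k + 2))"
  let ?p = "\<lambda>k. g (f (s + 6*k + 1)) (f (port1 s k))" and ?q = "\<lambda>k. g (f (s + 6*k + 5)) (f (port2 s k))"
  have lt: "f x < m" if "x \<in> {0,1,2,3} \<union> {s..<s+6*i}" for x using PiE_mem[OF f that] by simp
  have "ew (J_edges s i) f = (\<Prod>k<i. ?r k) * ((\<Prod>k<n. ?p (Suc k)) * ((\<Prod>k<n. ?q (Suc k)) *
     (g (f 1) (f (s+1)) * (g (f 2) (f (s+5)) * (g (f 0) (f (s+6*n)) * g (f 3) (f (s+6*n+3)))))))"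
    using Suc by (simp add: J_edges_def ew_append) (simp add: ew_def o_def prod_list_upt port1_def port2_def)
  also have "g (f 1) (f (s+1)) = ?p 0" using lt Suc by (subst g_sym) (auto simp: port1_def)
  also have "g (f 2) (f (s+5)) = ?q 0" using lt Suc by (subst g_sym) (auto simp: port2_def)
  finally have e: "ew (J_edges s i) f = (\<Prod>k<i. ?r k) * ((\<Prod>k<n. ?p (Suc k)) * ((\<Prod>k<n. ?q (Suc k)) *
     (?p 0 * (?q 0 * (g (f 0) (f (s+6*n)) * g (f 3) (f (s+6*n+3)))))))" .
  have p: "(\<Prod>k<i. ?p k) = ?p 0 * (\<Prod>k<n. ?p (Suc k))" unfolding Suc by (rule prod.lessThan_Suc_shift)
  have q: "(\<Prod>k<i. ?q k) = ?q 0 * (\<Prod>k<n. ?q (Suc k))" unfolding Suc by (rule prod.lessThan_Suc_shift)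
  have "(\<Prod>k<i. rung_weight s k f) = (\<Prod>k<i. ?t k) * (\<Prod>k<i. ?r k) * (\<Prod>k<i. ?p k) * (\<Prod>k<i. ?q k)"
    by (simp add: rung_weight_def prod.distrib)
  then have "ladder_weight s i f = (\<Prod>k<i. ?t k) * (\<Prod>k<i. ?r k) * (?p 0 * (\<Prod>k<n. ?p (Suc k))) * (?q 0 * (\<Prod>k<n. ?q (Suc k)))
      * (g (f 0) (f (s+6*n)) * g (f 3) (f (s+6*n+3)))"
    unfolding ladder_weight_def p q by (simp add: Suc port1_def port2_def)
  then show ?thesis unfolding e vw_J_verts by (simp only: mult_ac)
qed

lemma wval_block_core:
  assumes B: "\<B> \<subseteq> comps (Jdiag i j)" and core: "J_core i j \<subseteq> \<B>"
  shows "wval (subdiag (Jdiag i j) (\<Union>\<B>)) = ladder_val i (card (J_chords j \<inter> \<B>))"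
proof -
  have sub: "J_base i j \<subseteq> \<Union>\<B>" unfolding Union_J_core[symmetric] using core by (rule Union_mono)
  then have "0 \<in> \<Union>\<B>" "1 \<in> \<Union>\<B>" "2 \<in> \<Union>\<B>" "3 \<in> \<Union>\<B>" unfolding J_base_def by blast+
  then have l: "filter (\<lambda>h. h \<in> \<Union>\<B>) [0] = [0]" "filter (\<lambda>h. h \<in> \<Union>\<B>) [1,2] = [1,2]" "filter (\<lambda>h. h \<in> \<Union>\<B>) [3] = [3]"
    by (simp_all only: filter.simps if_True)
  have base: "J_base i j \<inter> \<Union>\<B> = {0,1,2,3} \<union> {2*j+4..<2*j+4+6*i}" using sub unfolding J_base_def by blast
  have es: "filter (\<lambda>(a,_). a \<in> \<Union>\<B>) (J_edges (2*j+4) i) = J_edges (2*j+4) i"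
  proof (rule filter_True, clarify)
    fix x y assume "(x,y) \<in> set (J_edges (2*j+4) i)"
    from J_edges_core[OF this] show "x \<in> \<Union>\<B>" using sub unfolding J_base_def by blast
  qed
  have vs: "filter (\<lambda>(a,_,_). a \<in> \<Union>\<B>) (J_verts (2*j+4) i) = J_verts (2*j+4) i"
  proof (rule filter_True, clarify)
    fix a b d assume "(a,b,d) \<in> set (J_verts (2*j+4) i)"
    from J_verts_core[OF this] show "a \<in> \<Union>\<B>" using sub unfolding J_base_def by blast
  qed
  have w2: "word [x,y] = E x * E y" for x y using word_append[of "[x]" "[y]"] by simp
  have "wval (subdiag (Jdiag i j) (\<Union>\<B>)) = (\<Sum>f\<in>({0,1,2,3} \<union> {2*j+4..<2*j+4+6*i}) \<rightarrow>\<^sub>E {..<m}.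
      scl (ladder_weight (2*j+4) i f) (E (f 0) * (Phi ^^ card (J_chords j \<inter> \<B>)) (E (f 1) * E (f 2)) * E (f 3)))"
    unfolding wval_block[OF B] l base es vs
    by (intro sum.cong refl) (simp only: J_weight list.map w2)
  also have "\<dots> = ladder_val i (card (J_chords j \<inter> \<B>))" by (rule ladder_core_sum) simp
  finally show ?thesis .
qed

lemma wval_block_one_sided:
  assumes B: "\<B> \<subseteq> comps (Jdiag 0 j)" and one: "({0,1} \<in> \<B>) \<noteq> ({2,3} \<in> \<B>)"
  shows "wval (subdiag (Jdiag 0 j) (\<Union>\<B>)) \<approx> Cas_shift ^ card (J_chords j \<inter> \<B>) * Cas"
proof -
  let ?n = "card (J_chords j \<inter> \<B>)"
  have c: "{0,1} \<in> comps (Jdiag 0 j)" "{2,3} \<in> comps (Jdiag 0 j)" by (auto simp: comps_J J_core_def)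
  have U: "0 \<in> \<Union>\<B> \<longleftrightarrow> {0,1} \<in> \<B>" "1 \<in> \<Union>\<B> \<longleftrightarrow> {0,1} \<in> \<B>" "2 \<in> \<Union>\<B> \<longleftrightarrow> {2,3} \<in> \<B>" "3 \<in> \<Union>\<B> \<longleftrightarrow> {2,3} \<in> \<B>"
    by (rule mem_Union_block[OF B c(1)], simp, rule mem_Union_block[OF B c(1)], simp,
        rule mem_Union_block[OF B c(2)], simp, rule mem_Union_block[OF B c(2)], simp)
  have vs: "J_verts (2*j+4) 0 = []" and es: "J_edges (2*j+4) 0 = [(0,1),(2,3)]" by (auto simp: J_verts_def J_edges_def)
  show ?thesis
  proof (cases "{0,1} \<in> \<B>")
    case True
    then have "{2,3} \<notin> \<B>" using one by simp
    then have "J_base 0 j \<inter> \<Union>\<B> = {0,1}" using True U by (auto simp: J_base_def)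
    then have "wval (subdiag (Jdiag 0 j) (\<Union>\<B>)) = (\<Sum>f\<in>{0,1::nat} \<rightarrow>\<^sub>E {..<m}. scl (g (f 1) (f 0)) (E (f 0) * (Phi ^^ ?n) (E (f 1))))"
      unfolding wval_block[OF B] es vs using True \<open>{2,3} \<notin> \<B>\<close>
      by (simp only: filter.simps U if_True if_False prod.case list.map) (simp add: ew_def vw_def word_Nil)
    also have "\<dots> = (\<Sum>x<m. \<Sum>y<m. scl (g y x) (E x * (Phi ^^ ?n) (E y)))" by (simp add: sum_PiE_insert)
    finally show ?thesis using one_sided_left by simp
  next
    case False
    then have T: "{2,3} \<in> \<B>" using one by simp
    then have "J_base 0 j \<inter> \<Union>\<B> = {2,3}" using False U by (auto simp: J_base_def)
    then have "wval (subdiag (Jdiag 0 j) (\<Union>\<B>)) = (\<Sum>f\<in>{2,3::nat} \<rightarrow>\<^sub>E {..<m}. scl (g (f 3) (f 2)) ((Phi ^^ ?n) (E (f 2)) * E (f 3)))"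
      unfolding wval_block[OF B] es vs using False T
      by (simp only: filter.simps U if_True if_False prod.case list.map) (simp add: ew_def vw_def word_Nil)
    also have "\<dots> = (\<Sum>x<m. \<Sum>y<m. scl (g y x) ((Phi ^^ ?n) (E x) * E y))" by (simp add: sum_PiE_insert)
    finally show ?thesis using one_sided_right by simp
  qed
qed

lemma comm_Cas_power:
  assumes "comm_Cas x"
  shows "x * Cas ^ n \<approx> Cas ^ n * x"
proof (induction n)
  case (Suc n)
  have "x * Cas ^ Suc n = (x * Cas) * Cas ^ n" by (simp add: mult.assoc)
  also have "\<dots> \<approx> (Cas * x) * Cas ^ n" by (intro ucong_mult ucong_refl assms[unfolded comm_Cas_def])
  also have "\<dots> = Cas * (x * Cas ^ n)" by (simp add: mult.assoc)
  also have "\<dots> \<approx> Cas * (Cas ^ n * x)" by (intro ucong_mult ucong_refl Suc)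
  finally show ?case by (simp add: mult.assoc)
qed simp

lemma prod_list_Cas:
  assumes "distinct ps" "\<And>B. B \<in> set ps \<Longrightarrow> w B \<approx> Cas ^ n B"
  shows "prod_list (map w ps) \<approx> Cas ^ (\<Sum>B\<in>set ps. n B)"
  using assms
proof (induction ps)
  case (Cons B ps)
  then have "w B * prod_list (map w ps) \<approx> Cas ^ n B * Cas ^ (\<Sum>B\<in>set ps. n B)"
    by (intro ucong_mult) auto
  then show ?case using Cons.prems by (simp add: power_add)
qed simp

text \<open>The distinguished factor may stand anywhere in the list; as it commutes with
  \<open>Cas\<close>, it can be moved to the end.\<close>

lemma prod_list_Cas_except:
  assumes "distinct ps" "L \<in> set ps" "comm_Cas (w L)" "\<And>B. B \<in> set ps - {L} \<Longrightarrow> w B \<approx> Cas ^ n B"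
  shows "prod_list (map w ps) \<approx> Cas ^ (\<Sum>B\<in>set ps - {L}. n B) * w L"
  using assms
proof (induction ps)
  case (Cons B ps)
  show ?case
  proof (cases "B = L")
    case True
    then have set: "set (B # ps) - {L} = set ps" using Cons.prems(1) by auto
    have "prod_list (map w ps) \<approx> Cas ^ (\<Sum>B\<in>set ps. n B)"
      using Cons.prems(1,4) True by (intro prod_list_Cas) auto
    then have "w L * prod_list (map w ps) \<approx> w L * Cas ^ (\<Sum>B\<in>set ps. n B)" by (intro ucong_mult ucong_refl)
    also have "\<dots> \<approx> Cas ^ (\<Sum>B\<in>set ps. n B) * w L" by (rule comm_Cas_power[OF Cons.prems(3)])
    finally show ?thesis unfolding set using True by simp
  next
    case False
    then have set: "set (B # ps) - {L} = insert B (set ps - {L})" "B \<notin> set ps - {L}" using Cons.prems(1) by auto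
    have "prod_list (map w ps) \<approx> Cas ^ (\<Sum>B\<in>set ps - {L}. n B) * w L"
      using Cons.prems False by (intro Cons.IH) auto
    moreover have "w B \<approx> Cas ^ n B" using Cons.prems(4)[of B] False by simp
    ultimately have "w B * prod_list (map w ps) \<approx> Cas ^ n B * (Cas ^ (\<Sum>B\<in>set ps - {L}. n B) * w L)"
      by (intro ucong_mult)
    then show ?thesis using set by (simp add: power_add mult.assoc)
  qed
qed simp

lemma prod_list_Cas_shift_Cas:
  assumes "distinct ps" "\<And>B. B \<in> set ps \<Longrightarrow> w B \<approx> Cas_shift ^ p B * Cas ^ r B"
  shows "prod_list (map w ps) \<approx> Cas_shift ^ (\<Sum>B\<in>set ps. p B) * Cas ^ (\<Sum>B\<in>set ps. r B)"
  using assms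
proof (induction ps)
  case (Cons B ps)
  let ?p = "\<Sum>B\<in>set ps. p B" and ?r = "\<Sum>B\<in>set ps. r B"
  have "w B * prod_list (map w ps) \<approx> (Cas_shift ^ p B * Cas ^ r B) * (Cas_shift ^ ?p * Cas ^ ?r)"
    using Cons by (intro ucong_mult) auto
  also have "\<dots> = Cas_shift ^ p B * (Cas ^ r B * Cas_shift ^ ?p) * Cas ^ ?r" by (simp add: mult.assoc)
  also have "Cas ^ r B * Cas_shift ^ ?p = Cas_shift ^ ?p * Cas ^ r B"
    by (rule power_commuting_commutes) (rule power_commuting_commutes[OF Cas_shift_Cas_commute, symmetric])
  also have "Cas_shift ^ p B * (Cas_shift ^ ?p * Cas ^ r B) * Cas ^ ?r = Cas_shift ^ (p B + ?p) * Cas ^ (r B + ?r)"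
    by (simp add: power_add mult.assoc)
  finally show ?case using Cons.prems by simp
qed simp

lemma sum_card_partition:
  assumes "partition_on A P" "finite A" "C \<subseteq> A" "S \<subseteq> P"
  shows "(\<Sum>B\<in>P - S. card (C \<inter> B)) = card (C - \<Union>S)"
proof -
  have fin: "finite (P - S)" using finite_elements[OF assms(2,1)] by simp
  have dis: "B \<inter> B' = {}" if "B \<in> P" "B' \<in> P" "B \<noteq> B'" for B B'
    using assms(1) that by (auto simp: partition_on_def disjoint_def)
  have "C - \<Union>S = (\<Union>B\<in>P - S. C \<inter> B)"
  proof (intro equalityI subsetI)
    fix x assume x: "x \<in> C - \<Union>S"
    then obtain B where "B \<in> P" "x \<in> B" using assms(1,3) by (auto simp: partition_on_def)
    then show "x \<in> (\<Union>B\<in>P - S. C \<inter> B)" using x by blast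
  next
    fix x assume "x \<in> (\<Union>B\<in>P - S. C \<inter> B)"
    then obtain B where B: "B \<in> P" "B \<notin> S" "x \<in> C" "x \<in> B" by blast
    have "x \<notin> B'" if "B' \<in> S" for B' using dis[of B B'] B that assms(4) by blast
    then show "x \<in> C - \<Union>S" using B by blast
  qed
  moreover have "card (\<Union>B\<in>P - S. C \<inter> B) = (\<Sum>B\<in>P - S. card (C \<inter> B))"
  proof (rule card_UN_disjoint[OF fin])
    show "\<forall>B\<in>P - S. finite (C \<inter> B)" using assms(2,3) by (auto intro: finite_subset)
    show "\<forall>B\<in>P - S. \<forall>B'\<in>P - S. B \<noteq> B' \<longrightarrow> (C \<inter> B) \<inter> (C \<inter> B') = {}" using dis by blast
  qed
  ultimately show ?thesis by simp
qed

section \<open>Values of splittings and the recursion for the primitive part\<close>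

lemma finite_comps_J: "finite (comps (Jdiag i j))"
  by (simp add: comps_J finite_J_core finite_J_chords)

lemma wval_split_together:
  assumes P: "partition_on (comps (Jdiag i j)) P" and L: "L \<in> P" "J_core i j \<subseteq> L"
  shows "wval (split_prod (Jdiag i j) P) \<approx> Cas ^ card (J_chords j - L) * ladder_val i (card (J_chords j \<inter> L))"
proof -
  let ?D = "Jdiag i j" and ?C = "J_chords j"
  let ?w = "\<lambda>B. wval (subdiag ?D (\<Union>B))"
  obtain ps where ps: "distinct ps" "set ps = P" "wval (split_prod ?D P) = prod_list (map ?w ps)"
    by (rule wval_split_prod[OF wf_J finite_comps_J P])
  have sub: "B \<subseteq> comps ?D" if "B \<in> P" for B using P that by (auto simp: partition_on_def)
  have wL: "?w L = ladder_val i (card (?C \<inter> L))" by (rule wval_block_core[OF sub[OF L(1)] L(2)])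
  have others: "?w B \<approx> Cas ^ card (?C \<inter> B)" if "B \<in> P - {L}" for B
  proof (rule wval_block_chords)
    show "B \<subseteq> comps ?D" using that sub by simp
    have "B \<inter> L = {}" using P that L(1) by (auto simp: partition_on_def disjoint_def)
    then show "B \<inter> J_core i j = {}" using L(2) by blast
  qed
  have "prod_list (map ?w ps) \<approx> Cas ^ (\<Sum>B\<in>set ps - {L}. card (?C \<inter> B)) * ?w L"
    using others L(1) wL comm_Cas_ladder_val ps(2) by (intro prod_list_Cas_except[OF ps(1)]) auto
  moreover have "(\<Sum>B\<in>P - {L}. card (?C \<inter> B)) = card (?C - L)"
    using sum_card_partition[OF P finite_comps_J, of ?C "{L}"] L(1) by (simp add: comps_J)
  ultimately show ?thesis unfolding ps(2,3) wL by simp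
qed

lemma wval_split_apart:
  assumes P: "partition_on (comps (Jdiag 0 j)) P"
    and L: "L \<in> P" "{0,1} \<in> L" and M: "M \<in> P" "{2,3} \<in> M" and "L \<noteq> M"
  shows "wval (split_prod (Jdiag 0 j) P)
    \<approx> Cas_shift ^ card (J_chords j \<inter> (L \<union> M)) * Cas ^ (card (J_chords j - (L \<union> M)) + 2)"
proof -
  let ?D = "Jdiag 0 j" and ?C = "J_chords j"
  let ?w = "\<lambda>B. wval (subdiag ?D (\<Union>B))"
  obtain ps where ps: "distinct ps" "set ps = P" "wval (split_prod ?D P) = prod_list (map ?w ps)"
    by (rule wval_split_prod[OF wf_J finite_comps_J P])
  have sub: "B \<subseteq> comps ?D" if "B \<in> P" for B using P that by (auto simp: partition_on_def)
  have dis: "B \<inter> B' = {}" if "B \<in> P" "B' \<in> P" "B \<noteq> B'" for B B'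
    using P that by (auto simp: partition_on_def disjoint_def)
  have LM: "L \<inter> M = {}" using dis L M \<open>L \<noteq> M\<close> by blast
  \<comment> \<open>The two parts with a core chord carry one \<open>Cas\<close> for that chord and
    one \<open>Cas_shift\<close> for each chord crossing it; all other parts carry only
    \<open>Cas\<close>.\<close>
  define p where "p B = (if B \<in> {L,M} then card (?C \<inter> B) else 0)" for B
  define r where "r B = (if B \<in> {L,M} then 1 else card (?C \<inter> B))" for B
  have "?w B \<approx> Cas_shift ^ p B * Cas ^ r B" if B: "B \<in> P" for B
  proof (cases "B \<in> {L,M}")
    case True
    have "({0,1} \<in> B) \<noteq> ({2,3} \<in> B)" using True L M LM by blast
    from wval_block_one_sided[OF sub[OF B] this] show ?thesis using True by (simp add: p_def r_def)
  next
    case False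
    have "B \<inter> L = {}" "B \<inter> M = {}" using dis B L(1) M(1) False by blast+
    then have "B \<inter> J_core 0 j = {}" using L M by (auto simp: J_core_def)
    from wval_block_chords[OF sub[OF B] this] show ?thesis using False by (simp add: p_def r_def)
  qed
  then have "prod_list (map ?w ps) \<approx> Cas_shift ^ (\<Sum>B\<in>P. p B) * Cas ^ (\<Sum>B\<in>P. r B)"
    using prod_list_Cas_shift_Cas[OF ps(1), of ?w p r] unfolding ps(2) by blast
  moreover have split: "(\<Sum>B\<in>P. h B) = (\<Sum>B\<in>P - {L,M}. h B) + (\<Sum>B\<in>{L,M}. h B)" for h :: "nat set set \<Rightarrow> nat"
    by (rule sum.subset_diff[OF _ finite_elements[OF finite_comps_J P]]) (use L M in blast)
  have "(\<Sum>B\<in>P. p B) = card (?C \<inter> (L \<union> M))"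
  proof -
    have "(\<Sum>B\<in>P - {L,M}. p B) = 0" by (intro sum.neutral) (simp add: p_def)
    moreover have "(\<Sum>B\<in>{L,M}. p B) = card (?C \<inter> L) + card (?C \<inter> M)" using \<open>L \<noteq> M\<close> by (simp add: p_def)
    moreover have "card (?C \<inter> (L \<union> M)) = card (?C \<inter> L) + card (?C \<inter> M)"
      unfolding Int_Un_distrib using LM finite_J_chords by (intro card_Un_disjoint) auto
    ultimately show ?thesis unfolding split by simp
  qed
  moreover have "(\<Sum>B\<in>P. r B) = card (?C - (L \<union> M)) + 2"
  proof -
    have "(\<Sum>B\<in>P - {L,M}. r B) = (\<Sum>B\<in>P - {L,M}. card (?C \<inter> B))" by (intro sum.cong) (auto simp: r_def)
    also have "\<dots> = card (?C - (L \<union> M))"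
      using sum_card_partition[OF P finite_comps_J, of ?C "{L,M}"] L(1) M(1) by (simp add: comps_J)
    moreover have "(\<Sum>B\<in>{L,M}. r B) = 2" using \<open>L \<noteq> M\<close> by (simp add: r_def)
    ultimately show ?thesis unfolding split by simp
  qed
  ultimately show ?thesis unfolding ps(3) by simp
qed

lemma wval_prim_J_pos: "wval_prim (Jdiag (Suc i) j) \<approx> chord_transform j (ladder_val (Suc i))"
proof -
  let ?D = "Jdiag (Suc i) j" and ?C = "J_chords j"
  obtain l where l: "J_core (Suc i) j = {l}" by (simp add: J_core_def)
  have comps: "comps ?D = {l} \<union> ?C" by (simp add: comps_J l)
  \<comment> \<open>With rungs present the core is a single component and cannot be split; the
    condition, always true here, gives the sum the shape of
    \<open>partition_sum_core_together\<close>.\<close>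
  have "wval_prim ?D \<approx> (\<Sum>P | partition_on ({l} \<union> ?C) P. if {l} \<subseteq> block l P
      then scl (pi_coeff (card P)) (Cas ^ card (?C - block l P) * ladder_val (Suc i) (card (?C \<inter> block l P))) else 0)"
    unfolding wval_prim_def comps
  proof (rule ucong_sum)
    fix P assume "P \<in> {P. partition_on ({l} \<union> ?C) P}"
    then have P: "partition_on ({l} \<union> ?C) P" by simp
    have b: "block l P \<in> P" "l \<in> block l P" using block_in[OF P] by simp_all
    have "wval (split_prod ?D P) \<approx> Cas ^ card (?C - block l P) * ladder_val (Suc i) (card (?C \<inter> block l P))"
      using wval_split_together[of "Suc i" j P "block l P"] P b unfolding comps l by blast
    from ucong_scl[OF this] show "scl (pi_coeff (card P)) (wval (split_prod ?D P)) \<approx> (if {l} \<subseteq> block l P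
      then scl (pi_coeff (card P)) (Cas ^ card (?C - block l P) * ladder_val (Suc i) (card (?C \<inter> block l P))) else 0)"
      using b by simp
  qed
  also have "\<dots> = chord_transform (card ?C) (ladder_val (Suc i))"
    by (rule partition_sum_core_together)
      (use J_core_chords_disjoint[of "Suc i" j j] finite_J_chords in \<open>simp_all only: l finite.intros insertI1\<close>)
  finally show ?thesis by (simp only: card_J_chords)
qed

text \<open>The contribution of the splittings that separate the two core chords when there are no
  rungs.\<close>

definition apart_sum :: "nat \<Rightarrow> fa" where
  "apart_sum j = (\<Sum>P | partition_on ({{0,1},{2,3}} \<union> J_chords j) P. if {2,3} \<in> block {0,1} P then 0 else
     scl (pi_coeff (card P)) (Cas_shift ^ card (J_chords j \<inter> (block {0,1} P \<union> block {2,3} P)) *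
       Cas ^ (card (J_chords j - (block {0,1} P \<union> block {2,3} P)) + 2)))"

lemma apart_sum_Suc: "apart_sum (Suc j) = - scl (1 / lam) (apart_sum j)"
  unfolding apart_sum_def J_chords_Suc
proof (rule partition_sum_core_apart)
  show "{0,1} \<noteq> {2,3::nat}"
  proof
    assume eq: "{0,1} = {2,3::nat}"
    have "0 \<in> {0,1::nat}" by simp
    then have "0 \<in> {2,3::nat}" by (simp only: eq)
    then show False by simp
  qed
  have "2 * Suc j + 2 \<in> chord (Suc j)" by (simp add: chord_def)
  moreover have "2 * Suc j + 2 \<notin> {0,1}" "2 * Suc j + 2 \<notin> {2,3}" by simp_all
  ultimately show "chord (Suc j) \<notin> {{0,1},{2,3}}" by (metis insertE emptyE)
qed (simp_all add: finite_J_chords chord_notin_J_chords)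

lemma wval_prim_J_zero: "wval_prim (Jdiag 0 j) \<approx> chord_transform j (ladder_val 0) + apart_sum j"
proof -
  let ?D = "Jdiag 0 j" and ?C = "J_chords j" and ?Q = "{{0,1},{2,3}} :: nat set set"
  let ?V = "\<lambda>P. if {2,3} \<in> block {0,1} P then 0 else
     scl (pi_coeff (card P)) (Cas_shift ^ card (?C \<inter> (block {0,1} P \<union> block {2,3} P)) *
       Cas ^ (card (?C - (block {0,1} P \<union> block {2,3} P)) + 2))"
  let ?G = "\<lambda>P. if ?Q \<subseteq> block {0,1} P
      then scl (pi_coeff (card P)) (Cas ^ card (?C - block {0,1} P) * ladder_val 0 (card (?C \<inter> block {0,1} P))) else 0"
  have core: "J_core 0 j = ?Q" by (simp add: J_core_def)
  have comps: "comps ?D = ?Q \<union> ?C" by (simp only: comps_J core)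
  have "wval_prim ?D \<approx> (\<Sum>P | partition_on (?Q \<union> ?C) P. ?G P + ?V P)"
    unfolding wval_prim_def comps
  proof (rule ucong_sum)
    fix P assume "P \<in> {P. partition_on (?Q \<union> ?C) P}"
    then have P: "partition_on (?Q \<union> ?C) P" by simp
    then have P': "partition_on (comps ?D) P" by (simp only: comps)
    define L M where "L = block {0,1} P" and "M = block {2,3} P"
    have L: "L \<in> P" "{0,1} \<in> L" using block_in[OF P, of "{0,1}"] by (simp_all add: L_def)
    have M: "M \<in> P" "{2,3} \<in> M" using block_in[OF P, of "{2,3}"] by (simp_all add: M_def)
    show "scl (pi_coeff (card P)) (wval (split_prod ?D P)) \<approx> ?G P + ?V P"
    proof (cases "{2,3} \<in> L")
      case True
      then have Q: "?Q \<subseteq> L" using L by simp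
      have "wval (split_prod ?D P) \<approx> Cas ^ card (?C - L) * ladder_val 0 (card (?C \<inter> L))"
        by (rule wval_split_together[OF P' L(1)]) (simp only: core Q)
      from ucong_scl[OF this] show ?thesis using True Q unfolding L_def by simp
    next
      case False
      then have "L \<noteq> M" using M by auto
      from wval_split_apart[OF P' L M this]
      have "wval (split_prod ?D P) \<approx> Cas_shift ^ card (?C \<inter> (L \<union> M)) * Cas ^ (card (?C - (L \<union> M)) + 2)" .
      from ucong_scl[OF this] show ?thesis using False unfolding L_def M_def by simp
    qed
  qed
  also have "\<dots> = (\<Sum>P | partition_on (?Q \<union> ?C) P. ?G P) + apart_sum j"
    unfolding apart_sum_def by (rule sum.distrib)
  also have "(\<Sum>P | partition_on (?Q \<union> ?C) P. ?G P) = chord_transform (card ?C) (ladder_val 0)"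
    by (rule partition_sum_core_together)
      (use J_core_chords_disjoint[of 0 j j] finite_J_chords in \<open>simp_all only: core finite.intros insertI1\<close>)
  finally show ?thesis by (simp only: card_J_chords)
qed

lemma wval_prim_recursion: "wval_prim (Jdiag (Suc i) j) \<approx> wval_prim (Jdiag i (Suc j)) + scl (1 / lam) (wval_prim (Jdiag i j))"
proof (cases i)
  case 0
  have "wval_prim (Jdiag 1 j) \<approx> chord_transform (Suc j) (ladder_val 0) + scl (1 / lam) (chord_transform j (ladder_val 0))"
    using ucong_trans[OF wval_prim_J_pos chord_transform_ladder_val, of 0 j] by simp
  \<comment> \<open>The two inserted terms cancel, since one more chord multiplies
    \<open>apart_sum j\<close> by -1/\<lambda>.\<close>
  also have "\<dots> = (chord_transform (Suc j) (ladder_val 0) + apart_sum (Suc j)) + scl (1 / lam) (chord_transform j (ladder_val 0) + apart_sum j)"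
    unfolding apart_sum_Suc scl_add_right by simp
  also have "\<dots> \<approx> wval_prim (Jdiag 0 (Suc j)) + scl (1 / lam) (wval_prim (Jdiag 0 j))"
    by (intro ucong_add ucong_scl ucong_sym[OF wval_prim_J_zero])
  finally show ?thesis using 0 by simp
next
  case (Suc k)
  have "wval_prim (Jdiag (Suc i) j) \<approx> chord_transform (Suc j) (ladder_val i) + scl (1 / lam) (chord_transform j (ladder_val i))"
    by (rule ucong_trans[OF wval_prim_J_pos chord_transform_ladder_val])
  also have "\<dots> \<approx> wval_prim (Jdiag i (Suc j)) + scl (1 / lam) (wval_prim (Jdiag i j))"
    unfolding Suc by (intro ucong_add ucong_scl ucong_sym[OF wval_prim_J_pos])
  finally show ?thesis .
qed

lemma coef_wval_prim_J: "coef (wval_prim (Jdiag i j)) = wbar m c lam (Jdiag i j)"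
proof (rule coef_wval_prim[OF wf_J finite_comps_J])
  show "comps (Jdiag i j) \<noteq> {}" by (simp add: comps_J J_core_def)
qed

end

theorem theorem1:
  fixes m :: nat and c :: "nat \<Rightarrow> nat \<Rightarrow> nat \<Rightarrow> complex" and lam :: complex and i j :: nat
  assumes "simple_lie m c" and "lam \<noteq> 0" and "i \<ge> 1"
  shows "U_eq m c (wbar m c lam (Jdiag i j))
           (fa_add (wbar m c lam (Jdiag (i - 1) (j + 1)))
                   (fa_smult (1 / lam) (wbar m c lam (Jdiag (i - 1) j))))"
proof -
  interpret simple_lie_form m c lam by unfold_locales (use assms in auto)
  obtain k where i: "i = Suc k" using assms(3) by (cases i) auto
  have "U_eq m c (coef (wval_prim (Jdiag (Suc k) j)))
      (coef (wval_prim (Jdiag k (Suc j)) + scl (1 / lam) (wval_prim (Jdiag k j))))"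
    unfolding U_eq_coef by (rule wval_prim_recursion)
  then show ?thesis unfolding coef_add coef_scl coef_wval_prim_J i by simp
qed

end
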